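(* Let $(E,\tau,M,\rho)$ be a Lie algebroid over a smooth manifold $M$. There exists a unique $\mathbb{R}$-linear graded endomorphism of degree $1$ of the exterior algebra of forms $\Omega(M,E)$, called the $\Omega(M,E)$-valued exterior derivative and denoted by $d_\rho$, which satisfies the following properties: (i) For $f\in\Omega^0(M,E)=C^\infty(M,\mathbb{R})$, $d_\rho f$ is the unique element in $\Omega^1(M,E)$ such that, for each $V\in A^1(M,E)$, $$\langle d_\rho f,V\rangle=\mathcal{L}_\rho(V)f=\langle df,\rho\circ V\rangle=\langle{}^t\!\rho\circ df,V\rangle,$$ where $d$ stands for the usual exterior derivative of smooth functions on $M$ and ${}^t\!\rho:T^*M\to E^*$ is the transpose of the anchor $\rho$. (ii) For $p\geq1$ and $\eta\in\Omega^p(M,E)$, $d_\rho\eta$ is the unique element in $\Omega^{p+1}(M,E)$ such that, for all $V_0,\ldots,V_p\in A^1(M,E)$, $$d_\rho\eta(V_0,\ldots,V_p)=\sum_{i=0}^p(-1)^i\mathcal{L}_\rho(V_i)\bigl(\eta(V_0,\ldots,\widehat{V}_i,\ldots,V_p)\bigr)+\sum_{0\leq i<j\leq p}(-1)^{i+j}\eta\bigl(\{V_i,V_j\},V_0,\ldots,\widehat{V}_i,\ldots,\widehat{V}_j,\ldots,V_p\bigr),$$ where the hat over $V_i$ and $V_j$ means that these terms are omitted.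
   Context: A Lie algebroid $(E,\tau,M,\rho)$ is a smooth real vector bundle $(E,\tau,M)$ of finite rank over a smooth manifold $M$ (with projection $\tau:E\to M$), equipped with a Lie algebra bracket $(s_1,s_2)\mapsto\{s_1,s_2\}$ on the space of smooth sections of $\tau$ and a smooth vector bundle map $\rho:E\to TM$ (the anchor), such that $s\mapsto\rho\circ s$ is a Lie algebra homomorphism into the Lie algebra of smooth vector fields on $M$, and $\{s_1,fs_2\}=f\{s_1,s_2\}+\langle df,\rho\circ s_1\rangle s_2$ for all smooth sections $s_1,s_2$ and all $f\in C^\infty(M,\mathbb{R})$. For $p\in\mathbb{Z}$, $A^p(M,E)$ is the space of smooth sections of $\bigwedge^pE$ and $\Omega^p(M,E)$ the space of smooth sections of $\bigwedge^pE^*$, with degree-$0$ parts equal to $C^\infty(M,\mathbb{R})$ and zero for $p<0$; $\Omega(M,E)=\oplus_p\Omega^p(M,E)$. An element of $\Omega^p(M,E)$ is identified with a skew-symmetric $C^\infty(M,\mathbb{R})$-multilinear map $A^1(M,E)^p\to C^\infty(M,\mathbb{R})$. For $V\in A^1(M,E)$ and $f\in C^\infty(M,\mathbb{R})$, $\mathcal{L}_\rho(V)f=\langle df,\rho\circ V\rangle$ is the derivative of $f$ along the vector field $\rho\circ V$. A linear endomorphism is graded of degree $1$ if it maps $\Omega^p(M,E)$ into $\Omega^{p+1}(M,E)$ for every $p$. *)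

theory Defs
  imports "HOL-Analysis.Analysis" "HOL-Library.FuncSet"
begin

text \<open>For an open set \<open>S\<close> of a finite-dimensional space, \<open>times_diff_on k S f\<close> says that \<open>f\<close> is of
  class \<open>C\<^sup>k\<close> on \<open>S\<close>: all iterated directional derivatives up to order \<open>k\<close> exist and are continuous.\<close>

primrec times_diff_on ::
    "nat \<Rightarrow> 'a::real_normed_vector set \<Rightarrow> ('a \<Rightarrow> 'c::real_normed_vector) \<Rightarrow> bool" where
  "times_diff_on 0 S f \<longleftrightarrow> continuous_on S f"
| "times_diff_on (Suc k) S f \<longleftrightarrow>
     (\<forall>x\<in>S. f differentiable (at x)) \<and>
     (\<forall>v. times_diff_on k S (\<lambda>x. frechet_derivative f (at x) v))"

definition smooth_on :: "'a::real_normed_vector set \<Rightarrow> ('a \<Rightarrow> 'c::real_normed_vector) \<Rightarrow> bool" where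
  "smooth_on S f \<longleftrightarrow> (\<forall>k. times_diff_on k S f)"

text \<open>The points of the manifold form a Hausdorff second countable type \<open>'m\<close>.  The model space \<open>'b\<close> is
  a finite-dimensional real inner product space rather than a \<^class>\<open>euclidean_space\<close>, because the latter
  class excludes dimension \<open>0\<close>.  A chart is a pair of its domain and its coordinate map, whose values
  outside the domain are irrelevant.\<close>

type_synonym ('m, 'b) chart = "'m set \<times> ('m \<Rightarrow> 'b)"

definition finite_dim_type :: "'b::real_vector itself \<Rightarrow> bool" where
  "finite_dim_type _ \<longleftrightarrow> (\<exists>B::'b set. finite B \<and> span B = UNIV)"

definition chart_inv :: "('m, 'b) chart \<Rightarrow> 'b \<Rightarrow> 'm" where
  "chart_inv c = inv_into (fst c) (snd c)"

definition is_chart :: "('m::topological_space, 'b::real_inner) chart \<Rightarrow> bool" where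
  "is_chart c \<longleftrightarrow>
     open (fst c) \<and> open (snd c ` fst c) \<and>
     homeomorphism (fst c) (snd c ` fst c) (snd c) (chart_inv c)"

definition smooth_manifold ::
    "('m::{t2_space,second_countable_topology}, 'b::real_inner) chart set \<Rightarrow> bool" where
  "smooth_manifold A \<longleftrightarrow>
     finite_dim_type TYPE('b) \<and>
     (\<forall>c\<in>A. is_chart c) \<and>
     (\<Union>c\<in>A. fst c) = UNIV \<and>
     (\<forall>c\<in>A. \<forall>c'\<in>A. smooth_on (snd c ` (fst c \<inter> fst c')) (snd c' \<circ> chart_inv c))"

definition mfd_smooth_on ::
    "('m, 'b::real_inner) chart set \<Rightarrow> 'm set \<Rightarrow> ('m \<Rightarrow> 'c::real_normed_vector) \<Rightarrow> bool" where
  "mfd_smooth_on A W g \<longleftrightarrow> (\<forall>c\<in>A. smooth_on (snd c ` (fst c \<inter> W)) (g \<circ> chart_inv c))"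

definition smooth_functions :: "('m, 'b::real_inner) chart set \<Rightarrow> ('m \<Rightarrow> real) set" where
  "smooth_functions A = {f. mfd_smooth_on A UNIV f}"

text \<open>A bundle over \<open>'m\<close> consists of its total space, its projection, the vector space operations
  of the fibres, and a bundle atlas.  An element \<open>(U, \<psi>)\<close> of the atlas stands for the local
  trivialisation \<open>e \<mapsto> (proj e, \<psi> e)\<close> of the part over \<open>U\<close>, with values in \<open>U \<times> 'f\<close>.  The manifold
  structure of the total space is the one for which all these trivialisations are diffeomorphisms.\<close>

record ('m, 'e, 'f) vbundle =
  total :: "'e set"
  proj :: "'e \<Rightarrow> 'm"
  vzero :: "'m \<Rightarrow> 'e"
  vplus :: "'e \<Rightarrow> 'e \<Rightarrow> 'e"
  vscale :: "real \<Rightarrow> 'e \<Rightarrow> 'e"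
  trivs :: "('m set \<times> ('e \<Rightarrow> 'f)) set"

definition fibre :: "('m, 'e, 'f) vbundle \<Rightarrow> 'm \<Rightarrow> 'e set" where
  "fibre E x = {e \<in> total E. proj E e = x}"

definition triv_inv :: "('m, 'e, 'f) vbundle \<Rightarrow> ('e \<Rightarrow> 'f) \<Rightarrow> 'm \<Rightarrow> 'f \<Rightarrow> 'e" where
  "triv_inv E \<psi> x = inv_into (fibre E x) \<psi>"

text \<open>The vector space axioms on the fibres are not listed, since they are transported from \<open>'f\<close>
  by the fibrewise linear bijections.  Transition functions are maps into the linear endomorphisms
  of the finite-dimensional space \<open>'f\<close>; their smoothness is tested on each vector \<open>w\<close>.\<close>

definition vector_bundle ::
    "('m::{t2_space,second_countable_topology}, 'b::real_inner) chart set \<Rightarrow>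
     ('m, 'e, 'f::real_inner) vbundle \<Rightarrow> bool" where
  "vector_bundle A E \<longleftrightarrow>
     smooth_manifold A \<and> finite_dim_type TYPE('f) \<and>
     (\<forall>x. vzero E x \<in> fibre E x) \<and>
     (\<forall>x. \<forall>a\<in>fibre E x. \<forall>b\<in>fibre E x. vplus E a b \<in> fibre E x) \<and>
     (\<forall>x r. \<forall>a\<in>fibre E x. vscale E r a \<in> fibre E x) \<and>
     (\<forall>(U, \<psi>)\<in>trivs E. open U \<and>
        (\<forall>x\<in>U. bij_betw \<psi> (fibre E x) UNIV \<and>
           \<psi> (vzero E x) = 0 \<and>
           (\<forall>a\<in>fibre E x. \<forall>b\<in>fibre E x. \<psi> (vplus E a b) = \<psi> a + \<psi> b) \<and>
           (\<forall>r. \<forall>a\<in>fibre E x. \<psi> (vscale E r a) = r *\<^sub>R \<psi> a))) \<and>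
     (\<Union>(U, \<psi>)\<in>trivs E. U) = UNIV \<and>
     (\<forall>(U, \<psi>)\<in>trivs E. \<forall>(U', \<psi>')\<in>trivs E. \<forall>w.
        mfd_smooth_on A (U \<inter> U') (\<lambda>x. \<psi>' (triv_inv E \<psi> x w)))"

definition sections ::
    "('m, 'b::real_inner) chart set \<Rightarrow> ('m, 'e, 'f::real_inner) vbundle \<Rightarrow> ('m \<Rightarrow> 'e) set" where
  "sections A E = {s. (\<forall>x. s x \<in> fibre E x) \<and> (\<forall>(U, \<psi>)\<in>trivs E. mfd_smooth_on A U (\<psi> \<circ> s))}"

definition sec_add :: "('m, 'e, 'f) vbundle \<Rightarrow> ('m \<Rightarrow> 'e) \<Rightarrow> ('m \<Rightarrow> 'e) \<Rightarrow> 'm \<Rightarrow> 'e" where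
  "sec_add E s t = (\<lambda>x. vplus E (s x) (t x))"

definition sec_mult :: "('m, 'e, 'f) vbundle \<Rightarrow> ('m \<Rightarrow> real) \<Rightarrow> ('m \<Rightarrow> 'e) \<Rightarrow> 'm \<Rightarrow> 'e" where
  "sec_mult E f s = (\<lambda>x. vscale E (f x) (s x))"

definition vbundle_map ::
    "('m, 'b::real_inner) chart set \<Rightarrow> ('m, 'e, 'f::real_inner) vbundle \<Rightarrow>
     ('m, 'g, 'h::real_inner) vbundle \<Rightarrow> ('e \<Rightarrow> 'g) \<Rightarrow> bool" where
  "vbundle_map A E G \<rho> \<longleftrightarrow>
     (\<forall>x. \<forall>a\<in>fibre E x. \<rho> a \<in> fibre G x) \<and>
     (\<forall>x. \<forall>a\<in>fibre E x. \<forall>b\<in>fibre E x. \<rho> (vplus E a b) = vplus G (\<rho> a) (\<rho> b)) \<and>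
     (\<forall>x r. \<forall>a\<in>fibre E x. \<rho> (vscale E r a) = vscale G r (\<rho> a)) \<and>
     (\<forall>(U, \<psi>)\<in>trivs E. \<forall>(U', \<psi>')\<in>trivs G. \<forall>w.
        mfd_smooth_on A (U \<inter> U') (\<lambda>x. \<psi>' (\<rho> (triv_inv E \<psi> x w))))"

text \<open>A tangent vector at \<open>x\<close> is the family of its coordinate vectors in all charts around \<open>x\<close>,
  related by the derivatives of the coordinate changes; the family is \<open>0\<close> at all other charts.\<close>

definition tangent_space ::
    "('m, 'b::real_inner) chart set \<Rightarrow> 'm \<Rightarrow> (('m, 'b) chart \<Rightarrow> 'b) set" where
  "tangent_space A x =
     {v. (\<forall>c\<in>A. \<forall>c'\<in>A. x \<in> fst c \<longrightarrow> x \<in> fst c' \<longrightarrow>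
            v c' = frechet_derivative (snd c' \<circ> chart_inv c) (at (snd c x)) (v c)) \<and>
         (\<forall>c. \<not> (c \<in> A \<and> x \<in> fst c) \<longrightarrow> v c = 0)}"

type_synonym ('m, 'b) tangent = "'m \<times> (('m, 'b) chart \<Rightarrow> 'b)"

definition tangent_bundle ::
    "('m, 'b::real_inner) chart set \<Rightarrow> ('m, ('m, 'b) tangent, 'b) vbundle" where
  "tangent_bundle A =
     \<lparr> total = {(x, v). v \<in> tangent_space A x},
       proj = fst,
       vzero = (\<lambda>x. (x, \<lambda>c. 0)),
       vplus = (\<lambda>a b. (fst a, \<lambda>c. snd a c + snd b c)),
       vscale = (\<lambda>r a. (fst a, \<lambda>c. r *\<^sub>R snd a c)),
       trivs = (\<lambda>c. (fst c, \<lambda>a. snd a c)) ` A \<rparr>"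

text \<open>Derivative of a smooth function along a tangent vector.  By the chain rule it does not depend
  on the chart that is chosen.\<close>

definition tangent_deriv ::
    "('m, 'b::real_inner) chart set \<Rightarrow> ('m, 'b) tangent \<Rightarrow> ('m \<Rightarrow> real) \<Rightarrow> real" where
  "tangent_deriv A a f =
     (let c = (SOME c. c \<in> A \<and> fst a \<in> fst c)
      in frechet_derivative (f \<circ> chart_inv c) (at (snd c (fst a))) (snd a c))"

definition vf_deriv ::
    "('m, 'b::real_inner) chart set \<Rightarrow> ('m \<Rightarrow> ('m, 'b) tangent) \<Rightarrow> ('m \<Rightarrow> real) \<Rightarrow> 'm \<Rightarrow> real" where
  "vf_deriv A X f = (\<lambda>x. tangent_deriv A (X x) f)"

text \<open>\<open>is_vf_bracket A X Y Z\<close> says that \<open>Z\<close> is the Lie bracket \<open>[X, Y]\<close> of smooth vector fields: it is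
  the unique vector field that acts on smooth functions as the commutator.\<close>

definition is_vf_bracket ::
    "('m, 'b::real_inner) chart set \<Rightarrow> ('m \<Rightarrow> ('m, 'b) tangent) \<Rightarrow> ('m \<Rightarrow> ('m, 'b) tangent) \<Rightarrow>
     ('m \<Rightarrow> ('m, 'b) tangent) \<Rightarrow> bool" where
  "is_vf_bracket A X Y Z \<longleftrightarrow>
     Z \<in> sections A (tangent_bundle A) \<and>
     (\<forall>f\<in>smooth_functions A. \<forall>x.
        vf_deriv A Z f x = vf_deriv A X (vf_deriv A Y f) x - vf_deriv A Y (vf_deriv A X f) x)"

text \<open>The fibre of the \<open>p\<close>-th exterior power of the dual bundle at \<open>x\<close> is realised as the space of
  skew-symmetric \<open>p\<close>-linear forms on the fibre \<open>E\<^sub>x\<close>.  Forms are extended by \<open>0\<close> to lists that are not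
  \<open>p\<close>-tuples of elements of \<open>E\<^sub>x\<close>, so that equality of functions is equality of forms.\<close>

definition alt_forms :: "('m, 'e, 'f) vbundle \<Rightarrow> 'm \<Rightarrow> nat \<Rightarrow> ('e list \<Rightarrow> real) set" where
  "alt_forms E x p =
     {\<omega>. (\<forall>vs. \<not> (length vs = p \<and> set vs \<subseteq> fibre E x) \<longrightarrow> \<omega> vs = 0) \<and>
         (\<forall>vs i a b. length vs = p \<and> set vs \<subseteq> fibre E x \<and> i < p \<and> a \<in> fibre E x \<and> b \<in> fibre E x \<longrightarrow>
            \<omega> (vs[i := vplus E a b]) = \<omega> (vs[i := a]) + \<omega> (vs[i := b])) \<and>
         (\<forall>vs i r a. length vs = p \<and> set vs \<subseteq> fibre E x \<and> i < p \<and> a \<in> fibre E x \<longrightarrow>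
            \<omega> (vs[i := vscale E r a]) = r * \<omega> (vs[i := a])) \<and>
         (\<forall>vs i j. length vs = p \<and> set vs \<subseteq> fibre E x \<and> i < j \<and> j < p \<longrightarrow>
            \<omega> (vs[i := vs ! j, j := vs ! i]) = - \<omega> vs)}"

type_synonym ('m, 'e) form = "'m \<Rightarrow> 'e list \<Rightarrow> real"

definition zero_form :: "('m, 'e) form" where
  "zero_form = (\<lambda>x vs. 0)"

text \<open>Smoothness of a section of the exterior power is smoothness of its coefficients in the
  trivialisations induced by those of \<open>E\<close>.\<close>

definition forms ::
    "('m, 'b::real_inner) chart set \<Rightarrow> ('m, 'e, 'f::real_inner) vbundle \<Rightarrow> int \<Rightarrow> ('m, 'e) form set" where
  "forms A E p =
     (if p < 0 then {zero_form}
      else {\<eta>. (\<forall>x. \<eta> x \<in> alt_forms E x (nat p)) \<and>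
               (\<forall>(U, \<psi>)\<in>trivs E. \<forall>ws. length ws = nat p \<longrightarrow>
                  mfd_smooth_on A U (\<lambda>x. \<eta> x (map (triv_inv E \<psi> x) ws)))})"

definition eval_form :: "('m, 'e) form \<Rightarrow> ('m \<Rightarrow> 'e) list \<Rightarrow> 'm \<Rightarrow> real" where
  "eval_form \<eta> Vs = (\<lambda>x. \<eta> x (map (\<lambda>V. V x) Vs))"

definition fun_form :: "('m \<Rightarrow> real) \<Rightarrow> ('m, 'e) form" where
  "fun_form f = (\<lambda>x vs. if vs = [] then f x else 0)"

definition differential ::
    "('m, 'b::real_inner) chart set \<Rightarrow> ('m \<Rightarrow> real) \<Rightarrow> ('m, ('m, 'b) tangent) form" where
  "differential A f =
     (\<lambda>x vs. if length vs = 1 \<and> set vs \<subseteq> fibre (tangent_bundle A) x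
             then tangent_deriv A (hd vs) f else 0)"

text \<open>Composition of a form of degree \<open>1\<close> with the transpose of a bundle map \<open>\<rho>\<close> defined on \<open>E\<close>.\<close>

definition transpose_comp ::
    "('m, 'e, 'f) vbundle \<Rightarrow> ('e \<Rightarrow> 'g) \<Rightarrow> ('m, 'g) form \<Rightarrow> ('m, 'e) form" where
  "transpose_comp E \<rho> \<xi> =
     (\<lambda>x vs. if length vs = 1 \<and> set vs \<subseteq> fibre E x then \<xi> x [\<rho> (hd vs)] else 0)"

definition ext_forms ::
    "('m, 'b::real_inner) chart set \<Rightarrow> ('m, 'e, 'f::real_inner) vbundle \<Rightarrow> (int \<Rightarrow> ('m, 'e) form) set" where
  "ext_forms A E = {\<omega>. (\<forall>p. \<omega> p \<in> forms A E p) \<and> finite {p. \<omega> p \<noteq> zero_form}}"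

definition homogeneous :: "int \<Rightarrow> ('m, 'e) form \<Rightarrow> int \<Rightarrow> ('m, 'e) form" where
  "homogeneous p \<eta> = (\<lambda>q. if q = p then \<eta> else zero_form)"

definition ext_add ::
    "(int \<Rightarrow> ('m, 'e) form) \<Rightarrow> (int \<Rightarrow> ('m, 'e) form) \<Rightarrow> int \<Rightarrow> ('m, 'e) form" where
  "ext_add \<omega> \<theta> = (\<lambda>p x vs. \<omega> p x vs + \<theta> p x vs)"

definition ext_scale :: "real \<Rightarrow> (int \<Rightarrow> ('m, 'e) form) \<Rightarrow> int \<Rightarrow> ('m, 'e) form" where
  "ext_scale r \<omega> = (\<lambda>p x vs. r * \<omega> p x vs)"

text \<open>Endomorphisms are extensional functions, that is, \<^const>\<open>undefined\<close> outside of
  \<^const>\<open>ext_forms\<close>, so that they are determined by their values on forms.\<close>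

definition graded_endo ::
    "('m, 'b::real_inner) chart set \<Rightarrow> ('m, 'e, 'f::real_inner) vbundle \<Rightarrow> int \<Rightarrow>
     ((int \<Rightarrow> ('m, 'e) form) \<Rightarrow> (int \<Rightarrow> ('m, 'e) form)) \<Rightarrow> bool" where
  "graded_endo A E k d \<longleftrightarrow>
     d \<in> ext_forms A E \<rightarrow>\<^sub>E ext_forms A E \<and>
     (\<forall>\<omega>\<in>ext_forms A E. \<forall>\<theta>\<in>ext_forms A E. d (ext_add \<omega> \<theta>) = ext_add (d \<omega>) (d \<theta>)) \<and>
     (\<forall>r. \<forall>\<omega>\<in>ext_forms A E. d (ext_scale r \<omega>) = ext_scale r (d \<omega>)) \<and>
     (\<forall>p. \<forall>\<eta>\<in>forms A E p. \<exists>\<theta>\<in>forms A E (p + k). d (homogeneous p \<eta>) = homogeneous (p + k) \<theta>)"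

locale lie_algebroid =
  fixes A :: "('m::{t2_space,second_countable_topology}, 'b::real_inner) chart set"
    and E :: "('m, 'e, 'f::real_inner) vbundle"
    and \<rho> :: "'e \<Rightarrow> ('m, 'b) tangent"
    and bracket :: "('m \<Rightarrow> 'e) \<Rightarrow> ('m \<Rightarrow> 'e) \<Rightarrow> 'm \<Rightarrow> 'e"
  assumes is_bundle: "vector_bundle A E"
    and anchor: "vbundle_map A E (tangent_bundle A) \<rho>"
    and bracket_closed:
      "\<lbrakk>s \<in> sections A E; t \<in> sections A E\<rbrakk> \<Longrightarrow> bracket s t \<in> sections A E"
    and bracket_add_left:
      "\<lbrakk>s \<in> sections A E; s' \<in> sections A E; t \<in> sections A E\<rbrakk> \<Longrightarrow>
         bracket (sec_add E s s') t = sec_add E (bracket s t) (bracket s' t)"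
    and bracket_add_right:
      "\<lbrakk>s \<in> sections A E; t \<in> sections A E; t' \<in> sections A E\<rbrakk> \<Longrightarrow>
         bracket s (sec_add E t t') = sec_add E (bracket s t) (bracket s t')"
    and bracket_scale_left:
      "\<lbrakk>s \<in> sections A E; t \<in> sections A E\<rbrakk> \<Longrightarrow>
         bracket (sec_mult E (\<lambda>x. r) s) t = sec_mult E (\<lambda>x. r) (bracket s t)"
    and bracket_scale_right:
      "\<lbrakk>s \<in> sections A E; t \<in> sections A E\<rbrakk> \<Longrightarrow>
         bracket s (sec_mult E (\<lambda>x. r) t) = sec_mult E (\<lambda>x. r) (bracket s t)"
    and bracket_alternating:
      "s \<in> sections A E \<Longrightarrow> bracket s s = vzero E"
    and jacobi:
      "\<lbrakk>s \<in> sections A E; t \<in> sections A E; u \<in> sections A E\<rbrakk> \<Longrightarrow>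
         sec_add E (bracket s (bracket t u))
           (sec_add E (bracket t (bracket u s)) (bracket u (bracket s t))) = vzero E"
    and anchor_bracket:
      "\<lbrakk>s \<in> sections A E; t \<in> sections A E\<rbrakk> \<Longrightarrow>
         is_vf_bracket A (\<rho> \<circ> s) (\<rho> \<circ> t) (\<rho> \<circ> bracket s t)"
    and leibniz:
      "\<lbrakk>s \<in> sections A E; t \<in> sections A E; f \<in> smooth_functions A\<rbrakk> \<Longrightarrow>
         bracket s (sec_mult E f t) =
           sec_add E (sec_mult E f (bracket s t))
             (sec_mult E (eval_form (differential A f) [\<rho> \<circ> s]) t)"

definition anchor_deriv ::
    "('m, 'b::real_inner) chart set \<Rightarrow> ('e \<Rightarrow> ('m, 'b) tangent) \<Rightarrow> ('m \<Rightarrow> 'e) \<Rightarrow> ('m \<Rightarrow> real) \<Rightarrow>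
     'm \<Rightarrow> real" where
  "anchor_deriv A \<rho> V f = vf_deriv A (\<rho> \<circ> V) f"

text \<open>\<open>omit I p V\<close> is the list \<open>V\<^sub>0, \<dots>, V\<^sub>p\<close> without the entries whose index is in \<open>I\<close>.\<close>

definition omit :: "nat set \<Rightarrow> nat \<Rightarrow> (nat \<Rightarrow> 'a) \<Rightarrow> 'a list" where
  "omit I p V = map V (filter (\<lambda>k. k \<notin> I) [0..<Suc p])"

end

theory Submission
  imports Defs
begin

text \<open>
  Cartan's formula \<open>i\<^sub>V d\<eta> = L\<^sub>V \<eta> - d(i\<^sub>V \<eta>)\<close>, read as a recursion on the list of arguments, defines
  \<open>d\<eta>\<close> on sections.  With it, skew-symmetry and linearity over smooth functions follow by
  induction: the Lie derivative preserves both properties, which gives linearity in all slots but the first,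
  and swapping the first two slots reduces the first one to the case of degree \<open>0\<close>.  A map on sections
  that is linear over smooth functions depends only on the values of the sections at the point of
  evaluation, by means of bump functions, and hence comes from a unique form.
\<close>

section \<open>Calculus of smooth maps\<close>

text \<open>Why a recursion and not the alternating sum: in the sum, linearity over functions rests
  on cancellations between derivatives of \<open>f\<close> and the Leibniz terms of the brackets,
  scattered over all pairs of indices. The recursion confines them to the Lie derivative, where
  differentiating \<open>f\<close> in a slot \<open>f X\<close> produces
  \<open>(L V f) F(X, ...)\<close> and the bracket \<open>{V, f X}\<close> removes it. The Lie
  derivative is not linear over functions in \<open>V\<close> itself, which is why the first slot
  needs an argument of its own. The analytic obstacle is that smoothness of derivatives and of
  bundle data is given on fixed vectors, while the vectors that occur move with the point. Model
  space and typical fibre are inner product spaces with a finite spanning set, so an orthonormal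
  expansion turns each such expression into a finite sum of products. The same expansion makes
  closed balls compact, so that the supports of bump functions are closed in the whole
  manifold.\<close>

lemma times_diff_on_imp_continuous_on: "times_diff_on k S f \<Longrightarrow> continuous_on S f"
  by (cases k) (auto intro!: continuous_at_imp_continuous_on differentiable_imp_continuous_within)

lemma times_diff_on_SucD: "times_diff_on (Suc k) S f \<Longrightarrow> times_diff_on k S f"
  by (induction k arbitrary: f) (auto dest: times_diff_on_imp_continuous_on intro!: continuous_at_imp_continuous_on differentiable_imp_continuous_within)

lemma times_diff_on_subset: "times_diff_on k S f \<Longrightarrow> T \<subseteq> S \<Longrightarrow> times_diff_on k T f"
  by (induction k arbitrary: f) (auto intro: continuous_on_subset)

text \<open>A derivative at a point of \<open>S\<close> depends on values in a neighbourhood of it,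
  so agreement on \<open>S\<close> suffices because \<open>S\<close> is open.\<close>

lemma times_diff_on_cong:
  "times_diff_on k S f \<Longrightarrow> open S \<Longrightarrow> (\<And>x. x \<in> S \<Longrightarrow> f x = g x) \<Longrightarrow> times_diff_on k S g"
proof (induction k arbitrary: f g)
  case 0
  then show ?case by (simp cong: continuous_on_cong)
next
  case (Suc k)
  have "g differentiable (at x)" if "x \<in> S" for x
    using that Suc.prems unfolding differentiable_def times_diff_on.simps
    by (metis has_derivative_transform_within_open)
  moreover have "times_diff_on k S (\<lambda>x. frechet_derivative g (at x) v)" for v
  proof (rule Suc.IH)
    show "times_diff_on k S (\<lambda>x. frechet_derivative f (at x) v)" using Suc.prems by simp
    show "frechet_derivative f (at x) v = frechet_derivative g (at x) v" if "x \<in> S" for x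
      using frechet_derivative_transform_within_open[of f x S g] Suc.prems that by auto
  qed fact
  ultimately show ?case by simp
qed

lemma times_diff_on_local:
  "(\<And>x. x \<in> S \<Longrightarrow> \<exists>N. open N \<and> x \<in> N \<and> times_diff_on k N f) \<Longrightarrow> times_diff_on k S f"
proof (induction k arbitrary: f)
  case 0
  have "isCont f x" if "x \<in> S" for x
    using 0[OF that] continuous_on_eq_continuous_at by (metis times_diff_on.simps(1))
  then show ?case by (simp add: continuous_at_imp_continuous_on)
next
  case (Suc k)
  have "f differentiable (at x)" if "x \<in> S" for x using Suc.prems[OF that] by auto
  moreover have "times_diff_on k S (\<lambda>x. frechet_derivative f (at x) v)" for v
  proof (rule Suc.IH)
    show "\<exists>N. open N \<and> x \<in> N \<and> times_diff_on k N (\<lambda>x. frechet_derivative f (at x) v)" if "x \<in> S" for x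
      using Suc.prems[OF that] by auto
  qed
  ultimately show ?case by simp
qed

lemma times_diff_on_const: "times_diff_on k S (\<lambda>x. c)"
  by (induction k arbitrary: c) auto

lemma times_diff_on_ident: "times_diff_on k S (\<lambda>x. x)"
  by (cases k) (auto simp: times_diff_on_const)

lemma times_diff_on_has_derivative:
  "times_diff_on (Suc k) S f \<Longrightarrow> x \<in> S \<Longrightarrow> (f has_derivative frechet_derivative f (at x)) (at x)"
  by (simp add: frechet_derivative_works)

text \<open>An explicit derivative \<open>D\<close> takes the place of
  \<open>frechet_derivative\<close>. Each closure property below is then an induction on
  \<open>k\<close> in which the formula for \<open>D\<close> is again built from functions of class
  \<open>k\<close>.\<close>

lemma times_diff_on_SucI:
  assumes "open S" and d: "\<And>x. x \<in> S \<Longrightarrow> (f has_derivative D x) (at x)"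
    and "\<And>v. times_diff_on k S (\<lambda>x. D x v)"
  shows "times_diff_on (Suc k) S f"
proof -
  have "D x v = frechet_derivative f (at x) v" if "x \<in> S" for x v
    using frechet_derivative_at[OF d[OF that]] by simp
  then have "times_diff_on k S (\<lambda>x. frechet_derivative f (at x) v)" for v
    using times_diff_on_cong[OF assms(3)[of v] assms(1), of "\<lambda>x. frechet_derivative f (at x) v"] by simp
  then show ?thesis using d by (auto simp: differentiable_def)
qed

lemma times_diff_on_add:
  assumes "open S"
  shows "times_diff_on k S f \<Longrightarrow> times_diff_on k S g \<Longrightarrow> times_diff_on k S (\<lambda>x. f x + g x)"
proof (induction k arbitrary: f g)
  case 0
  then show ?case by (simp add: continuous_on_add)
next
  case (Suc k)
  show ?case
    by (rule times_diff_on_SucI[OF assms has_derivative_add[OF Suc.prems[THEN times_diff_on_has_derivative]]])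
      (use Suc in auto)
qed

text \<open>One product rule for multiplication, scalar multiplication and the inner
  product.\<close>

lemma times_diff_on_bilinear:
  assumes b: "bounded_bilinear b" and "open S"
  shows "times_diff_on k S f \<Longrightarrow> times_diff_on k S g \<Longrightarrow> times_diff_on k S (\<lambda>x. b (f x) (g x))"
proof (induction k arbitrary: f g)
  case 0
  then show ?case using bounded_bilinear.continuous_on[OF b] by simp
next
  case (Suc k)
  show ?case
    by (rule times_diff_on_SucI[OF assms(2)
          bounded_bilinear.FDERIV[OF b Suc.prems[THEN times_diff_on_has_derivative]]])
      (use Suc.prems Suc.IH Suc.prems[THEN times_diff_on_SucD] in \<open>auto intro!: times_diff_on_add[OF assms(2)]\<close>)
qed

lemma times_diff_on_sum:
  "open S \<Longrightarrow> (\<And>i. i \<in> I \<Longrightarrow> times_diff_on k S (f i)) \<Longrightarrow> times_diff_on k S (\<lambda>x. \<Sum>i\<in>I. f i x)"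
  by (induction I rule: infinite_finite_induct) (auto simp: times_diff_on_const intro!: times_diff_on_add)

lemma times_diff_on_inverse:
  fixes f :: "'a::real_normed_vector \<Rightarrow> real"
  assumes "open S" "\<And>x. x \<in> S \<Longrightarrow> f x \<noteq> 0"
  shows "times_diff_on k S f \<Longrightarrow> times_diff_on k S (\<lambda>x. inverse (f x))"
proof (induction k)
  case 0
  then show ?case using assms by (simp add: continuous_on_inverse)
next
  case (Suc k)
  show ?case
  proof (rule times_diff_on_SucI[OF assms(1)])
    fix x assume "x \<in> S"
    then have "((\<lambda>x. inverse (f x)) has_derivative
      (\<lambda>v. - (inverse (f x) * frechet_derivative f (at x) v * inverse (f x)))) (at x)"
      using assms(2) times_diff_on_has_derivative[OF Suc.prems] by (intro Deriv.has_derivative_inverse) auto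
    \<comment> \<open>The sign is written as a factor \<open>-1\<close>, so that the product rule
      covers the whole expression.\<close>
    then show "((\<lambda>x. inverse (f x)) has_derivative
      (\<lambda>v. (-1) * (inverse (f x) * frechet_derivative f (at x) v * inverse (f x)))) (at x)"
      by simp
  next
    fix v
    have "times_diff_on k S (\<lambda>x. inverse (f x))" "times_diff_on k S (\<lambda>x. frechet_derivative f (at x) v)"
      using Suc times_diff_on_SucD by auto
    then show "times_diff_on k S (\<lambda>x. (-1) * (inverse (f x) * frechet_derivative f (at x) v * inverse (f x)))"
      by (intro times_diff_on_bilinear[OF bounded_bilinear_mult] assms(1) times_diff_on_const)
  qed
qed

section \<open>Orthonormal expansions in finite-dimensional inner product spaces\<close>

text \<open>Records the two properties that are used. Orthogonality follows from them, by pairing an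
  element of \<open>B\<close> with its own expansion. In dimension 0 the set \<open>B\<close> is
  empty.\<close>

definition orthonormal_expansion :: "'b::real_inner set \<Rightarrow> bool" where
  "orthonormal_expansion B \<longleftrightarrow>
     finite B \<and> (\<forall>b\<in>B. norm b = 1) \<and> (\<forall>w. w = (\<Sum>b\<in>B. (w \<bullet> b) *\<^sub>R b))"

lemma finite_dim_type_orthonormal:
  assumes "finite_dim_type TYPE('b::real_inner)"
  obtains B :: "'b::real_inner set" where "orthonormal_expansion B"
proof -
  obtain B0 :: "'b set" where "finite B0" "span B0 = UNIV" using assms by (auto simp: finite_dim_type_def)
  then obtain C :: "'b set" where C: "finite C" "span C = UNIV" "pairwise orthogonal C"
    using basis_orthogonal by metis
  \<comment> \<open>An orthogonal spanning set may contain 0, which cannot be normalised and adds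
    nothing to the span.\<close>
  define B where "B = (\<lambda>c. c /\<^sub>R norm c) ` (C - {0})"
  have fin: "finite B" using C by (simp add: B_def)
  have norm: "norm b = 1" if "b \<in> B" for b using that left_inverse by (fastforce simp: B_def)
  have orth: "b \<bullet> b' = 0" if bb: "b \<in> B" "b' \<in> B" "b \<noteq> b'" for b b'
  proof -
    obtain c c' where c: "b = c /\<^sub>R norm c" "b' = c' /\<^sub>R norm c'" "c \<in> C" "c' \<in> C"
      using bb unfolding B_def by blast
    then have "c \<noteq> c'" using bb(3) by auto
    then show ?thesis using C(3) c by (simp add: pairwise_def orthogonal_def)
  qed
  \<comment> \<open>The vectors that satisfy the expansion form a subspace; it contains a spanning
    set, hence everything.\<close>
  let ?W = "{w. w = (\<Sum>b\<in>B. (w \<bullet> b) *\<^sub>R b)}"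
  have sub: "subspace ?W"
    unfolding subspace_def
    by (simp add: inner_add_left scaleR_add_left sum.distrib flip: scaleR_scaleR scaleR_sum_right)
  have b: "b \<in> ?W" if "b \<in> B" for b
  proof -
    have "(\<Sum>b'\<in>B. (b \<bullet> b') *\<^sub>R b') = (\<Sum>b'\<in>B. if b' = b then b else 0)"
      using that norm orth by (intro sum.cong) (auto simp: norm_eq_1)
    then show ?thesis using that fin by simp
  qed
  have "c \<in> ?W" if "c \<in> C" for c
  proof (cases "c = 0")
    case False
    have "norm c *\<^sub>R (c /\<^sub>R norm c) \<in> ?W"
      by (rule subspace_scale[OF sub b]) (use that False in \<open>auto simp: B_def\<close>)
    then show ?thesis using False by simp
  qed auto
  then have "span C \<subseteq> ?W" using sub span_minimal by blast
  then show ?thesis using that[of B] fin norm C(2) unfolding orthonormal_expansion_def by blast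
qed

text \<open>Trades a moving argument of \<open>T\<close> for finitely many fixed ones with scalar
  coefficients.\<close>

lemma linear_expand:
  fixes T :: "'b::real_inner \<Rightarrow> 'c::real_normed_vector"
  assumes "orthonormal_expansion B" "linear T"
  shows "T w = (\<Sum>b\<in>B. (w \<bullet> b) *\<^sub>R T b)"
proof -
  have "w = (\<Sum>b\<in>B. (w \<bullet> b) *\<^sub>R b)" using assms(1) unfolding orthonormal_expansion_def by blast
  then have "T w = T (\<Sum>b\<in>B. (w \<bullet> b) *\<^sub>R b)" by simp
  then show ?thesis by (simp only: linear_sum[OF assms(2)] linear_scale[OF assms(2)])
qed

text \<open>The chain rule evaluates the derivative of \<open>g\<close> in the direction
  \<open>f'(x) v\<close>, which varies with \<open>x\<close>, whereas the induction hypothesis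
  speaks of fixed directions. Expanding this direction in \<open>B\<close> leaves the functions
  \<open>g'(f x) b\<close>, to which the hypothesis applies.\<close>

lemma times_diff_on_compose:
  fixes f :: "'a::real_normed_vector \<Rightarrow> 'b::real_inner" and g :: "'b \<Rightarrow> 'c::real_normed_vector"
    and B :: "'b set"
  assumes B: "orthonormal_expansion B" and "open S" "f ` S \<subseteq> T"
  shows "times_diff_on k T g \<Longrightarrow> times_diff_on k S f \<Longrightarrow> times_diff_on k S (\<lambda>x. g (f x))"
proof (induction k arbitrary: g)
  case 0
  then show ?case using continuous_on_compose2[OF _ _ assms(3)] by simp
next
  case (Suc k)
  show ?case
  proof (rule times_diff_on_SucI[OF assms(2)])
    fix x assume x: "x \<in> S"
    have dg: "(g has_derivative frechet_derivative g (at (f x))) (at (f x))"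
      using x assms(3) by (intro times_diff_on_has_derivative[OF Suc.prems(1)]) auto
    then have lin: "linear (frechet_derivative g (at (f x)))" using has_derivative_linear by blast
    show "((\<lambda>x. g (f x)) has_derivative
        (\<lambda>v. \<Sum>b\<in>B. (frechet_derivative f (at x) v \<bullet> b) *\<^sub>R frechet_derivative g (at (f x)) b)) (at x)"
      using has_derivative_compose[OF times_diff_on_has_derivative[OF Suc.prems(2) x] dg]
      by (simp only: linear_expand[OF B lin, symmetric])
  next
    show "times_diff_on k S (\<lambda>x. \<Sum>b\<in>B. (frechet_derivative f (at x) v \<bullet> b) *\<^sub>R frechet_derivative g (at (f x)) b)" for v
      using Suc.prems times_diff_on_SucD[OF Suc.prems(2)]
      by (intro times_diff_on_sum times_diff_on_bilinear[OF bounded_bilinear_scaleR]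
          times_diff_on_bilinear[OF bounded_bilinear_inner] assms(2) times_diff_on_const Suc.IH) auto
  qed
qed

lemma orthonormal_expansion_real: "orthonormal_expansion {1::real}"
  by (simp add: orthonormal_expansion_def)

section \<open>Bump functions on the model space\<close>

text \<open>The usual \<open>exp (-1/x)\<close>, times powers of \<open>1/x\<close>. With these
  powers the family is closed under differentiation up to linear combinations, so its smoothness is
  a single induction with \<open>n\<close> arbitrary.\<close>

definition flat :: "nat \<Rightarrow> real \<Rightarrow> real" where
  "flat n x = (if x > 0 then exp (- inverse x) * inverse x ^ n else 0)"

lemma flat_tendsto_0: "(flat n \<longlongrightarrow> 0) (at 0)"
proof (rule filterlim_split_at)
  have "\<forall>\<^sub>F x in at_left 0. 0 = flat n x"
    by (auto simp: eventually_at_filter flat_def)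
  then show "(flat n \<longlongrightarrow> 0) (at_left 0)" by (rule Lim_transform_eventually[OF tendsto_const])
  have "((\<lambda>x. inverse x ^ n / exp (inverse x)) \<longlongrightarrow> (0::real)) (at_right 0)"
    by (rule filterlim_compose[OF tendsto_power_div_exp_0 filterlim_inverse_at_top_right])
  moreover have "\<forall>\<^sub>F x in at_right 0. inverse x ^ n / exp (inverse x) = flat n x"
    by (auto simp: eventually_at_filter flat_def exp_minus field_simps)
  ultimately show "(flat n \<longlongrightarrow> 0) (at_right 0)" using Lim_transform_eventually by blast
qed

lemma flat_has_derivative: "(flat n has_real_derivative flat (n + 2) x - real n * flat (n + 1) x) (at x)"
proof -
  consider "x < 0" | "x = 0" | "x > 0" by linarith
  then show ?thesis
  proof cases
    case 1
    have "((\<lambda>x. 0) has_real_derivative 0) (at x)" by simp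
    then have "(flat n has_real_derivative 0) (at x)"
      by (rule has_field_derivative_transform_within_open[of _ _ _ "{..<0}"]) (use 1 in \<open>auto simp: flat_def\<close>)
    then show ?thesis using 1 by (simp add: flat_def)
  next
    case 2
    \<comment> \<open>The difference quotient of \<open>flat n\<close> at 0 is the next member of
      the family, so the derivative there is its limit.\<close>
    have "(\<lambda>h. (flat n (0 + h) - flat n 0) / h) = flat (n + 1)"
      by (simp add: flat_def fun_eq_iff divide_inverse)
    then have "(flat n has_real_derivative 0) (at 0)"
      using flat_tendsto_0[of "n + 1"] by (simp only: DERIV_def)
    then show ?thesis by (simp add: 2 flat_def)
  next
    case 3
    have "((\<lambda>x. exp (- inverse x) * inverse x ^ n) has_real_derivative
        exp (- inverse x) * (inverse x * inverse x) * inverse x ^ n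
        + exp (- inverse x) * (real n * inverse x ^ (n - 1) * - (inverse x * inverse x))) (at x)"
      by (rule derivative_eq_intros refl | use 3 in simp)+
    also have "exp (- inverse x) * (inverse x * inverse x) * inverse x ^ n
        + exp (- inverse x) * (real n * inverse x ^ (n - 1) * - (inverse x * inverse x))
        = flat (n + 2) x - real n * flat (n + 1) x"
      \<comment> \<open>The cases separate \<open>n = 0\<close>, where \<open>n - 1\<close> is
        truncated subtraction.\<close>
      using 3 by (cases n) (simp_all add: flat_def)
    finally have "((\<lambda>x. exp (- inverse x) * inverse x ^ n) has_real_derivative
        flat (n + 2) x - real n * flat (n + 1) x) (at x)" .
    then show ?thesis
      by (rule has_field_derivative_transform_within_open[of _ _ _ "{0<..}"]) (use 3 in \<open>auto simp: flat_def\<close>)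
  qed
qed

lemma times_diff_on_flat: "times_diff_on k UNIV (flat n)"
proof (induction k arbitrary: n)
  case 0
  have "isCont (flat n) x" for x using flat_has_derivative DERIV_isCont by blast
  then show ?case by (auto intro!: continuous_at_imp_continuous_on)
next
  case (Suc k)
  show ?case
  proof (rule times_diff_on_SucI)
    show "(flat n has_derivative (\<lambda>v. (flat (n + 2) x + (- real n) * flat (n + 1) x) * v)) (at x)" for x
      using flat_has_derivative[of n x] by (simp add: has_field_derivative_def)
    show "times_diff_on k UNIV (\<lambda>x. (flat (n + 2) x + (- real n) * flat (n + 1) x) * v)" for v
      by (intro times_diff_on_bilinear[OF bounded_bilinear_mult] times_diff_on_add times_diff_on_const Suc.IH open_UNIV)
  qed simp
qed

text \<open>The witness is a quotient whose denominator has no zeros, since the two arguments of \<^const>\<open>flat\<close>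
  in it have positive sum.\<close>

lemma smooth_plateau:
  fixes y0 :: "'b::real_inner"
  assumes "r > 0"
  obtains \<beta> :: "'b \<Rightarrow> real" where "smooth_on UNIV \<beta>"
    "\<And>y. dist y y0 \<le> r \<Longrightarrow> \<beta> y = 1" "\<And>y. dist y y0 \<ge> 2 * r \<Longrightarrow> \<beta> y = 0"
proof -
  define q where "q y = (y - y0) \<bullet> (y - y0)" for y
  \<comment> \<open>\<open>u\<close> vanishes at distance at least \<open>2 * r\<close> and
    \<open>w\<close> at distance at most \<open>r\<close>, so \<open>u / (u + w)\<close> is 0 on the
    former region and 1 on the latter. Differences are written with \<open>+\<close> to fit the
    closure rules.\<close>
  define u where "u y = flat 0 (4 * r\<^sup>2 + (-1) * q y)" for y
  define w where "w y = flat 0 (q y + - r\<^sup>2)" for y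
  have q: "q y = (dist y y0)\<^sup>2" for y by (simp add: q_def dist_norm power2_norm_eq_inner)
  have nz: "u y + w y \<noteq> 0" for y
  proof -
    have "4 * r\<^sup>2 - q y > 0 \<or> q y - r\<^sup>2 > 0" using assms by (smt (verit) zero_less_power)
    moreover have "flat 0 x \<ge> 0" "x > 0 \<Longrightarrow> flat 0 x > 0" for x by (auto simp: flat_def)
    ultimately show ?thesis unfolding u_def w_def by (smt (verit))
  qed
  have "times_diff_on k UNIV (\<lambda>y. u y * inverse (u y + w y))" for k
  proof -
    have tq: "times_diff_on k UNIV q"
      unfolding q_def diff_conv_add_uminus
      by (intro times_diff_on_bilinear[OF bounded_bilinear_inner] times_diff_on_add times_diff_on_ident times_diff_on_const open_UNIV)
    have u: "times_diff_on k UNIV u" unfolding u_def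
      by (rule times_diff_on_compose[OF orthonormal_expansion_real _ _ times_diff_on_flat])
        (intro times_diff_on_bilinear[OF bounded_bilinear_mult] times_diff_on_add times_diff_on_const tq open_UNIV subset_UNIV)+
    have w: "times_diff_on k UNIV w" unfolding w_def
      by (rule times_diff_on_compose[OF orthonormal_expansion_real _ _ times_diff_on_flat])
        (intro times_diff_on_add times_diff_on_const tq open_UNIV subset_UNIV)+
    show ?thesis
      by (intro times_diff_on_bilinear[OF bounded_bilinear_mult] times_diff_on_inverse times_diff_on_add u w open_UNIV nz)
  qed
  moreover have "u y * inverse (u y + w y) = 1" if "dist y y0 \<le> r" for y
  proof -
    have "q y \<le> r\<^sup>2" using that by (simp add: q power_mono)
    then have "w y = 0" by (simp add: w_def flat_def)
    then show ?thesis using nz[of y] by simp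
  qed
  moreover have "u y * inverse (u y + w y) = 0" if "dist y y0 \<ge> 2 * r" for y
  proof -
    have "q y \<ge> (2 * r)\<^sup>2" using that assms by (simp only: q power_mono)
    then show ?thesis by (simp add: u_def flat_def power_mult_distrib)
  qed
  ultimately show ?thesis using that[of "\<lambda>y. u y * inverse (u y + w y)"] by (simp add: smooth_on_def)
qed

section \<open>Compactness of closed balls\<close>

text \<open>The box of coefficients is built up one vector at a time: each step is the continuous
  image of an interval times the previous compact set.\<close>

lemma compact_combinations:
  fixes B :: "'b::real_normed_vector set"
  assumes "finite B"
  shows "compact {(\<Sum>b\<in>B. t b *\<^sub>R b) | t. \<forall>b\<in>B. \<bar>t b\<bar> \<le> r}"
  using assms
proof (induction B rule: finite_induct)
  case empty
  then show ?case by simp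
next
  case (insert b B)
  let ?K = "{(\<Sum>b\<in>B. t b *\<^sub>R b) | t. \<forall>b\<in>B. \<bar>t b\<bar> \<le> r}"
  let ?f = "\<lambda>(s, z). s *\<^sub>R b + z"
  have "{(\<Sum>b\<in>insert b B. t b *\<^sub>R b) | t. \<forall>b\<in>insert b B. \<bar>t b\<bar> \<le> r} = ?f ` ({-r..r} \<times> ?K)" (is "?L = ?R")
  proof (intro equalityI subsetI)
    fix x assume "x \<in> ?L"
    then show "x \<in> ?R" using insert.hyps by force
  next
    fix x assume "x \<in> ?R"
    then obtain s t where st: "x = s *\<^sub>R b + (\<Sum>b\<in>B. t b *\<^sub>R b)" "\<bar>s\<bar> \<le> r" "\<forall>b\<in>B. \<bar>t b\<bar> \<le> r" by auto
    have "(\<Sum>a\<in>B. (if a = b then s else t a) *\<^sub>R a) = (\<Sum>b\<in>B. t b *\<^sub>R b)"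
      using insert.hyps by (intro sum.cong) auto
    then show "x \<in> ?L"
      using insert.hyps st by (intro CollectI exI[of _ "\<lambda>a. if a = b then s else t a"]) auto
  qed
  moreover have "compact (?f ` ({-r..r} \<times> ?K))"
    by (intro compact_continuous_image compact_Times insert.IH)
      (auto simp: case_prod_unfold intro!: continuous_intros)
  ultimately show ?case by simp
qed

text \<open>By Cauchy-Schwarz every coordinate of a point of the ball is at most its norm, so the
  ball is a closed subset of a compact box.\<close>

lemma compact_cball_finite_dim:
  fixes y0 :: "'b::real_inner" and B :: "'b set"
  assumes "orthonormal_expansion B"
  shows "compact (cball y0 r)"
proof -
  let ?K = "{(\<Sum>b\<in>B. t b *\<^sub>R b) | t. \<forall>b\<in>B. \<bar>t b\<bar> \<le> norm y0 + r}"
  have "cball y0 r \<subseteq> ?K"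
  proof
    fix y assume "y \<in> cball y0 r"
    then have "norm y \<le> norm y0 + r" by (simp add: dist_norm) (smt (verit) norm_minus_commute norm_triangle_sub)
    then have "\<bar>y \<bullet> b\<bar> \<le> norm y0 + r" if "b \<in> B" for b
      using Cauchy_Schwarz_ineq2[of y b] assms that by (simp add: orthonormal_expansion_def)
    then show "y \<in> ?K" using assms by (auto simp: orthonormal_expansion_def intro!: exI[of _ "\<lambda>b. y \<bullet> b"])
  qed
  moreover have "compact ?K" using assms by (intro compact_combinations) (simp add: orthonormal_expansion_def)
  ultimately show ?thesis using compact_Int_closed[of ?K "cball y0 r"] by (simp add: Int_absorb1)
qed

section \<open>Smooth maps on the manifold\<close>

locale smooth_mfd =
  fixes A :: "('m::{t2_space,second_countable_topology}, 'b::real_inner) chart set"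
  assumes manifold: "smooth_manifold A"
begin

lemma model_orthonormal: obtains B :: "'b set" where "orthonormal_expansion B"
  using manifold finite_dim_type_orthonormal unfolding smooth_manifold_def by metis

lemma chart_at: obtains c where "c \<in> A" "x \<in> fst c"
proof -
  have "x \<in> (\<Union>c\<in>A. fst c)" using manifold by (simp add: smooth_manifold_def)
  then show ?thesis using that by blast
qed

context
  fixes c assumes c: "c \<in> A"
begin

lemma chart: "is_chart c"
  using c manifold by (simp add: smooth_manifold_def)

lemma open_chart: "open (fst c)"
  using chart by (simp add: is_chart_def)

lemma chart_inv_left [simp]: "x \<in> fst c \<Longrightarrow> chart_inv c (snd c x) = x"
  using chart by (simp add: is_chart_def homeomorphism_def)

lemma open_chart_image: "open W \<Longrightarrow> open (snd c ` (fst c \<inter> W))"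
proof -
  assume "open W"
  have h: "homeomorphism (fst c) (snd c ` fst c) (snd c) (chart_inv c)" "open (snd c ` fst c)"
    using chart by (auto simp: is_chart_def)
  have "snd c ` (fst c \<inter> W) = snd c ` fst c \<inter> chart_inv c -` W" by auto
  moreover have "open (snd c ` fst c \<inter> chart_inv c -` W)"
    using h \<open>open W\<close> by (intro continuous_open_preimage) (auto simp: homeomorphism_def)
  ultimately show ?thesis by simp
qed

lemma open_chart_preimage: "open V \<Longrightarrow> open (fst c \<inter> snd c -` V)"
  using chart by (intro continuous_open_preimage) (auto simp: is_chart_def homeomorphism_def)

end

lemma mfd_smooth_on_const: "mfd_smooth_on A W (\<lambda>x. k)"
  by (simp add: mfd_smooth_on_def smooth_on_def comp_def times_diff_on_const)

lemma mfd_smooth_on_subset: "mfd_smooth_on A W f \<Longrightarrow> W' \<subseteq> W \<Longrightarrow> mfd_smooth_on A W' f"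
  unfolding mfd_smooth_on_def smooth_on_def by (meson Int_mono image_mono order_refl times_diff_on_subset)

lemma mfd_smooth_on_cong:
  assumes "mfd_smooth_on A W f" "open W" "\<And>x. x \<in> W \<Longrightarrow> f x = g x"
  shows "mfd_smooth_on A W g"
  unfolding mfd_smooth_on_def smooth_on_def
proof (intro ballI allI)
  fix c k assume c: "c \<in> A"
  show "times_diff_on k (snd c ` (fst c \<inter> W)) (g \<circ> chart_inv c)"
    by (rule times_diff_on_cong[of _ _ "f \<circ> chart_inv c"])
      (use assms c open_chart_image in \<open>auto simp: mfd_smooth_on_def smooth_on_def\<close>)
qed

lemma mfd_smooth_on_local:
  assumes "\<And>x. x \<in> W \<Longrightarrow> \<exists>N. open N \<and> x \<in> N \<and> mfd_smooth_on A N f"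
  shows "mfd_smooth_on A W f"
  unfolding mfd_smooth_on_def smooth_on_def
proof (intro ballI allI times_diff_on_local)
  fix c k y assume c: "c \<in> A" and "y \<in> snd c ` (fst c \<inter> W)"
  then obtain x where x: "x \<in> fst c" "x \<in> W" "y = snd c x" by blast
  then obtain N where "open N" "x \<in> N" "mfd_smooth_on A N f" using assms by blast
  then show "\<exists>N. open N \<and> y \<in> N \<and> times_diff_on k N (f \<circ> chart_inv c)"
    using x c by (intro exI[of _ "snd c ` (fst c \<inter> N)"])
      (auto simp: mfd_smooth_on_def smooth_on_def open_chart_image)
qed

lemma mfd_smooth_onD: "mfd_smooth_on A W f \<Longrightarrow> c \<in> A \<Longrightarrow> times_diff_on k (snd c ` (fst c \<inter> W)) (f \<circ> chart_inv c)"
  by (simp add: mfd_smooth_on_def smooth_on_def)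

lemma mfd_smooth_onI:
  "(\<And>c k. c \<in> A \<Longrightarrow> times_diff_on k (snd c ` (fst c \<inter> W)) (f \<circ> chart_inv c)) \<Longrightarrow> mfd_smooth_on A W f"
  by (simp add: mfd_smooth_on_def smooth_on_def)

lemma mfd_smooth_on_add:
  "open W \<Longrightarrow> mfd_smooth_on A W f \<Longrightarrow> mfd_smooth_on A W g \<Longrightarrow> mfd_smooth_on A W (\<lambda>x. f x + g x)"
  by (rule mfd_smooth_onI)
    (simp add: comp_def times_diff_on_add open_chart_image mfd_smooth_onD[unfolded comp_def])

lemma mfd_smooth_on_bilinear:
  "bounded_bilinear b \<Longrightarrow> open W \<Longrightarrow> mfd_smooth_on A W f \<Longrightarrow> mfd_smooth_on A W g
    \<Longrightarrow> mfd_smooth_on A W (\<lambda>x. b (f x) (g x))"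
  unfolding mfd_smooth_on_def smooth_on_def comp_def
  by (intro ballI allI times_diff_on_bilinear[of b]) (simp_all add: open_chart_image)

lemma mfd_smooth_on_sum:
  "open W \<Longrightarrow> (\<And>i. i \<in> I \<Longrightarrow> mfd_smooth_on A W (f i)) \<Longrightarrow> mfd_smooth_on A W (\<lambda>x. \<Sum>i\<in>I. f i x)"
  by (rule mfd_smooth_onI)
    (simp add: comp_def times_diff_on_sum open_chart_image mfd_smooth_onD[unfolded comp_def])

text \<open>Here "smooth on each fixed vector" becomes "smooth on a smooth family of vectors". It is
  applied to transition maps, to the anchor in trivialisations and to single slots of a
  form.\<close>

lemma mfd_smooth_on_linear:
  fixes T :: "'m \<Rightarrow> 'v::real_inner \<Rightarrow> 'w::real_normed_vector" and B :: "'v set"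
  assumes B: "orthonormal_expansion B" and W: "open W"
    and g: "mfd_smooth_on A W g" and T: "\<And>b. mfd_smooth_on A W (\<lambda>x. T x b)"
    and lin: "\<And>x. x \<in> W \<Longrightarrow> linear (T x)"
  shows "mfd_smooth_on A W (\<lambda>x. T x (g x))"
proof (rule mfd_smooth_on_cong)
  show "mfd_smooth_on A W (\<lambda>x. \<Sum>b\<in>B. (g x \<bullet> b) *\<^sub>R T x b)"
    by (intro mfd_smooth_on_sum mfd_smooth_on_bilinear[OF bounded_bilinear_scaleR]
        mfd_smooth_on_bilinear[OF bounded_bilinear_inner] mfd_smooth_on_const W g T)
  show "(\<Sum>b\<in>B. (g x \<bullet> b) *\<^sub>R T x b) = T x (g x)" if "x \<in> W" for x
    using linear_expand[OF B lin[OF that]] by metis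
qed fact

text \<open>Extension by zero: \<open>U\<close> and the complement of \<open>K\<close> are open and
  cover everything, and \<open>g\<close> is smooth on the first and constant on the second.\<close>

lemma mfd_smooth_on_extend:
  assumes "open W" "open U" "closed K" "K \<subseteq> U" "\<And>x. x \<notin> K \<Longrightarrow> g x = 0" "mfd_smooth_on A (U \<inter> W) g"
  shows "mfd_smooth_on A W g"
proof (rule mfd_smooth_on_local)
  fix x assume "x \<in> W"
  show "\<exists>N. open N \<and> x \<in> N \<and> mfd_smooth_on A N g"
  proof (cases "x \<in> U")
    case True
    then show ?thesis using assms \<open>x \<in> W\<close> by (intro exI[of _ "U \<inter> W"]) auto
  next
    case False
    have "mfd_smooth_on A (- K) g"
      by (rule mfd_smooth_on_cong[OF mfd_smooth_on_const[of _ 0]]) (use assms in auto)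
    then show ?thesis using False assms by (intro exI[of _ "- K"]) auto
  qed
qed

text \<open>Any other chart differs by a smooth coordinate change, so one chart that contains
  \<open>W\<close> is enough.\<close>

lemma mfd_smooth_on_chart:
  assumes c: "c \<in> A" and W: "open W" "W \<subseteq> fst c" and f: "smooth_on (snd c ` W) (f \<circ> chart_inv c)"
  shows "mfd_smooth_on A W f"
  unfolding mfd_smooth_on_def smooth_on_def
proof (intro ballI allI)
  fix c' k assume c': "c' \<in> A"
  obtain B :: "'b set" where B: "orthonormal_expansion B" using model_orthonormal .
  let ?S = "snd c' ` (fst c' \<inter> W)" and ?t = "snd c \<circ> chart_inv c'"
  have "smooth_on (snd c' ` (fst c' \<inter> fst c)) ?t"
    using manifold c c' unfolding smooth_manifold_def by blast
  then have "times_diff_on k ?S ?t"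
    using W(2) unfolding smooth_on_def by (meson Int_mono image_mono order_refl times_diff_on_subset)
  moreover have "?t ` ?S \<subseteq> snd c ` W" using W(2) c' by auto
  ultimately have "times_diff_on k ?S (\<lambda>y. (f \<circ> chart_inv c) (?t y))"
    using times_diff_on_compose[OF B open_chart_image[OF c' W(1)]] f unfolding smooth_on_def by blast
  then show "times_diff_on k ?S (f \<circ> chart_inv c')"
    by (rule times_diff_on_cong[OF _ open_chart_image[OF c' W(1)]]) (use W c c' in auto)
qed

lemma smooth_functions_iff: "f \<in> smooth_functions A \<longleftrightarrow> mfd_smooth_on A UNIV f"
  by (simp add: smooth_functions_def)

lemma smooth_functions_const: "(\<lambda>x. r) \<in> smooth_functions A"
  by (simp add: smooth_functions_iff mfd_smooth_on_const)

lemma smooth_functions_add: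
  "f \<in> smooth_functions A \<Longrightarrow> g \<in> smooth_functions A \<Longrightarrow> (\<lambda>x. f x + g x) \<in> smooth_functions A"
  by (simp add: smooth_functions_iff mfd_smooth_on_add)

lemma smooth_functions_mult:
  "f \<in> smooth_functions A \<Longrightarrow> g \<in> smooth_functions A \<Longrightarrow> (\<lambda>x. f x * g x) \<in> smooth_functions A"
  by (simp add: smooth_functions_iff mfd_smooth_on_bilinear[OF bounded_bilinear_mult])

lemma smooth_functions_diff:
  "f \<in> smooth_functions A \<Longrightarrow> g \<in> smooth_functions A \<Longrightarrow> (\<lambda>x. f x - g x) \<in> smooth_functions A"
  using smooth_functions_add[OF _ smooth_functions_mult[OF smooth_functions_const[of "-1"]]] by fastforce

lemma smooth_functions_differentiable:
  assumes "f \<in> smooth_functions A" "c \<in> A" "x \<in> fst c"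
  shows "(f \<circ> chart_inv c) differentiable at (snd c x)"
proof -
  have "times_diff_on (Suc 0) (snd c ` (fst c \<inter> UNIV)) (f \<circ> chart_inv c)"
    using assms(1,2) unfolding smooth_functions_iff mfd_smooth_on_def smooth_on_def by blast
  then show ?thesis using assms(3) by auto
qed

text \<open>The set \<open>N\<close> is for replacing local objects by global ones near
  \<open>x0\<close>; the closed set \<open>K\<close> is for extending products with
  \<open>\<phi>\<close> by zero.\<close>

lemma bump_function:
  assumes "open U" "x0 \<in> U"
  obtains \<phi> N K where "\<phi> \<in> smooth_functions A" "open N" "x0 \<in> N" "N \<subseteq> U" "\<And>x. x \<in> N \<Longrightarrow> \<phi> x = 1"
    "closed K" "K \<subseteq> U" "\<And>x. x \<notin> K \<Longrightarrow> \<phi> x = 0"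
proof -
  obtain B :: "'b set" where B: "orthonormal_expansion B" using model_orthonormal .
  obtain c where c: "c \<in> A" "x0 \<in> fst c" using chart_at .
  have oU: "open (fst c \<inter> U)" using open_chart[OF c(1)] assms(1) by (rule open_Int)
  obtain e where e: "e > 0" "ball (snd c x0) e \<subseteq> snd c ` (fst c \<inter> U)"
    using open_chart_image[OF c(1) assms(1)] c(2) assms(2) open_contains_ball by blast
  \<comment> \<open>A third, so that the closed ball of radius \<open>2 * r\<close>, off which the
    plateau function vanishes, fits into the open ball of radius \<open>e\<close>.\<close>
  define r where "r = e / 3"
  have r: "r > 0" "cball (snd c x0) (2 * r) \<subseteq> snd c ` (fst c \<inter> U)"
    using e by (auto simp: r_def subset_iff)
  obtain \<beta> :: "'b \<Rightarrow> real" where \<beta>: "smooth_on UNIV \<beta>" "\<And>y. dist y (snd c x0) \<le> r \<Longrightarrow> \<beta> y = 1"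
    "\<And>y. dist y (snd c x0) \<ge> 2 * r \<Longrightarrow> \<beta> y = 0"
    using smooth_plateau[OF r(1), of "snd c x0"] by blast
  define K where "K = chart_inv c ` cball (snd c x0) (2 * r)"
  define \<phi> where "\<phi> x = (if x \<in> fst c \<inter> U then \<beta> (snd c x) else 0)" for x
  have "continuous_on (snd c ` fst c) (chart_inv c)"
    using chart[OF c(1)] by (simp add: is_chart_def homeomorphism_def)
  \<comment> \<open>A closed ball is carried to a set closed in the chart domain only; compactness
    together with the Hausdorff property makes it closed in the whole manifold.\<close>
  then have "compact K" unfolding K_def
    by (rule compact_continuous_image[OF continuous_on_subset compact_cball_finite_dim[OF B]])
      (use r(2) in auto)
  then have K: "closed K" by (rule compact_imp_closed)
  have KU: "K \<subseteq> fst c \<inter> U" using r(2) c by (auto simp: K_def)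
  have \<phi>0: "\<phi> x = 0" if "x \<notin> K" for x
  proof (cases "x \<in> fst c \<inter> U")
    case True
    then have "snd c x \<notin> cball (snd c x0) (2 * r)"
      using that c by (auto simp: K_def image_iff) (metis IntD1 True c(1) chart_inv_left mem_cball)
    then show ?thesis using \<beta>(3)[of "snd c x"] by (simp add: \<phi>_def dist_commute)
  qed (auto simp: \<phi>_def)
  have "times_diff_on k (snd c ` (fst c \<inter> U)) (\<phi> \<circ> chart_inv c)" for k
    by (rule times_diff_on_cong[of _ _ \<beta>])
      (use \<beta>(1) c open_chart_image[OF c(1) assms(1)] in
        \<open>auto simp: \<phi>_def smooth_on_def intro: times_diff_on_subset[of _ UNIV]\<close>)
  then have "mfd_smooth_on A (fst c \<inter> U) \<phi>"
    by (intro mfd_smooth_on_chart[OF c(1) oU]) (auto simp: smooth_on_def)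
  then have "\<phi> \<in> smooth_functions A"
    unfolding smooth_functions_iff
    by (intro mfd_smooth_on_extend[OF open_UNIV oU K KU \<phi>0]) auto
  moreover have "open (fst c \<inter> snd c -` ball (snd c x0) r \<inter> U)"
    using open_chart_preimage[OF c(1) open_ball] assms(1) by auto
  moreover have "\<phi> x = 1" if "x \<in> fst c \<inter> snd c -` ball (snd c x0) r \<inter> U" for x
    using that \<beta>(2)[of "snd c x"] by (auto simp: \<phi>_def dist_commute)
  ultimately show ?thesis
    using that[of \<phi> "fst c \<inter> snd c -` ball (snd c x0) r \<inter> U" K] K KU \<phi>0 c assms r(1) by auto
qed

section \<open>Derivatives along vector fields\<close>

lemma fibre_tangent_bundle: "a \<in> fibre (tangent_bundle A) x \<longleftrightarrow> fst a = x \<and> snd a \<in> tangent_space A x"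
  by (auto simp: fibre_def tangent_bundle_def)

text \<open>The chart in the definition is picked by \<open>SOME\<close>. The chain rule for the
  coordinate change, with the compatibility of the components of a tangent vector, makes any other
  chart give the same value.\<close>

lemma tangent_deriv_chart:
  assumes f: "f \<in> smooth_functions A" and a: "a \<in> fibre (tangent_bundle A) x" and c: "c \<in> A" "x \<in> fst c"
  shows "tangent_deriv A a f = frechet_derivative (f \<circ> chart_inv c) (at (snd c x)) (snd a c)"
proof -
  define c' where "c' = (SOME c. c \<in> A \<and> fst a \<in> fst c)"
  have a': "fst a = x" "snd a \<in> tangent_space A x" using a by (auto simp: fibre_tangent_bundle)
  have c': "c' \<in> A" "x \<in> fst c'"
    using someI[of "\<lambda>c. c \<in> A \<and> fst a \<in> fst c" c] c a' by (auto simp: c'_def)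
  let ?t = "snd c' \<circ> chart_inv c" and ?S = "snd c ` (fst c \<inter> fst c')"
  have "smooth_on ?S ?t"
    using manifold c(1) c'(1) unfolding smooth_manifold_def by blast
  then have "times_diff_on (Suc 0) ?S ?t" unfolding smooth_on_def by blast
  then have t: "?t differentiable at (snd c x)" using c(2) c'(2) by auto
  have tx: "?t (snd c x) = snd c' x" using c by simp
  have f': "(f \<circ> chart_inv c') differentiable at (?t (snd c x))"
    unfolding tx by (rule smooth_functions_differentiable[OF f c'])
  have "frechet_derivative (f \<circ> chart_inv c) (at (snd c x)) =
      frechet_derivative ((f \<circ> chart_inv c') \<circ> ?t) (at (snd c x))"
    by (rule frechet_derivative_transform_within_open[of _ _ ?S])
      (use smooth_functions_differentiable[OF f c] open_chart_image[OF c(1) open_chart[OF c'(1)]] c c' in auto)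
  also have "\<dots> = frechet_derivative (f \<circ> chart_inv c') (at (?t (snd c x))) \<circ> frechet_derivative ?t (at (snd c x))"
    by (rule frechet_derivative_compose[OF t f'])
  finally have "frechet_derivative (f \<circ> chart_inv c) (at (snd c x)) (snd a c)
      = frechet_derivative (f \<circ> chart_inv c') (at (snd c' x)) (frechet_derivative ?t (at (snd c x)) (snd a c))"
    using c by simp
  also have "frechet_derivative ?t (at (snd c x)) (snd a c) = snd a c'"
    using a'(2) c c' unfolding tangent_space_def mem_Collect_eq by metis
  finally show ?thesis
    unfolding tangent_deriv_def Let_def c'_def[symmetric] unfolding a'(1) by (rule sym)
qed

lemma tangent_deriv_eqI:
  assumes f: "f \<in> smooth_functions A" and a: "a \<in> fibre (tangent_bundle A) x" and c: "c \<in> A" "x \<in> fst c"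
    and d: "(f \<circ> chart_inv c has_derivative D) (at (snd c x))"
  shows "tangent_deriv A a f = D (snd a c)"
  using tangent_deriv_chart[OF f a c] frechet_derivative_at[OF d] by simp

lemma smooth_functions_has_derivative:
  assumes "f \<in> smooth_functions A" "c \<in> A" "x \<in> fst c"
  shows "(f \<circ> chart_inv c has_derivative frechet_derivative (f \<circ> chart_inv c) (at (snd c x))) (at (snd c x))"
  using smooth_functions_differentiable[OF assms] by (simp add: frechet_derivative_works)

lemma tangent_deriv_add:
  assumes f: "f \<in> smooth_functions A" and g: "g \<in> smooth_functions A" and a: "a \<in> fibre (tangent_bundle A) x"
  shows "tangent_deriv A a (\<lambda>x. f x + g x) = tangent_deriv A a f + tangent_deriv A a g"
proof -
  obtain c where c: "c \<in> A" "x \<in> fst c" using chart_at .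
  show ?thesis
    using tangent_deriv_eqI[OF smooth_functions_add[OF f g] a c]
      has_derivative_add[OF smooth_functions_has_derivative[OF f c] smooth_functions_has_derivative[OF g c]]
    by (simp add: tangent_deriv_chart[OF f a c] tangent_deriv_chart[OF g a c] comp_def)
qed

lemma tangent_deriv_mult:
  assumes f: "f \<in> smooth_functions A" and g: "g \<in> smooth_functions A" and a: "a \<in> fibre (tangent_bundle A) x"
  shows "tangent_deriv A a (\<lambda>x. f x * g x) = f x * tangent_deriv A a g + tangent_deriv A a f * g x"
proof -
  obtain c where c: "c \<in> A" "x \<in> fst c" using chart_at .
  show ?thesis
    using tangent_deriv_eqI[OF smooth_functions_mult[OF f g] a c]
      has_derivative_mult[OF smooth_functions_has_derivative[OF f c] smooth_functions_has_derivative[OF g c]] c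
    by (simp add: tangent_deriv_chart[OF f a c] tangent_deriv_chart[OF g a c] comp_def)
qed

lemma tangent_deriv_const: "a \<in> fibre (tangent_bundle A) x \<Longrightarrow> tangent_deriv A a (\<lambda>x. r) = 0"
proof -
  assume a: "a \<in> fibre (tangent_bundle A) x"
  obtain c where "c \<in> A" "x \<in> fst c" using chart_at .
  then show ?thesis using tangent_deriv_chart[OF smooth_functions_const a] by (simp add: comp_def)
qed

lemma tangent_deriv_vplus:
  assumes f: "f \<in> smooth_functions A" and a: "a \<in> fibre (tangent_bundle A) x" "b \<in> fibre (tangent_bundle A) x"
    and ab: "vplus (tangent_bundle A) a b \<in> fibre (tangent_bundle A) x"
  shows "tangent_deriv A (vplus (tangent_bundle A) a b) f = tangent_deriv A a f + tangent_deriv A b f"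
proof -
  obtain c where c: "c \<in> A" "x \<in> fst c" using chart_at .
  show ?thesis
    using linear_add[OF linear_frechet_derivative[OF smooth_functions_differentiable[OF f c]]]
    by (simp add: tangent_deriv_chart[OF f ab c] tangent_deriv_chart[OF f a(1) c] tangent_deriv_chart[OF f a(2) c])
      (simp add: tangent_bundle_def)
qed

lemma tangent_deriv_vscale:
  assumes f: "f \<in> smooth_functions A" and a: "a \<in> fibre (tangent_bundle A) x"
    and ra: "vscale (tangent_bundle A) r a \<in> fibre (tangent_bundle A) x"
  shows "tangent_deriv A (vscale (tangent_bundle A) r a) f = r * tangent_deriv A a f"
proof -
  obtain c where c: "c \<in> A" "x \<in> fst c" using chart_at .
  show ?thesis
    using linear_scale[OF linear_frechet_derivative[OF smooth_functions_differentiable[OF f c]]]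
    by (simp add: tangent_deriv_chart[OF f ra c] tangent_deriv_chart[OF f a c]) (simp add: tangent_bundle_def)
qed

text \<open>In a chart this is the derivative of \<open>f\<close> in the direction of the coordinate
  vector of \<open>X\<close>, which moves with the point; the expansion in \<open>B\<close> leaves
  derivatives in fixed directions.\<close>

lemma vf_deriv_smooth:
  assumes X: "X \<in> sections A (tangent_bundle A)" and f: "f \<in> smooth_functions A"
  shows "vf_deriv A X f \<in> smooth_functions A"
  unfolding smooth_functions_iff mfd_smooth_on_def smooth_on_def
proof (intro ballI allI)
  fix c k assume c: "c \<in> A"
  obtain B :: "'b set" where B: "orthonormal_expansion B" using model_orthonormal .
  let ?S = "snd c ` (fst c \<inter> UNIV)" and ?f = "f \<circ> chart_inv c" and ?X = "(\<lambda>x. snd (X x) c) \<circ> chart_inv c"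
  have S: "open ?S" using open_chart_image[OF c open_UNIV] .
  have "(fst c, \<lambda>a. snd a c) \<in> trivs (tangent_bundle A)" using c by (auto simp: tangent_bundle_def)
  then have "mfd_smooth_on A (fst c) ((\<lambda>a. snd a c) \<circ> X)" using X by (fastforce simp: sections_def)
  then have "smooth_on (snd c ` (fst c \<inter> fst c)) (((\<lambda>a. snd a c) \<circ> X) \<circ> chart_inv c)"
    using c unfolding mfd_smooth_on_def by blast
  then have tX: "times_diff_on k ?S ?X" by (simp add: smooth_on_def comp_def)
  have "times_diff_on (Suc k) ?S ?f"
    using f c unfolding smooth_functions_iff mfd_smooth_on_def smooth_on_def by blast
  then have tf: "times_diff_on k ?S (\<lambda>y. frechet_derivative ?f (at y) b)" for b by simp
  show "times_diff_on k ?S (vf_deriv A X f \<circ> chart_inv c)"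
  proof (rule times_diff_on_cong[OF _ S])
    show "times_diff_on k ?S (\<lambda>y. \<Sum>b\<in>B. (?X y \<bullet> b) *\<^sub>R frechet_derivative ?f (at y) b)"
      by (intro times_diff_on_sum times_diff_on_bilinear[OF bounded_bilinear_scaleR]
          times_diff_on_bilinear[OF bounded_bilinear_inner] S times_diff_on_const tX tf)
    fix y assume "y \<in> ?S"
    then obtain x where x: "x \<in> fst c" "y = snd c x" by auto
    have "X x \<in> fibre (tangent_bundle A) x" using X by (simp add: sections_def)
    then have "(vf_deriv A X f \<circ> chart_inv c) y = frechet_derivative ?f (at y) (?X y)"
      using tangent_deriv_chart[OF f _ c x(1)] x c by (simp add: vf_deriv_def)
    also have "\<dots> = (\<Sum>b\<in>B. (?X y \<bullet> b) *\<^sub>R frechet_derivative ?f (at y) b)"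
      using linear_frechet_derivative[OF smooth_functions_differentiable[OF f c x(1)]] x(2)
      by (intro linear_expand[OF B]) simp
    finally show "(\<Sum>b\<in>B. (?X y \<bullet> b) *\<^sub>R frechet_derivative ?f (at y) b) = (vf_deriv A X f \<circ> chart_inv c) y"
      by (rule sym)
  qed
qed

end

section \<open>Sections of a vector bundle\<close>

locale smooth_bundle =
  fixes A :: "('m::{t2_space,second_countable_topology}, 'b::real_inner) chart set"
    and E :: "('m, 'e, 'f::real_inner) vbundle"
  assumes vb: "vector_bundle A E"

sublocale smooth_bundle \<subseteq> smooth_mfd A
  using vb by unfold_locales (simp add: vector_bundle_def)

context smooth_bundle
begin

lemma fibre_orthonormal: obtains B :: "'f set" where "orthonormal_expansion B"
  using vb finite_dim_type_orthonormal unfolding vector_bundle_def by metis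

lemma triv_at: obtains U \<psi> where "(U, \<psi>) \<in> trivs E" "x \<in> U"
proof -
  have "(\<Union>(U, \<psi>)\<in>trivs E. U) = UNIV" using vb by (simp add: vector_bundle_def)
  then have "x \<in> (\<Union>(U, \<psi>)\<in>trivs E. U)" by simp
  then show ?thesis using that by blast
qed

lemma vzero_fibre: "vzero E x \<in> fibre E x"
  and vplus_fibre: "a \<in> fibre E x \<Longrightarrow> b \<in> fibre E x \<Longrightarrow> vplus E a b \<in> fibre E x"
  and vscale_fibre: "a \<in> fibre E x \<Longrightarrow> vscale E r a \<in> fibre E x"
  using vb by (simp_all add: vector_bundle_def)

lemma trivs_smooth:
  assumes "(U, \<psi>) \<in> trivs E" "(U', \<psi>') \<in> trivs E"
  shows "mfd_smooth_on A (U \<inter> U') (\<lambda>x. \<psi>' (triv_inv E \<psi> x w))"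
proof -
  have "\<forall>(U, \<psi>)\<in>trivs E. \<forall>(U', \<psi>')\<in>trivs E. \<forall>w.
        mfd_smooth_on A (U \<inter> U') (\<lambda>x. \<psi>' (triv_inv E \<psi> x w))"
    using vb unfolding vector_bundle_def by (elim conjE)
  from bspec[OF this assms(1)]
  have "\<forall>(U', \<psi>')\<in>trivs E. \<forall>w. mfd_smooth_on A (U \<inter> U') (\<lambda>x. \<psi>' (triv_inv E \<psi> x w))" by simp
  from bspec[OF this assms(2)] show ?thesis by simp
qed

context
  fixes U \<psi> assumes triv: "(U, \<psi>) \<in> trivs E"
begin

lemma triv_props: "open U \<and>
        (\<forall>x\<in>U. bij_betw \<psi> (fibre E x) UNIV \<and>
           \<psi> (vzero E x) = 0 \<and>
           (\<forall>a\<in>fibre E x. \<forall>b\<in>fibre E x. \<psi> (vplus E a b) = \<psi> a + \<psi> b) \<and>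
           (\<forall>r. \<forall>a\<in>fibre E x. \<psi> (vscale E r a) = r *\<^sub>R \<psi> a))"
proof -
  have "\<forall>(U, \<psi>)\<in>trivs E. open U \<and>
        (\<forall>x\<in>U. bij_betw \<psi> (fibre E x) UNIV \<and>
           \<psi> (vzero E x) = 0 \<and>
           (\<forall>a\<in>fibre E x. \<forall>b\<in>fibre E x. \<psi> (vplus E a b) = \<psi> a + \<psi> b) \<and>
           (\<forall>r. \<forall>a\<in>fibre E x. \<psi> (vscale E r a) = r *\<^sub>R \<psi> a))"
    using vb unfolding vector_bundle_def by (elim conjE)
  from bspec[OF this triv] show ?thesis by simp
qed

lemma triv_open: "open U" using triv_props by blast

context
  fixes x assumes x: "x \<in> U"
begin

lemma triv_bij: "bij_betw \<psi> (fibre E x) UNIV" using triv_props x by blast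

lemma triv_vzero: "\<psi> (vzero E x) = 0" using triv_props x by blast

lemma triv_vplus: "a \<in> fibre E x \<Longrightarrow> b \<in> fibre E x \<Longrightarrow> \<psi> (vplus E a b) = \<psi> a + \<psi> b"
  using triv_props x by blast

lemma triv_vscale: "a \<in> fibre E x \<Longrightarrow> \<psi> (vscale E r a) = r *\<^sub>R \<psi> a"
  using triv_props x by blast

lemma triv_inj: "a \<in> fibre E x \<Longrightarrow> b \<in> fibre E x \<Longrightarrow> \<psi> a = \<psi> b \<Longrightarrow> a = b"
  using triv_bij by (auto simp: bij_betw_def inj_on_def)

lemma triv_inv_fibre: "triv_inv E \<psi> x w \<in> fibre E x"
  using triv_bij by (auto simp: triv_inv_def bij_betw_def intro: inv_into_into)

lemma triv_triv_inv: "\<psi> (triv_inv E \<psi> x w) = w"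
  using triv_bij by (auto simp: triv_inv_def bij_betw_def intro: f_inv_into_f)

lemma triv_inv_triv: "a \<in> fibre E x \<Longrightarrow> triv_inv E \<psi> x (\<psi> a) = a"
  using triv_inj triv_inv_fibre triv_triv_inv by blast

lemma triv_inv_add: "triv_inv E \<psi> x (v + w) = vplus E (triv_inv E \<psi> x v) (triv_inv E \<psi> x w)"
  by (rule triv_inj) (simp_all add: triv_inv_fibre vplus_fibre triv_triv_inv triv_vplus)

lemma triv_inv_scale: "triv_inv E \<psi> x (r *\<^sub>R w) = vscale E r (triv_inv E \<psi> x w)"
  by (rule triv_inj) (simp_all add: triv_inv_fibre vscale_fibre triv_triv_inv triv_vscale)

lemma triv_inv_0: "triv_inv E \<psi> x 0 = vzero E x"
  by (rule triv_inj) (simp_all add: triv_inv_fibre vzero_fibre triv_triv_inv triv_vzero)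

text \<open>Fibres are bare sets with operations, so the predicate \<open>linear\<close> becomes
  available only after pulling a map back to the typical fibre.\<close>

lemma linear_triv_inv:
  assumes "\<And>a b. a \<in> fibre E x \<Longrightarrow> b \<in> fibre E x \<Longrightarrow> T (vplus E a b) = T a + T b"
    and "\<And>r a. a \<in> fibre E x \<Longrightarrow> T (vscale E r a) = r *\<^sub>R T a"
  shows "linear (\<lambda>w. T (triv_inv E \<psi> x w))"
  by (rule linearI) (simp_all add: triv_inv_add triv_inv_scale triv_inv_fibre assms)

end

end

lemma sections_fibre: "V \<in> sections A E \<Longrightarrow> V x \<in> fibre E x"
  by (simp add: sections_def)

lemma sections_smooth: "V \<in> sections A E \<Longrightarrow> (U, \<psi>) \<in> trivs E \<Longrightarrow> mfd_smooth_on A U (\<lambda>x. \<psi> (V x))"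
  unfolding sections_def comp_def by fast

lemma sectionsI:
  assumes "\<And>x. V x \<in> fibre E x" "\<And>U \<psi>. (U, \<psi>) \<in> trivs E \<Longrightarrow> mfd_smooth_on A U (\<lambda>x. \<psi> (V x))"
  shows "V \<in> sections A E"
  using assms unfolding sections_def comp_def by fast

lemma sec_add_closed: "V \<in> sections A E \<Longrightarrow> W \<in> sections A E \<Longrightarrow> sec_add E V W \<in> sections A E"
proof (rule sectionsI)
  fix U \<psi> assume V: "V \<in> sections A E" "W \<in> sections A E" and t: "(U, \<psi>) \<in> trivs E"
  show "mfd_smooth_on A U (\<lambda>x. \<psi> (sec_add E V W x))"
    by (rule mfd_smooth_on_cong[OF mfd_smooth_on_add[OF triv_open[OF t] sections_smooth[OF V(1) t]
            sections_smooth[OF V(2) t]] triv_open[OF t]])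
      (simp add: sec_add_def triv_vplus[OF t] sections_fibre V)
qed (simp add: sec_add_def vplus_fibre sections_fibre)

lemma sec_mult_closed: "f \<in> smooth_functions A \<Longrightarrow> V \<in> sections A E \<Longrightarrow> sec_mult E f V \<in> sections A E"
proof (rule sectionsI)
  fix U \<psi> assume f: "f \<in> smooth_functions A" and V: "V \<in> sections A E" and t: "(U, \<psi>) \<in> trivs E"
  have "mfd_smooth_on A U f" using f mfd_smooth_on_subset unfolding smooth_functions_iff by blast
  then show "mfd_smooth_on A U (\<lambda>x. \<psi> (sec_mult E f V x))"
    by (rule mfd_smooth_on_cong[OF mfd_smooth_on_bilinear[OF bounded_bilinear_scaleR triv_open[OF t] _
            sections_smooth[OF V t]] triv_open[OF t]])
      (simp add: sec_mult_def triv_vscale[OF t] sections_fibre V)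
qed (simp add: sec_mult_def vscale_fibre sections_fibre)

text \<open>In another trivialisation the coordinates are the linear transition map applied to
  \<open>g\<close>. They are smooth on the overlap and vanish off \<open>K\<close>, so they extend
  by zero.\<close>

lemma local_section:
  assumes t: "(U, \<psi>) \<in> trivs E" and K: "closed K" "K \<subseteq> U"
    and g: "mfd_smooth_on A U g" "\<And>x. x \<in> U \<Longrightarrow> x \<notin> K \<Longrightarrow> g x = 0"
  shows "(\<lambda>x. if x \<in> U then triv_inv E \<psi> x (g x) else vzero E x) \<in> sections A E" (is "?V \<in> _")
proof (rule sectionsI)
  show "?V x \<in> fibre E x" for x by (simp add: triv_inv_fibre[OF t] vzero_fibre)
next
  fix U' \<psi>' assume t': "(U', \<psi>') \<in> trivs E"
  obtain B :: "'f set" where B: "orthonormal_expansion B" using fibre_orthonormal .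
  have o: "open (U \<inter> U')" using triv_open t t' by blast
  \<comment> \<open>The value 0 off \<open>U'\<close> is put in by hand: nothing is known about
    \<open>\<psi>'\<close> on the fibres there, while the extension lemma asks for vanishing at
    every point off \<open>K\<close>.\<close>
  let ?g = "\<lambda>x. if x \<in> U' then \<psi>' (?V x) else 0"
  have "mfd_smooth_on A U' ?g"
  proof (rule mfd_smooth_on_extend[OF triv_open[OF t'] triv_open[OF t] K])
    show "?g x = 0" if "x \<notin> K" for x
      using that by (simp add: g(2) triv_inv_0[OF t] triv_vzero[OF t'])
    have "mfd_smooth_on A (U \<inter> U') (\<lambda>x. \<psi>' (triv_inv E \<psi> x (g x)))"
    proof (rule mfd_smooth_on_linear[where T = "\<lambda>x w. \<psi>' (triv_inv E \<psi> x w)", OF B o])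
      show "mfd_smooth_on A (U \<inter> U') g" using mfd_smooth_on_subset[OF g(1)] by blast
      show "mfd_smooth_on A (U \<inter> U') (\<lambda>x. \<psi>' (triv_inv E \<psi> x b))" for b
        by (rule trivs_smooth[OF t t'])
      show "linear (\<lambda>w. \<psi>' (triv_inv E \<psi> x w))" if "x \<in> U \<inter> U'" for x
        using that by (intro linear_triv_inv[OF t]) (auto simp: triv_vplus[OF t'] triv_vscale[OF t'])
    qed
    then show "mfd_smooth_on A (U \<inter> U') ?g"
      by (rule mfd_smooth_on_cong[OF _ o]) simp
  qed
  then show "mfd_smooth_on A U' (\<lambda>x. \<psi>' (?V x))"
    by (rule mfd_smooth_on_cong[OF _ triv_open[OF t']]) simp
qed

lemma vzero_section: "vzero E \<in> sections A E"
  by (rule sectionsI) (auto simp: vzero_fibre triv_vzero triv_open intro: mfd_smooth_on_cong[OF mfd_smooth_on_const[of _ 0]])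

text \<open>Vectors with constant coordinates become global sections. They provide sections through
  given vectors and global substitutes for a local frame.\<close>

lemma cutoff_section:
  assumes t: "(U, \<psi>) \<in> trivs E" and K: "closed K" "K \<subseteq> U"
    and \<phi>: "\<phi> \<in> smooth_functions A" "\<And>x. x \<notin> K \<Longrightarrow> \<phi> x = 0"
  shows "(\<lambda>x. if x \<in> U then triv_inv E \<psi> x (\<phi> x *\<^sub>R w) else vzero E x) \<in> sections A E"
proof (rule local_section[OF t K])
  have "mfd_smooth_on A U \<phi>" using \<phi>(1) mfd_smooth_on_subset unfolding smooth_functions_iff by blast
  then show "mfd_smooth_on A U (\<lambda>x. \<phi> x *\<^sub>R w)"
    by (intro mfd_smooth_on_bilinear[OF bounded_bilinear_scaleR triv_open[OF t]] mfd_smooth_on_const)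
qed (simp add: \<phi>(2))

lemma section_through:
  assumes "a \<in> fibre E x"
  obtains V where "V \<in> sections A E" "V x = a"
proof -
  obtain U \<psi> where t: "(U, \<psi>) \<in> trivs E" "x \<in> U" using triv_at .
  obtain \<phi> N K where \<phi>: "\<phi> \<in> smooth_functions A" "x \<in> N" "\<And>x. x \<in> N \<Longrightarrow> \<phi> x = 1"
    "closed K" "K \<subseteq> U" "\<And>x. x \<notin> K \<Longrightarrow> \<phi> x = 0"
    using bump_function[OF triv_open[OF t(1)] t(2)] by metis
  show ?thesis
    using that[OF cutoff_section[OF t(1) \<phi>(4,5,1,6), of "\<psi> a"]] t \<phi>(2,3) assms
    by (simp add: triv_inv_triv[OF t(1)])
qed

text \<open>Near each point the coordinates of the image are the matrix of \<open>\<rho>\<close>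
  applied to the coordinates of \<open>V\<close>.\<close>

lemma bundle_map_section:
  assumes \<rho>: "vbundle_map A E (tangent_bundle A) \<rho>" and V: "V \<in> sections A E"
  shows "\<rho> \<circ> V \<in> sections A (tangent_bundle A)"
proof -
  let ?T = "tangent_bundle A"
  have \<rho>f: "\<rho> a \<in> fibre ?T x" "b \<in> fibre E x \<Longrightarrow> \<rho> (vplus E a b) = vplus ?T (\<rho> a) (\<rho> b)"
    "\<rho> (vscale E r a) = vscale ?T r (\<rho> a)" if "a \<in> fibre E x" for a b r x
    using \<rho> that unfolding vbundle_map_def by blast+
  have \<rho>s: "mfd_smooth_on A (U \<inter> U') (\<lambda>x. \<psi>' (\<rho> (triv_inv E \<psi> x w)))"
    if "(U, \<psi>) \<in> trivs E" "(U', \<psi>') \<in> trivs ?T" for U \<psi> U' \<psi>' w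
    using \<rho> that unfolding vbundle_map_def by fast
  have "mfd_smooth_on A U' (\<psi>' \<circ> (\<rho> \<circ> V))" if t': "(U', \<psi>') \<in> trivs ?T" for U' \<psi>'
  proof (rule mfd_smooth_on_local)
    fix x assume x: "x \<in> U'"
    obtain U \<psi> where t: "(U, \<psi>) \<in> trivs E" "x \<in> U" using triv_at .
    obtain B :: "'f set" where B: "orthonormal_expansion B" using fibre_orthonormal .
    obtain c where c: "c \<in> A" "U' = fst c" "\<psi>' = (\<lambda>a. snd a c)" using t' by (auto simp: tangent_bundle_def)
    have o: "open (U \<inter> U')" using open_chart[OF c(1)] triv_open[OF t(1)] c(2) by blast
    have "mfd_smooth_on A (U \<inter> U') (\<lambda>x. \<psi>' (\<rho> (triv_inv E \<psi> x (\<psi> (V x)))))"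
    proof (rule mfd_smooth_on_linear[where T = "\<lambda>x w. \<psi>' (\<rho> (triv_inv E \<psi> x w))", OF B o])
      show "mfd_smooth_on A (U \<inter> U') (\<lambda>x. \<psi> (V x))"
        using mfd_smooth_on_subset[OF sections_smooth[OF V t(1)]] by blast
      show "mfd_smooth_on A (U \<inter> U') (\<lambda>x. \<psi>' (\<rho> (triv_inv E \<psi> x b)))" for b
        by (rule \<rho>s[OF t(1) t'])
      show "linear (\<lambda>w. \<psi>' (\<rho> (triv_inv E \<psi> x w)))" if "x \<in> U \<inter> U'" for x
        using that by (intro linear_triv_inv[OF t(1)]) (auto simp: \<rho>f c(3) tangent_bundle_def)
    qed
    then have "mfd_smooth_on A (U \<inter> U') (\<psi>' \<circ> (\<rho> \<circ> V))"
      by (rule mfd_smooth_on_cong[OF _ o]) (simp add: triv_inv_triv[OF t(1)] sections_fibre[OF V])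
    then show "\<exists>N. open N \<and> x \<in> N \<and> mfd_smooth_on A N (\<psi>' \<circ> (\<rho> \<circ> V))" using o x t by blast
  qed
  then show ?thesis using \<rho>f(1) sections_fibre[OF V] unfolding sections_def comp_def by fast
qed

section \<open>Forms\<close>

lemma alt_forms_degree: "\<omega> \<in> alt_forms E x p \<Longrightarrow> length vs \<noteq> p \<or> \<not> set vs \<subseteq> fibre E x \<Longrightarrow> \<omega> vs = 0"
  unfolding alt_forms_def by blast

text \<open>Splittings of lists replace the index updates of \<open>alt_forms\<close>, which suits
  induction on lists. At a wrong length all three terms are the default 0.\<close>

lemma alt_forms_add:
  assumes w: "\<omega> \<in> alt_forms E x p" and s: "set xs \<subseteq> fibre E x" "set ys \<subseteq> fibre E x"
    and a: "a \<in> fibre E x" "b \<in> fibre E x"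
  shows "\<omega> (xs @ vplus E a b # ys) = \<omega> (xs @ a # ys) + \<omega> (xs @ b # ys)"
proof (cases "length (xs @ a # ys) = p")
  case True
  have "set (xs @ a # ys) \<subseteq> fibre E x" "length xs < p" using True s a by auto
  then have "\<omega> ((xs @ a # ys)[length xs := vplus E a b]) =
      \<omega> ((xs @ a # ys)[length xs := a]) + \<omega> ((xs @ a # ys)[length xs := b])"
    using w a True unfolding alt_forms_def by blast
  then show ?thesis by simp
next
  case False
  then show ?thesis by (simp add: alt_forms_degree[OF w])
qed

lemma alt_forms_scale:
  assumes w: "\<omega> \<in> alt_forms E x p" and s: "set xs \<subseteq> fibre E x" "set ys \<subseteq> fibre E x" and a: "a \<in> fibre E x"
  shows "\<omega> (xs @ vscale E r a # ys) = r * \<omega> (xs @ a # ys)"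
proof (cases "length (xs @ a # ys) = p")
  case True
  have "set (xs @ a # ys) \<subseteq> fibre E x" "length xs < p" using True s a by auto
  then have "\<omega> ((xs @ a # ys)[length xs := vscale E r a]) = r * \<omega> ((xs @ a # ys)[length xs := a])"
    using w a True unfolding alt_forms_def by blast
  then show ?thesis by simp
next
  case False
  then show ?thesis by (simp add: alt_forms_degree[OF w])
qed

lemma alt_forms_swap:
  assumes w: "\<omega> \<in> alt_forms E x p"
  shows "\<omega> (xs @ b # a # ys) = - \<omega> (xs @ a # b # ys)"
proof (cases "length (xs @ a # b # ys) = p \<and> set (xs @ a # b # ys) \<subseteq> fibre E x")
  case True
  let ?l = "xs @ a # b # ys"
  have sw: "\<forall>vs i j. length vs = p \<and> set vs \<subseteq> fibre E x \<and> i < j \<and> j < p \<longrightarrow>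
      \<omega> (vs[i := vs ! j, j := vs ! i]) = - \<omega> vs"
    using w unfolding alt_forms_def mem_Collect_eq by (elim conjE)
  have "\<omega> (?l[length xs := ?l ! Suc (length xs), Suc (length xs) := ?l ! length xs]) = - \<omega> ?l"
    by (rule sw[rule_format]) (use True in auto)
  then show ?thesis by (simp add: nth_append list_update_append)
next
  \<comment> \<open>The two lists agree in length and in entries, so both lie outside the domain and
    get the default 0.\<close>
  case False
  then show ?thesis using alt_forms_degree[OF w, of "xs @ a # b # ys"] alt_forms_degree[OF w, of "xs @ b # a # ys"]
    by auto
qed

lemma forms_alt: "\<eta> \<in> forms A E (int p) \<Longrightarrow> \<eta> x \<in> alt_forms E x p"
  by (simp add: forms_def)

lemma forms_smooth:
  "\<eta> \<in> forms A E (int p) \<Longrightarrow> (U, \<psi>) \<in> trivs E \<Longrightarrow> length ws = p \<Longrightarrow>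
     mfd_smooth_on A U (\<lambda>x. \<eta> x (map (triv_inv E \<psi> x) ws))"
  unfolding forms_def by simp fast

text \<open>The coefficients of a form are smooth on vectors that are constant in a trivialisation.
  Sections replace these one slot at a time, each by linearity in that slot.\<close>

lemma eval_form_smooth:
  assumes \<eta>: "\<eta> \<in> forms A E (int p)" and Vs: "set Vs \<subseteq> sections A E"
  shows "eval_form \<eta> Vs \<in> smooth_functions A"
proof (cases "length Vs = p")
  case False
  then have "eval_form \<eta> Vs = (\<lambda>x. 0)"
    by (auto simp: eval_form_def fun_eq_iff intro!: alt_forms_degree[OF forms_alt[OF \<eta>]])
  then show ?thesis by (simp add: smooth_functions_const)
next
  case True
  obtain B :: "'f set" where B: "orthonormal_expansion B" using fibre_orthonormal .
  \<comment> \<open>\<open>ws\<close> fills the slots that are still constant. It has to be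
    arbitrary, because the induction step appends a basis vector to it.\<close>
  have *: "mfd_smooth_on A U (\<lambda>x. \<eta> x (map (triv_inv E \<psi> x) ws @ map (\<lambda>V. V x) Vs))"
    if t: "(U, \<psi>) \<in> trivs E" and "length ws + length Vs = p" "set Vs \<subseteq> sections A E" for U \<psi> ws Vs
    using that(2,3)
  proof (induction Vs arbitrary: ws)
    case Nil
    then show ?case using forms_smooth[OF \<eta> t] by simp
  next
    case (Cons V Vs)
    then have V: "V \<in> sections A E" by simp
    have "mfd_smooth_on A U (\<lambda>x. \<eta> x (map (triv_inv E \<psi> x) ws @ triv_inv E \<psi> x (\<psi> (V x)) # map (\<lambda>V. V x) Vs))"
    proof (rule mfd_smooth_on_linear[where T = "\<lambda>x w. \<eta> x (map (triv_inv E \<psi> x) ws @ triv_inv E \<psi> x w # map (\<lambda>V. V x) Vs)",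
          OF B triv_open[OF t] sections_smooth[OF V t]])
      show "mfd_smooth_on A U (\<lambda>x. \<eta> x (map (triv_inv E \<psi> x) ws @ triv_inv E \<psi> x b # map (\<lambda>V. V x) Vs))" for b
        using Cons.IH[of "ws @ [b]"] Cons.prems by simp
      fix x assume x: "x \<in> U"
      show "linear (\<lambda>w. \<eta> x (map (triv_inv E \<psi> x) ws @ triv_inv E \<psi> x w # map (\<lambda>V. V x) Vs))"
      proof (rule linear_triv_inv[OF t x])
        have fib: "set (map (triv_inv E \<psi> x) ws) \<subseteq> fibre E x" "set (map (\<lambda>V. V x) Vs) \<subseteq> fibre E x"
          using Cons.prems(2) sections_fibre triv_inv_fibre[OF t x] by auto
        fix a r assume a: "a \<in> fibre E x"
        show "\<eta> x (map (triv_inv E \<psi> x) ws @ vscale E r a # map (\<lambda>V. V x) Vs)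
            = r *\<^sub>R \<eta> x (map (triv_inv E \<psi> x) ws @ a # map (\<lambda>V. V x) Vs)"
          using alt_forms_scale[OF forms_alt[OF \<eta>] fib a] by simp
        fix b assume b: "b \<in> fibre E x"
        show "\<eta> x (map (triv_inv E \<psi> x) ws @ vplus E a b # map (\<lambda>V. V x) Vs)
            = \<eta> x (map (triv_inv E \<psi> x) ws @ a # map (\<lambda>V. V x) Vs)
            + \<eta> x (map (triv_inv E \<psi> x) ws @ b # map (\<lambda>V. V x) Vs)"
          by (rule alt_forms_add[OF forms_alt[OF \<eta>] fib a b])
      qed
    qed
    then show ?case
      by (rule mfd_smooth_on_cong[OF _ triv_open[OF t]]) (simp add: triv_inv_triv[OF t] sections_fibre[OF V])
  qed
  show ?thesis
    unfolding smooth_functions_iff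
  proof (rule mfd_smooth_on_local)
    fix x
    obtain U \<psi> where t: "(U, \<psi>) \<in> trivs E" "x \<in> U" using triv_at .
    have "mfd_smooth_on A U (eval_form \<eta> Vs)"
      using *[OF t(1), of "[]" Vs] True Vs by (simp add: eval_form_def)
    then show "\<exists>N. open N \<and> x \<in> N \<and> mfd_smooth_on A N (eval_form \<eta> Vs)"
      using triv_open t by blast
  qed
qed

end

section \<open>The Chevalley--Eilenberg differential on multilinear maps of sections\<close>

sublocale lie_algebroid \<subseteq> smooth_bundle A E
  using is_bundle by unfold_locales

context smooth_bundle
begin

lemma vplus_vzero: "a \<in> fibre E x \<Longrightarrow> vplus E (vzero E x) a = a" "a \<in> fibre E x \<Longrightarrow> vplus E a (vzero E x) = a"
proof -
  assume a: "a \<in> fibre E x"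
  obtain U \<psi> where t: "(U, \<psi>) \<in> trivs E" "x \<in> U" using triv_at .
  show "vplus E (vzero E x) a = a"
    by (rule triv_inj[OF t]) (simp_all add: a vplus_fibre vzero_fibre triv_vplus[OF t] triv_vzero[OF t])
  show "vplus E a (vzero E x) = a"
    by (rule triv_inj[OF t]) (simp_all add: a vplus_fibre vzero_fibre triv_vplus[OF t] triv_vzero[OF t])
qed

lemma sec_add_vzero: "V \<in> sections A E \<Longrightarrow> sec_add E (vzero E) V = V" "V \<in> sections A E \<Longrightarrow> sec_add E V (vzero E) = V"
  by (simp_all add: sec_add_def vplus_vzero sections_fibre)

end

context lie_algebroid
begin

section \<open>Derivatives along the anchor and rules for the bracket\<close>

abbreviation L :: "('m \<Rightarrow> 'e) \<Rightarrow> ('m \<Rightarrow> real) \<Rightarrow> 'm \<Rightarrow> real" where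
  "L V f \<equiv> anchor_deriv A \<rho> V f"

abbreviation \<Gamma> :: "('m \<Rightarrow> 'e) set" where
  "\<Gamma> \<equiv> sections A E"

lemma anchor_section: "V \<in> \<Gamma> \<Longrightarrow> \<rho> \<circ> V \<in> sections A (tangent_bundle A)"
  by (rule bundle_map_section[OF anchor])

lemma anchor_fibre: "a \<in> fibre E x \<Longrightarrow> \<rho> a \<in> fibre (tangent_bundle A) x"
  and anchor_vplus: "a \<in> fibre E x \<Longrightarrow> b \<in> fibre E x \<Longrightarrow> \<rho> (vplus E a b) = vplus (tangent_bundle A) (\<rho> a) (\<rho> b)"
  and anchor_vscale: "a \<in> fibre E x \<Longrightarrow> \<rho> (vscale E r a) = vscale (tangent_bundle A) r (\<rho> a)"
  using anchor unfolding vbundle_map_def by blast+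

lemma anchor_deriv_apply: "L V f x = tangent_deriv A (\<rho> (V x)) f"
  by (simp add: anchor_deriv_def vf_deriv_def)

lemma anchor_deriv_smooth: "V \<in> \<Gamma> \<Longrightarrow> f \<in> smooth_functions A \<Longrightarrow> L V f \<in> smooth_functions A"
  unfolding anchor_deriv_def by (intro vf_deriv_smooth anchor_section)

lemma anchor_deriv_add:
  "V \<in> \<Gamma> \<Longrightarrow> f \<in> smooth_functions A \<Longrightarrow> g \<in> smooth_functions A \<Longrightarrow>
    L V (\<lambda>x. f x + g x) = (\<lambda>x. L V f x + L V g x)"
  by (simp add: fun_eq_iff anchor_deriv_apply tangent_deriv_add[OF _ _ anchor_fibre[OF sections_fibre]])

lemma anchor_deriv_mult:
  "V \<in> \<Gamma> \<Longrightarrow> f \<in> smooth_functions A \<Longrightarrow> g \<in> smooth_functions A \<Longrightarrow>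
    L V (\<lambda>x. f x * g x) = (\<lambda>x. f x * L V g x + L V f x * g x)"
  by (simp add: fun_eq_iff anchor_deriv_apply tangent_deriv_mult[OF _ _ anchor_fibre[OF sections_fibre]])

lemma anchor_deriv_const: "V \<in> \<Gamma> \<Longrightarrow> L V (\<lambda>x. r) = (\<lambda>x. 0)"
  by (simp add: fun_eq_iff anchor_deriv_apply tangent_deriv_const[OF anchor_fibre[OF sections_fibre]])

lemma anchor_deriv_sec_add:
  assumes "V \<in> \<Gamma>" "W \<in> \<Gamma>" "f \<in> smooth_functions A"
  shows "L (sec_add E V W) f = (\<lambda>x. L V f x + L W f x)"
proof
  fix x
  have f: "V x \<in> fibre E x" "W x \<in> fibre E x" using assms sections_fibre by auto
  show "L (sec_add E V W) f x = L V f x + L W f x"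
    using tangent_deriv_vplus[OF assms(3) anchor_fibre[OF f(1)] anchor_fibre[OF f(2)]]
      anchor_fibre[OF vplus_fibre[OF f]]
    by (simp add: anchor_deriv_apply sec_add_def anchor_vplus[OF f])
qed

lemma anchor_deriv_sec_mult:
  assumes "V \<in> \<Gamma>" "f \<in> smooth_functions A"
  shows "L (sec_mult E g V) f = (\<lambda>x. g x * L V f x)"
proof
  fix x
  have f: "V x \<in> fibre E x" using assms sections_fibre by auto
  show "L (sec_mult E g V) f x = g x * L V f x"
    using tangent_deriv_vscale[OF assms(2) anchor_fibre[OF f]] anchor_fibre[OF vscale_fibre[OF f]]
    by (simp add: anchor_deriv_apply sec_mult_def anchor_vscale[OF f])
qed

lemma eval_differential: "V \<in> \<Gamma> \<Longrightarrow> eval_form (differential A f) [\<rho> \<circ> V] = L V f"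
  using anchor_fibre[OF sections_fibre]
  by (simp add: fun_eq_iff eval_form_def differential_def anchor_deriv_apply)

lemma eval_transpose: "V \<in> \<Gamma> \<Longrightarrow> eval_form (transpose_comp E \<rho> (differential A f)) [V] = L V f"
  using anchor_fibre[OF sections_fibre] sections_fibre
  by (simp add: fun_eq_iff eval_form_def differential_def transpose_comp_def anchor_deriv_apply)

lemma bracket_sec_mult:
  "V \<in> \<Gamma> \<Longrightarrow> W \<in> \<Gamma> \<Longrightarrow> f \<in> smooth_functions A \<Longrightarrow>
    bracket V (sec_mult E f W) = sec_add E (sec_mult E f (bracket V W)) (sec_mult E (L V f) W)"
  by (simp add: leibniz eval_differential)

text \<open>Polarisation of \<open>{V + W, V + W} = 0\<close>. The form as a sum avoids negatives of
  sections, for which the bundle record has no operation.\<close>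

lemma bracket_antisym:
  assumes V: "V \<in> \<Gamma>" and W: "W \<in> \<Gamma>"
  shows "sec_add E (bracket V W) (bracket W V) = vzero E"
proof -
  have "vzero E = bracket (sec_add E W V) (sec_add E W V)"
    using bracket_alternating sec_add_closed V W by simp
  also have "\<dots> = sec_add E (sec_add E (bracket W W) (bracket V W)) (sec_add E (bracket W V) (bracket V V))"
    by (simp add: bracket_add_left bracket_add_right sec_add_closed V W)
  also have "\<dots> = sec_add E (bracket V W) (bracket W V)"
    by (simp add: bracket_alternating V W sec_add_vzero bracket_closed)
  finally show ?thesis by simp
qed

section \<open>Cochains: alternating function-linear maps on lists of sections\<close>

definition smooth_map :: "(('m \<Rightarrow> 'e) list \<Rightarrow> 'm \<Rightarrow> real) \<Rightarrow> bool" where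
  "smooth_map F \<longleftrightarrow> (\<forall>Vs. set Vs \<subseteq> \<Gamma> \<longrightarrow> F Vs \<in> smooth_functions A)"

text \<open>Lists of all lengths are admitted, so a cochain may have components of several degrees.\<close>

definition cochain :: "(('m \<Rightarrow> 'e) list \<Rightarrow> 'm \<Rightarrow> real) \<Rightarrow> bool" where
  "cochain F \<longleftrightarrow> smooth_map F \<and>
     (\<forall>xs ys V W. set xs \<subseteq> \<Gamma> \<longrightarrow> set ys \<subseteq> \<Gamma> \<longrightarrow> V \<in> \<Gamma> \<longrightarrow> W \<in> \<Gamma> \<longrightarrow>
        F (xs @ sec_add E V W # ys) = (\<lambda>x. F (xs @ V # ys) x + F (xs @ W # ys) x) \<and>
        F (xs @ W # V # ys) = (\<lambda>x. - F (xs @ V # W # ys) x)) \<and>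
     (\<forall>xs ys V f. set xs \<subseteq> \<Gamma> \<longrightarrow> set ys \<subseteq> \<Gamma> \<longrightarrow> V \<in> \<Gamma> \<longrightarrow> f \<in> smooth_functions A \<longrightarrow>
        F (xs @ sec_mult E f V # ys) = (\<lambda>x. f x * F (xs @ V # ys) x))"

lemma smooth_mapD: "smooth_map F \<Longrightarrow> set Vs \<subseteq> \<Gamma> \<Longrightarrow> F Vs \<in> smooth_functions A"
  by (simp add: smooth_map_def)

lemma smooth_map_Cons: "smooth_map F \<Longrightarrow> V \<in> \<Gamma> \<Longrightarrow> smooth_map (\<lambda>Ws. F (V # Ws))"
  by (simp add: smooth_map_def)

lemma cochainI:
  assumes "smooth_map F"
    and "\<And>xs ys V W. set xs \<subseteq> \<Gamma> \<Longrightarrow> set ys \<subseteq> \<Gamma> \<Longrightarrow> V \<in> \<Gamma> \<Longrightarrow> W \<in> \<Gamma> \<Longrightarrow>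
        F (xs @ sec_add E V W # ys) = (\<lambda>x. F (xs @ V # ys) x + F (xs @ W # ys) x)"
    and "\<And>xs ys V W. set xs \<subseteq> \<Gamma> \<Longrightarrow> set ys \<subseteq> \<Gamma> \<Longrightarrow> V \<in> \<Gamma> \<Longrightarrow> W \<in> \<Gamma> \<Longrightarrow>
        F (xs @ W # V # ys) = (\<lambda>x. - F (xs @ V # W # ys) x)"
    and "\<And>xs ys V f. set xs \<subseteq> \<Gamma> \<Longrightarrow> set ys \<subseteq> \<Gamma> \<Longrightarrow> V \<in> \<Gamma> \<Longrightarrow> f \<in> smooth_functions A \<Longrightarrow>
        F (xs @ sec_mult E f V # ys) = (\<lambda>x. f x * F (xs @ V # ys) x)"
  shows "cochain F"
  unfolding cochain_def by (intro conjI allI impI assms)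

lemma cochain_smooth: "cochain F \<Longrightarrow> smooth_map F"
  by (simp add: cochain_def)

lemma cochain_add:
  assumes "cochain F" "set xs \<subseteq> \<Gamma>" "set ys \<subseteq> \<Gamma>" "V \<in> \<Gamma>" "W \<in> \<Gamma>"
  shows "F (xs @ sec_add E V W # ys) = (\<lambda>x. F (xs @ V # ys) x + F (xs @ W # ys) x)"
  using assms unfolding cochain_def by blast

lemma cochain_swap:
  assumes "cochain F" "set xs \<subseteq> \<Gamma>" "set ys \<subseteq> \<Gamma>" "V \<in> \<Gamma>" "W \<in> \<Gamma>"
  shows "F (xs @ W # V # ys) = (\<lambda>x. - F (xs @ V # W # ys) x)"
  using assms unfolding cochain_def by blast

lemma cochain_mult:
  assumes "cochain F" "set xs \<subseteq> \<Gamma>" "set ys \<subseteq> \<Gamma>" "V \<in> \<Gamma>" "f \<in> smooth_functions A"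
  shows "F (xs @ sec_mult E f V # ys) = (\<lambda>x. f x * F (xs @ V # ys) x)"
  using assms unfolding cochain_def by blast

lemmas cochain_add_head = cochain_add[where xs = "[]", simplified]
  and cochain_swap_head = cochain_swap[where xs = "[]", simplified]
  and cochain_mult_head = cochain_mult[where xs = "[]", simplified]

text \<open>This is the interior product with \<open>V\<close>. It keeps recursions on the argument
  list within the class of cochains.\<close>

lemma cochain_Cons: "cochain F \<Longrightarrow> V \<in> \<Gamma> \<Longrightarrow> cochain (\<lambda>Ws. F (V # Ws))"
proof (rule cochainI)
  assume F: "cochain F" and V: "V \<in> \<Gamma>"
  show "smooth_map (\<lambda>Ws. F (V # Ws))" using F V by (intro smooth_map_Cons cochain_smooth)
  fix xs ys W W' f assume *: "set xs \<subseteq> \<Gamma>" "set ys \<subseteq> \<Gamma>" "W \<in> \<Gamma>"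
  show "f \<in> smooth_functions A \<Longrightarrow> F (V # xs @ sec_mult E f W # ys) = (\<lambda>x. f x * F (V # xs @ W # ys) x)"
    using cochain_mult[OF F, of "V # xs"] V * by simp
  assume W': "W' \<in> \<Gamma>"
  show "F (V # xs @ sec_add E W W' # ys) = (\<lambda>x. F (V # xs @ W # ys) x + F (V # xs @ W' # ys) x)"
    using cochain_add[OF F _ *(2,3) W', of "V # xs"] V *(1) by simp
  show "F (V # xs @ W' # W # ys) = (\<lambda>x. - F (V # xs @ W # W' # ys) x)"
    using cochain_swap[OF F _ *(2,3) W', of "V # xs"] V *(1) by simp
qed

lemma cochain_vzero:
  assumes F: "cochain F" and xs: "set xs \<subseteq> \<Gamma>" and ys: "set ys \<subseteq> \<Gamma>"
  shows "F (xs @ vzero E # ys) = (\<lambda>x. 0)"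
proof -
  have "F (xs @ vzero E # ys) = F (xs @ sec_add E (vzero E) (vzero E) # ys)"
    by (simp add: sec_add_vzero vzero_section)
  also have "\<dots> = (\<lambda>x. F (xs @ vzero E # ys) x + F (xs @ vzero E # ys) x)"
    by (rule cochain_add[OF F xs ys vzero_section vzero_section])
  finally show ?thesis by (simp add: fun_eq_iff)
qed

lemma cochain_bracket_swap:
  assumes F: "cochain F" and s: "set ys \<subseteq> \<Gamma>" "V \<in> \<Gamma>" "W \<in> \<Gamma>"
  shows "F (bracket W V # ys) x = - F (bracket V W # ys) x"
  using cochain_add_head[OF F s(1) bracket_closed[OF s(2,3)] bracket_closed[OF s(3,2)]]
  by (simp add: bracket_antisym[OF s(2,3)] cochain_vzero[OF F _ s(1), of "[]", simplified] fun_eq_iff) (metis add.commute add_eq_0_iff)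

section \<open>The Lie derivative of a cochain\<close>

text \<open>The commutation rule \<open>i_W L_V = L_V i_W - i_{V,W}\<close> as a recursion on the
  arguments. Unfolded, it is the usual formula that subtracts one bracket term for each
  slot.\<close>

primrec lie_der :: "('m \<Rightarrow> 'e) \<Rightarrow> (('m \<Rightarrow> 'e) list \<Rightarrow> 'm \<Rightarrow> real) \<Rightarrow> ('m \<Rightarrow> 'e) list \<Rightarrow> 'm \<Rightarrow> real" where
  "lie_der V F [] = L V (F [])"
| "lie_der V F (W # Ws) = (\<lambda>x. lie_der V (\<lambda>Zs. F (W # Zs)) Ws x - F (bracket V W # Ws) x)"

lemma lie_der_smooth:
  assumes "V \<in> \<Gamma>"
  shows "smooth_map F \<Longrightarrow> set Ws \<subseteq> \<Gamma> \<Longrightarrow> lie_der V F Ws \<in> smooth_functions A"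
  by (induction Ws arbitrary: F)
    (simp_all add: assms anchor_deriv_smooth smooth_mapD smooth_functions_diff smooth_map_Cons bracket_closed)

text \<open>The decomposition of \<open>F\<close> is required on lists of sections only, since the
  cochain laws provide it only there. The lemmas that follow have the same shape.\<close>

lemma lie_der_add:
  assumes V: "V \<in> \<Gamma>"
  shows "smooth_map G \<Longrightarrow> smooth_map H \<Longrightarrow> set Ws \<subseteq> \<Gamma> \<Longrightarrow>
    (\<And>Zs. set Zs \<subseteq> \<Gamma> \<Longrightarrow> F Zs = (\<lambda>x. G Zs x + H Zs x)) \<Longrightarrow>
    lie_der V F Ws x = lie_der V G Ws x + lie_der V H Ws x"
proof (induction Ws arbitrary: F G H)
  case Nil
  then show ?case by (simp add: anchor_deriv_add V smooth_mapD)
next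
  case (Cons W Ws)
  have "lie_der V (\<lambda>Zs. F (W # Zs)) Ws x = lie_der V (\<lambda>Zs. G (W # Zs)) Ws x + lie_der V (\<lambda>Zs. H (W # Zs)) Ws x"
    by (rule Cons.IH) (use Cons.prems in \<open>simp_all add: smooth_map_Cons\<close>)
  then show ?case using Cons.prems by (simp add: bracket_closed V)
qed

text \<open>The derivative of \<open>f\<close> arises once, at the empty list, where the function
  \<open>f * G []\<close> is differentiated; the bracket terms merely carry the factor
  \<open>f\<close>.\<close>

lemma lie_der_mult:
  assumes V: "V \<in> \<Gamma>" and f: "f \<in> smooth_functions A"
  shows "smooth_map G \<Longrightarrow> set Ws \<subseteq> \<Gamma> \<Longrightarrow>
    (\<And>Zs. set Zs \<subseteq> \<Gamma> \<Longrightarrow> F Zs = (\<lambda>x. f x * G Zs x)) \<Longrightarrow>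
    lie_der V F Ws x = f x * lie_der V G Ws x + L V f x * G Ws x"
proof (induction Ws arbitrary: F G)
  case Nil
  then show ?case by (simp add: anchor_deriv_mult V f smooth_mapD)
next
  case (Cons W Ws)
  have "lie_der V (\<lambda>Zs. F (W # Zs)) Ws x = f x * lie_der V (\<lambda>Zs. G (W # Zs)) Ws x + L V f x * G (W # Ws) x"
    by (rule Cons.IH) (use Cons.prems in \<open>simp_all add: smooth_map_Cons\<close>)
  then show ?case using Cons.prems by (simp add: bracket_closed V algebra_simps)
qed

lemma lie_der_scale:
  assumes "V \<in> \<Gamma>" "smooth_map G" "set Ws \<subseteq> \<Gamma>" "\<And>Zs. set Zs \<subseteq> \<Gamma> \<Longrightarrow> F Zs = (\<lambda>x. r * G Zs x)"
  shows "lie_der V F Ws x = r * lie_der V G Ws x"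
  using lie_der_mult[OF assms(1) smooth_functions_const[of r] assms(2,3), of F] assms(4)
  by (simp add: anchor_deriv_const assms(1))

lemma lie_der_uminus:
  assumes "V \<in> \<Gamma>" "smooth_map G" "set Ws \<subseteq> \<Gamma>" "\<And>Zs. set Zs \<subseteq> \<Gamma> \<Longrightarrow> F Zs = (\<lambda>x. - G Zs x)"
  shows "lie_der V F Ws x = - lie_der V G Ws x"
  using lie_der_scale[OF assms(1-3), of F "-1"] assms(4) by simp

text \<open>In each of the three laws the affected slot is brought to the head by induction on
  \<open>xs\<close>; only there do the bracket terms interact with the law.\<close>

lemma cochain_lie_der:
  assumes V: "V \<in> \<Gamma>" and F: "cochain F"
  shows "cochain (lie_der V F)"
proof (rule cochainI)
  show "smooth_map (lie_der V F)" using lie_der_smooth[OF V cochain_smooth[OF F]] by (simp add: smooth_map_def)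
next
  fix xs ys X Y assume "set xs \<subseteq> \<Gamma>" and s: "set ys \<subseteq> \<Gamma>" "X \<in> \<Gamma>" "Y \<in> \<Gamma>"
  then show "lie_der V F (xs @ sec_add E X Y # ys) = (\<lambda>x. lie_der V F (xs @ X # ys) x + lie_der V F (xs @ Y # ys) x)"
    using F
  proof (induction xs arbitrary: F)
    case Nil
    note sm = cochain_smooth[OF cochain_Cons[OF \<open>cochain F\<close>]]
    have "lie_der V (\<lambda>Zs. F (sec_add E X Y # Zs)) ys x =
        lie_der V (\<lambda>Zs. F (X # Zs)) ys x + lie_der V (\<lambda>Zs. F (Y # Zs)) ys x" for x
      by (rule lie_der_add[OF V sm[OF s(2)] sm[OF s(3)] s(1)]) (rule cochain_add_head[OF Nil.prems(5) _ s(2,3)])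
    then show ?case
      using s V Nil.prems by (simp add: bracket_add_right cochain_add_head bracket_closed fun_eq_iff)
  next
    case (Cons Z xs)
    have "F (bracket V Z # xs @ sec_add E X Y # ys)
      = (\<lambda>x. F (bracket V Z # xs @ X # ys) x + F (bracket V Z # xs @ Y # ys) x)"
      using cochain_add[OF Cons.prems(5), of "bracket V Z # xs"] Cons.prems V by (simp add: bracket_closed)
    then show ?case using Cons by (simp add: cochain_Cons fun_eq_iff)
  qed
next
  fix xs ys X Y assume "set xs \<subseteq> \<Gamma>" and s: "set ys \<subseteq> \<Gamma>" "X \<in> \<Gamma>" "Y \<in> \<Gamma>"
  then show "lie_der V F (xs @ Y # X # ys) = (\<lambda>x. - lie_der V F (xs @ X # Y # ys) x)"
    using F
  proof (induction xs arbitrary: F)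
    case Nil
    note sm = cochain_smooth[OF cochain_Cons[OF cochain_Cons[OF \<open>cochain F\<close>]]]
    have "lie_der V (\<lambda>Zs. F (Y # X # Zs)) ys x = - lie_der V (\<lambda>Zs. F (X # Y # Zs)) ys x" for x
      by (rule lie_der_uminus[OF V sm[OF s(2,3)] s(1)]) (rule cochain_swap_head[OF Nil.prems(5) _ s(2,3)])
    \<comment> \<open>The bracket terms change places: \<open>{V, Y}\<close> is in the first slot
      for the order \<open>Y, X\<close> and in the second slot for the order \<open>X, Y\<close>,
      and conversely for \<open>{V, X}\<close>.\<close>
    moreover have "F (bracket V Y # X # ys) = (\<lambda>x. - F (X # bracket V Y # ys) x)"
      by (rule cochain_swap_head[OF Nil.prems(5) s(1,2) bracket_closed[OF V s(3)]])
    moreover have "F (Y # bracket V X # ys) = (\<lambda>x. - F (bracket V X # Y # ys) x)"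
      by (rule cochain_swap_head[OF Nil.prems(5) s(1) bracket_closed[OF V s(2)] s(3)])
    ultimately show ?case by (simp add: fun_eq_iff)
  next
    case (Cons Z xs)
    have "F (bracket V Z # xs @ Y # X # ys) = (\<lambda>x. - F (bracket V Z # xs @ X # Y # ys) x)"
      using cochain_swap[OF Cons.prems(5) _ s, of "bracket V Z # xs"] Cons.prems(1) V by (simp add: bracket_closed)
    then show ?case using Cons by (simp add: cochain_Cons fun_eq_iff)
  qed
next
  fix xs ys X f assume "set xs \<subseteq> \<Gamma>" and s: "set ys \<subseteq> \<Gamma>" "X \<in> \<Gamma>" "f \<in> smooth_functions A"
  then show "lie_der V F (xs @ sec_mult E f X # ys) = (\<lambda>x. f x * lie_der V F (xs @ X # ys) x)"
    using F
  proof (induction xs arbitrary: F)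
    case Nil
    note sm = cochain_smooth[OF cochain_Cons[OF \<open>cochain F\<close>]]
    have "lie_der V (\<lambda>Zs. F (sec_mult E f X # Zs)) ys x =
        f x * lie_der V (\<lambda>Zs. F (X # Zs)) ys x + L V f x * F (X # ys) x" for x
      by (rule lie_der_mult[OF V s(3) sm[OF s(2)] s(1)]) (rule cochain_mult_head[OF Nil.prems(5) _ s(2,3)])
    \<comment> \<open>The Leibniz term of \<open>{V, f X}\<close> contributes
      \<open>- (L V f) F(X, ...)\<close>, which cancels the derivative term above.\<close>
    then show ?case
      using s V Nil.prems
      by (simp add: bracket_sec_mult cochain_add_head cochain_mult_head bracket_closed sec_mult_closed
          anchor_deriv_smooth fun_eq_iff algebra_simps)
  next
    case (Cons Z xs)
    have "F (bracket V Z # xs @ sec_mult E f X # ys) = (\<lambda>x. f x * F (bracket V Z # xs @ X # ys) x)"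
      using cochain_mult[OF Cons.prems(5), of "bracket V Z # xs"] Cons.prems V by (simp add: bracket_closed)
    then show ?case using Cons by (simp add: cochain_Cons fun_eq_iff algebra_simps)
  qed
qed

text \<open>Cartan's formula \<open>i\<^sub>V d = L\<^sub>V - d i\<^sub>V\<close>, read as a recursion on the list of arguments.\<close>

primrec ce_diff :: "(('m \<Rightarrow> 'e) list \<Rightarrow> 'm \<Rightarrow> real) \<Rightarrow> ('m \<Rightarrow> 'e) list \<Rightarrow> 'm \<Rightarrow> real" where
  "ce_diff F [] = (\<lambda>x. 0)"
| "ce_diff F (V # Vs) = (\<lambda>x. lie_der V F Vs x - ce_diff (\<lambda>Ws. F (V # Ws)) Vs x)"

lemma ce_diff_smooth: "smooth_map F \<Longrightarrow> set Vs \<subseteq> \<Gamma> \<Longrightarrow> ce_diff F Vs \<in> smooth_functions A"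
  by (induction Vs arbitrary: F)
    (simp_all add: smooth_functions_const smooth_functions_diff lie_der_smooth smooth_map_Cons)

lemma ce_diff_add:
  "smooth_map G \<Longrightarrow> smooth_map H \<Longrightarrow> set Ws \<subseteq> \<Gamma> \<Longrightarrow>
    (\<And>Zs. set Zs \<subseteq> \<Gamma> \<Longrightarrow> F Zs = (\<lambda>x. G Zs x + H Zs x)) \<Longrightarrow>
    ce_diff F Ws x = ce_diff G Ws x + ce_diff H Ws x"
proof (induction Ws arbitrary: F G H)
  case (Cons W Ws)
  have "ce_diff (\<lambda>Zs. F (W # Zs)) Ws x = ce_diff (\<lambda>Zs. G (W # Zs)) Ws x + ce_diff (\<lambda>Zs. H (W # Zs)) Ws x"
    by (rule Cons.IH) (use Cons.prems in \<open>simp_all add: smooth_map_Cons\<close>)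
  moreover have "lie_der W F Ws x = lie_der W G Ws x + lie_der W H Ws x"
    using Cons.prems by (intro lie_der_add) auto
  ultimately show ?case by simp
qed simp

lemma ce_diff_scale:
  "smooth_map G \<Longrightarrow> set Ws \<subseteq> \<Gamma> \<Longrightarrow> (\<And>Zs. set Zs \<subseteq> \<Gamma> \<Longrightarrow> F Zs = (\<lambda>x. r * G Zs x)) \<Longrightarrow>
    ce_diff F Ws x = r * ce_diff G Ws x"
proof (induction Ws arbitrary: F G)
  case (Cons W Ws)
  have "ce_diff (\<lambda>Zs. F (W # Zs)) Ws x = r * ce_diff (\<lambda>Zs. G (W # Zs)) Ws x"
    by (rule Cons.IH) (use Cons.prems in \<open>simp_all add: smooth_map_Cons\<close>)
  moreover have "lie_der W F Ws x = r * lie_der W G Ws x"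
    using Cons.prems by (intro lie_der_scale) auto
  ultimately show ?case by (simp add: right_diff_distrib)
qed simp

lemma ce_diff_uminus:
  assumes "smooth_map G" "set Ws \<subseteq> \<Gamma>" "\<And>Zs. set Zs \<subseteq> \<Gamma> \<Longrightarrow> F Zs = (\<lambda>x. - G Zs x)"
  shows "ce_diff F Ws x = - ce_diff G Ws x"
  using ce_diff_scale[OF assms(1,2), of F "-1"] assms(3) by simp

text \<open>Expanding the recursion twice gives
  \<open>i\<^sub>W i\<^sub>V d = L\<^sub>V i\<^sub>W - L\<^sub>W i\<^sub>V - i\<^bsub>{V, W}\<^esub> + d i\<^sub>W i\<^sub>V\<close>, which is visibly antisymmetric in \<open>V\<close> and \<open>W\<close>.\<close>

lemma ce_diff_swap_head:
  assumes F: "cochain F" and s: "set ys \<subseteq> \<Gamma>" "V \<in> \<Gamma>" "W \<in> \<Gamma>"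
  shows "ce_diff F (W # V # ys) x = - ce_diff F (V # W # ys) x"
proof -
  have "ce_diff (\<lambda>Zs. F (W # V # Zs)) ys x = - ce_diff (\<lambda>Zs. F (V # W # Zs)) ys x"
    by (rule ce_diff_uminus[OF cochain_smooth[OF cochain_Cons[OF cochain_Cons[OF F s(2)] s(3)]] s(1)])
      (rule cochain_swap_head[OF F _ s(2,3)])
  moreover have "F (bracket W V # ys) x = - F (bracket V W # ys) x"
    by (rule cochain_bracket_swap[OF F s])
  ultimately show ?thesis by simp
qed

text \<open>With a further argument \<open>Y\<close>, the swap puts \<open>Y\<close> in front.
  Unfolding the recursion at \<open>Y\<close> leaves the sum in the head of a Lie derivative, which
  is a cochain, and in the head of a shorter list. The empty list is left, where the claim is
  additivity of the anchor.\<close>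

lemma ce_diff_add_head:
  assumes V: "V \<in> \<Gamma>" and W: "W \<in> \<Gamma>"
  shows "cochain F \<Longrightarrow> set ys \<subseteq> \<Gamma> \<Longrightarrow>
    ce_diff F (sec_add E V W # ys) x = ce_diff F (V # ys) x + ce_diff F (W # ys) x"
proof (induction ys arbitrary: F)
  case Nil
  then show ?case by (simp add: anchor_deriv_sec_add V W smooth_mapD[OF cochain_smooth])
next
  case (Cons Y ys)
  then have Y: "Y \<in> \<Gamma>" "set ys \<subseteq> \<Gamma>" by auto
  have "ce_diff (\<lambda>Zs. F (Y # Zs)) (sec_add E V W # ys) x =
      ce_diff (\<lambda>Zs. F (Y # Zs)) (V # ys) x + ce_diff (\<lambda>Zs. F (Y # Zs)) (W # ys) x"
    by (rule Cons.IH[OF cochain_Cons[OF Cons.prems(1) Y(1)] Y(2)])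
  moreover have "lie_der Y F (sec_add E V W # ys) x = lie_der Y F (V # ys) x + lie_der Y F (W # ys) x"
    by (simp only: cochain_add_head[OF cochain_lie_der[OF Y(1) Cons.prems(1)] Y(2) V W])
  ultimately have "ce_diff F (Y # sec_add E V W # ys) x = ce_diff F (Y # V # ys) x + ce_diff F (Y # W # ys) x"
    unfolding ce_diff.simps(2)[of _ Y] by simp
  then show ?case
    by (simp only: ce_diff_swap_head[OF Cons.prems(1) Y(2) Y(1)] V W sec_add_closed)
qed

text \<open>Unfolding at \<open>f V\<close> directly would give two summands neither of which is
  linear over functions: both differentiate \<open>f\<close>. The detour through \<open>Y\<close>,
  as for sums, avoids these terms.\<close>

lemma ce_diff_mult_head:
  assumes V: "V \<in> \<Gamma>" and f: "f \<in> smooth_functions A"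
  shows "cochain F \<Longrightarrow> set ys \<subseteq> \<Gamma> \<Longrightarrow> ce_diff F (sec_mult E f V # ys) x = f x * ce_diff F (V # ys) x"
proof (induction ys arbitrary: F)
  case Nil
  then show ?case by (simp add: anchor_deriv_sec_mult V smooth_mapD[OF cochain_smooth])
next
  case (Cons Y ys)
  then have Y: "Y \<in> \<Gamma>" "set ys \<subseteq> \<Gamma>" by auto
  have "ce_diff (\<lambda>Zs. F (Y # Zs)) (sec_mult E f V # ys) x = f x * ce_diff (\<lambda>Zs. F (Y # Zs)) (V # ys) x"
    by (rule Cons.IH[OF cochain_Cons[OF Cons.prems(1) Y(1)] Y(2)])
  moreover have "lie_der Y F (sec_mult E f V # ys) x = f x * lie_der Y F (V # ys) x"
    by (simp only: cochain_mult_head[OF cochain_lie_der[OF Y(1) Cons.prems(1)] Y(2) V f])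
  ultimately have "ce_diff F (Y # sec_mult E f V # ys) x = f x * ce_diff F (Y # V # ys) x"
    unfolding ce_diff.simps(2)[of _ Y] by (simp add: right_diff_distrib)
  then show ?case
    using ce_diff_swap_head[OF Cons.prems(1) Y(2) Y(1), of _ x] V sec_mult_closed[OF f V]
    by (metis minus_mult_right)
qed

lemma cochain_ce_diff:
  assumes F: "cochain F"
  shows "cochain (ce_diff F)"
proof (rule cochainI)
  show "smooth_map (ce_diff F)" using ce_diff_smooth[OF cochain_smooth[OF F]] by (simp add: smooth_map_def)
next
  fix xs ys V W assume "set xs \<subseteq> \<Gamma>" and s: "set ys \<subseteq> \<Gamma>" "V \<in> \<Gamma>" "W \<in> \<Gamma>"
  then show "ce_diff F (xs @ sec_add E V W # ys) = (\<lambda>x. ce_diff F (xs @ V # ys) x + ce_diff F (xs @ W # ys) x)"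
    using F
  proof (induction xs arbitrary: F)
    case Nil
    show ?case unfolding append_Nil by (rule ext) (rule ce_diff_add_head[OF s(2,3) Nil.prems(5) s(1)])
  next
    case (Cons Z xs)
    then show ?case
      using cochain_add[OF cochain_lie_der[OF _ Cons.prems(5)]] by (simp add: cochain_Cons fun_eq_iff)
  qed
next
  fix xs ys V W assume "set xs \<subseteq> \<Gamma>" and s: "set ys \<subseteq> \<Gamma>" "V \<in> \<Gamma>" "W \<in> \<Gamma>"
  then show "ce_diff F (xs @ W # V # ys) = (\<lambda>x. - ce_diff F (xs @ V # W # ys) x)"
    using F
  proof (induction xs arbitrary: F)
    case Nil
    show ?case unfolding append_Nil by (rule ext) (rule ce_diff_swap_head[OF Nil.prems(5) s])
  next
    case (Cons Z xs)
    then show ?case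
      using cochain_swap[OF cochain_lie_der[OF _ Cons.prems(5)] _ s, of Z xs]
      by (simp add: cochain_Cons fun_eq_iff)
  qed
next
  fix xs ys V f assume "set xs \<subseteq> \<Gamma>" and s: "set ys \<subseteq> \<Gamma>" "V \<in> \<Gamma>" "f \<in> smooth_functions A"
  then show "ce_diff F (xs @ sec_mult E f V # ys) = (\<lambda>x. f x * ce_diff F (xs @ V # ys) x)"
    using F
  proof (induction xs arbitrary: F)
    case Nil
    show ?case unfolding append_Nil by (rule ext) (rule ce_diff_mult_head[OF s(2,3) Nil.prems(5) s(1)])
  next
    case (Cons Z xs)
    then show ?case
      using cochain_mult[OF cochain_lie_der[OF _ Cons.prems(5)]]
      by (simp add: cochain_Cons fun_eq_iff right_diff_distrib)
  qed
qed

section \<open>The recursions as explicit alternating sums\<close>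

text \<open>\<open>omit I p\<close> is \<open>select I (Suc p)\<close>. Counting the entries admits
  the empty list, which is where the inductions on \<open>n\<close> start.\<close>

definition select :: "nat set \<Rightarrow> nat \<Rightarrow> (nat \<Rightarrow> 'v) \<Rightarrow> 'v list" where
  "select I n V = map V (filter (\<lambda>k. k \<notin> I) [0..<n])"

lemma select_Suc:
  "select I (Suc n) V = (if 0 \<in> I then [] else [V 0]) @ select {k. Suc k \<in> I} n (V \<circ> Suc)"
  by (simp add: select_def upt_conv_Cons filter_map comp_def flip: map_Suc_upt del: upt_Suc)

lemma select_empty: "select {} n V = map V [0..<n]"
  by (simp add: select_def)

lemma set_select: "(\<And>i. i < n \<Longrightarrow> V i \<in> S) \<Longrightarrow> set (select I n V) \<subseteq> S"
  by (auto simp: select_def)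

text \<open>The usual formula has the bracket in slot \<open>j\<close>; bringing it to the front
  costs \<open>(-1) ^ j\<close>.\<close>

lemma lie_der_formula:
  assumes V: "V \<in> \<Gamma>"
  shows "cochain F \<Longrightarrow> (\<And>i. i < n \<Longrightarrow> W i \<in> \<Gamma>) \<Longrightarrow>
    lie_der V F (select {} n W) x = L V (F (select {} n W)) x
      - (\<Sum>j<n. (-1) ^ j * F (bracket V (W j) # select {j} n W) x)"
proof (induction n arbitrary: F W)
  case 0
  then show ?case by (simp add: select_def)
next
  case (Suc n)
  have W: "W 0 \<in> \<Gamma>" "\<And>i. i < n \<Longrightarrow> (W \<circ> Suc) i \<in> \<Gamma>" using Suc.prems(2) by auto
  have sel: "set (select I n (W \<circ> Suc)) \<subseteq> \<Gamma>" for I by (rule set_select) (rule W(2))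
  \<comment> \<open>Passing \<open>W 0\<close> yields the one sign by which \<open>(-1) ^ j\<close>
    and \<open>(-1) ^ Suc j\<close> differ.\<close>
  have "F (bracket V (W (Suc j)) # W 0 # select {j} n (W \<circ> Suc)) x =
      - F (W 0 # bracket V (W (Suc j)) # select {j} n (W \<circ> Suc)) x" if "j < n" for j
    using fun_cong[OF cochain_swap_head[OF Suc.prems(1) sel W(1) bracket_closed[OF V W(2)[OF that]]]]
    by simp
  then have "(\<Sum>j<n. (-1) ^ j * F (bracket V (W (Suc j)) # W 0 # select {j} n (W \<circ> Suc)) x) =
      - (\<Sum>j<n. (-1) ^ j * F (W 0 # bracket V (W (Suc j)) # select {j} n (W \<circ> Suc)) x)"
    by (simp add: sum_negf)
  moreover have "lie_der V (\<lambda>Zs. F (W 0 # Zs)) (select {} n (W \<circ> Suc)) x =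
      L V (F (W 0 # select {} n (W \<circ> Suc))) x
      - (\<Sum>j<n. (-1) ^ j * F (W 0 # bracket V ((W \<circ> Suc) j) # select {j} n (W \<circ> Suc)) x)"
    by (rule Suc.IH[OF cochain_Cons[OF Suc.prems(1) W(1)]]) (rule W(2))
  ultimately show ?case
    by (simp add: select_Suc sum.lessThan_Suc_shift sum_negf del: sum.lessThan_Suc)
qed

text \<open>The terms that involve index 0 come from the Lie derivative along \<open>V 0\<close>;
  all others come from the recursive call, with indices shifted by one and a minus sign in
  front.\<close>

lemma ce_diff_formula:
  "cochain F \<Longrightarrow> (\<And>i. i < n \<Longrightarrow> V i \<in> \<Gamma>) \<Longrightarrow>
    ce_diff F (select {} n V) x =
      (\<Sum>i<n. (-1) ^ i * L (V i) (F (select {i} n V)) x) +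
      (\<Sum>j<n. \<Sum>i<j. (-1) ^ (i + j) * F (bracket (V i) (V j) # select {i, j} n V) x)"
proof (induction n arbitrary: F V)
  case 0
  then show ?case by (simp add: select_def)
next
  case (Suc n)
  have V: "V 0 \<in> \<Gamma>" "\<And>i. i < n \<Longrightarrow> (V \<circ> Suc) i \<in> \<Gamma>" using Suc.prems(2) by auto
  let ?V = "V \<circ> Suc"
  have sel: "set (select I n ?V) \<subseteq> \<Gamma>" for I by (rule set_select) (rule V(2))
  \<comment> \<open>Shifting both \<open>i\<close> and \<open>j\<close> leaves the parity of
    \<open>i + j\<close> unchanged, so the minus sign of the recursion must be absorbed by moving
    the bracket past \<open>V 0\<close>. In the single sum the shift itself absorbs it.\<close>
  have *: "(-1) ^ (i + j) * F (bracket (?V i) (?V j) # V 0 # select {i, j} n ?V) x =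
      - ((-1) ^ (i + j) * F (V 0 # bracket (?V i) (?V j) # select {i, j} n ?V) x)" if "i < j" "j < n" for i j
    using fun_cong[OF cochain_swap_head[OF Suc.prems(1) sel V(1) bracket_closed[OF V(2)[of i] V(2)[OF that(2)]]]] that
    by simp
  have double: "(\<Sum>j<n. \<Sum>i<j. (-1) ^ (i + j) * F (bracket (?V i) (?V j) # V 0 # select {i, j} n ?V) x) =
      - (\<Sum>j<n. \<Sum>i<j. (-1) ^ (i + j) * F (V 0 # bracket (?V i) (?V j) # select {i, j} n ?V) x)"
    unfolding sum_negf[symmetric] by (intro sum.cong refl *) auto
  have [simp]: "{k. k = i \<or> k = j} = {i, j}" for i j :: nat by auto
  have "ce_diff (\<lambda>Zs. F (V 0 # Zs)) (select {} n ?V) x =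
      (\<Sum>i<n. (-1) ^ i * L (?V i) (F (V 0 # select {i} n ?V)) x) +
      (\<Sum>j<n. \<Sum>i<j. (-1) ^ (i + j) * F (V 0 # bracket (?V i) (?V j) # select {i, j} n ?V) x)"
    by (rule Suc.IH[OF cochain_Cons[OF Suc.prems(1) V(1)]]) (rule V(2))
  moreover have "lie_der (V 0) F (select {} n ?V) x = L (V 0) (F (select {} n ?V)) x
      - (\<Sum>j<n. (-1) ^ j * F (bracket (V 0) (?V j) # select {j} n ?V) x)"
    by (rule lie_der_formula[OF V(1) Suc.prems(1)]) (rule V(2))
  ultimately show ?case
    using double
    by (simp add: select_Suc sum.lessThan_Suc_shift sum_negf sum.distrib sum_subtractf del: sum.lessThan_Suc)
qed

end

section \<open>From multilinear maps of sections to forms\<close>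

context smooth_bundle
begin

lemma vscale_0: "a \<in> fibre E x \<Longrightarrow> vscale E 0 a = vzero E x"
proof -
  assume a: "a \<in> fibre E x"
  obtain U \<psi> where t: "(U, \<psi>) \<in> trivs E" "x \<in> U" using triv_at .
  show ?thesis
    by (rule triv_inj[OF t]) (simp_all add: a vscale_fibre vzero_fibre triv_vscale[OF t] triv_vzero[OF t])
qed

lemma sections_through:
  assumes "set vs \<subseteq> fibre E x"
  obtains Vs where "set Vs \<subseteq> sections A E" "map (\<lambda>V. V x) Vs = vs"
proof -
  have "\<exists>Vs. set Vs \<subseteq> sections A E \<and> map (\<lambda>V. V x) Vs = vs"
    using assms
  proof (induction vs)
    case (Cons v vs)
    then obtain Vs where "set Vs \<subseteq> sections A E" "map (\<lambda>V. V x) Vs = vs" by auto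
    moreover obtain V where "V \<in> sections A E" "V x = v" using section_through[of v x] Cons.prems by auto
    ultimately show ?case by (intro exI[of _ "V # Vs"]) simp
  qed simp
  then show ?thesis using that by blast
qed

text \<open>Every tuple of vectors in a fibre consists of values of global sections, and off such
  tuples both forms have the default 0.\<close>

lemma forms_eqI:
  assumes \<eta>: "\<eta> \<in> forms A E (int p)" and \<theta>: "\<theta> \<in> forms A E (int p)"
    and eq: "\<And>Vs. set Vs \<subseteq> sections A E \<Longrightarrow> length Vs = p \<Longrightarrow> eval_form \<eta> Vs = eval_form \<theta> Vs"
  shows "\<eta> = \<theta>"
proof (intro ext)
  fix x vs
  show "\<eta> x vs = \<theta> x vs"
  proof (cases "length vs = p \<and> set vs \<subseteq> fibre E x")
    case True
    then obtain Vs where Vs: "set Vs \<subseteq> sections A E" "map (\<lambda>V. V x) Vs = vs" using sections_through by metis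
    then have "length Vs = p" using True by auto
    then show ?thesis using fun_cong[OF eq[OF Vs(1)], of x] Vs(2) by (simp add: eval_form_def)
  next
    case False
    then show ?thesis using alt_forms_degree[OF forms_alt[OF \<eta>]] alt_forms_degree[OF forms_alt[OF \<theta>]] by metis
  qed
qed

lemma zero_form_forms: "zero_form \<in> forms A E p"
  by (simp add: forms_def zero_form_def alt_forms_def mfd_smooth_on_const split_def)

lemma alt_forms_plus: "\<omega> \<in> alt_forms E x p \<Longrightarrow> \<omega>' \<in> alt_forms E x p \<Longrightarrow> (\<lambda>vs. \<omega> vs + \<omega>' vs) \<in> alt_forms E x p"
  by (simp add: alt_forms_def algebra_simps)

lemma alt_forms_times: "\<omega> \<in> alt_forms E x p \<Longrightarrow> (\<lambda>vs. r * \<omega> vs) \<in> alt_forms E x p"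
  by (simp add: alt_forms_def algebra_simps)

lemma forms_add:
  assumes \<eta>: "\<eta> \<in> forms A E p" and \<theta>: "\<theta> \<in> forms A E p"
  shows "(\<lambda>x vs. \<eta> x vs + \<theta> x vs) \<in> forms A E p"
proof (cases "p < 0")
  case True
  then show ?thesis using assms by (simp add: forms_def zero_form_def)
next
  case False
  have "mfd_smooth_on A U (\<lambda>x. \<eta> x (map (triv_inv E \<psi> x) ws) + \<theta> x (map (triv_inv E \<psi> x) ws))"
    if "(U, \<psi>) \<in> trivs E" "length ws = nat p" for U \<psi> ws
    using that forms_smooth[of \<eta> "nat p"] forms_smooth[of \<theta> "nat p"] assms False
    by (intro mfd_smooth_on_add triv_open[OF that(1)]) auto
  then show ?thesis using assms False by (auto simp: forms_def alt_forms_plus)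
qed

lemma forms_scale:
  assumes \<eta>: "\<eta> \<in> forms A E p"
  shows "(\<lambda>x vs. r * \<eta> x vs) \<in> forms A E p"
proof (cases "p < 0")
  case True
  then show ?thesis using assms by (simp add: forms_def zero_form_def)
next
  case False
  have "mfd_smooth_on A U (\<lambda>x. r * \<eta> x (map (triv_inv E \<psi> x) ws))"
    if "(U, \<psi>) \<in> trivs E" "length ws = nat p" for U \<psi> ws
    using that forms_smooth[of \<eta> "nat p"] assms False
    by (intro mfd_smooth_on_bilinear[OF bounded_bilinear_mult] mfd_smooth_on_const triv_open[OF that(1)]) auto
  then show ?thesis using assms False by (auto simp: forms_def alt_forms_times)
qed

lemma ext_add_ext_forms:
  assumes "\<omega> \<in> ext_forms A E" "\<theta> \<in> ext_forms A E"
  shows "ext_add \<omega> \<theta> \<in> ext_forms A E"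
proof -
  have "{p. ext_add \<omega> \<theta> p \<noteq> zero_form} \<subseteq> {p. \<omega> p \<noteq> zero_form} \<union> {p. \<theta> p \<noteq> zero_form}"
    by (auto simp: ext_add_def zero_form_def)
  moreover have "ext_add \<omega> \<theta> p \<in> forms A E p" for p
    unfolding ext_add_def using assms by (intro forms_add) (simp_all add: ext_forms_def)
  ultimately show ?thesis using assms by (auto simp: ext_forms_def intro: finite_subset)
qed

lemma ext_scale_ext_forms:
  assumes "\<omega> \<in> ext_forms A E"
  shows "ext_scale r \<omega> \<in> ext_forms A E"
proof -
  have "{p. ext_scale r \<omega> p \<noteq> zero_form} \<subseteq> {p. \<omega> p \<noteq> zero_form}"
    by (auto simp: ext_scale_def zero_form_def)
  moreover have "ext_scale r \<omega> p \<in> forms A E p" for p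
    unfolding ext_scale_def using assms by (intro forms_scale) (simp add: ext_forms_def)
  ultimately show ?thesis using assms by (auto simp: ext_forms_def intro: finite_subset)
qed

lemma fun_form_forms: "f \<in> smooth_functions A \<Longrightarrow> fun_form f \<in> forms A E 0"
  unfolding smooth_functions_iff using mfd_smooth_on_subset[of UNIV f]
  by (auto simp: forms_def fun_form_def alt_forms_def)

lemma forms_0:
  assumes "\<eta> \<in> forms A E 0"
  obtains f where "f \<in> smooth_functions A" "\<eta> = fun_form f"
proof -
  have \<eta>: "\<eta> \<in> forms A E (int 0)" using assms by simp
  have "eval_form \<eta> [] \<in> smooth_functions A" using eval_form_smooth[OF \<eta>] by simp
  moreover have "\<eta> = fun_form (eval_form \<eta> [])"
    using alt_forms_degree[OF forms_alt[OF \<eta>]] by (simp add: fun_eq_iff fun_form_def eval_form_def)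
  ultimately show ?thesis using that by blast
qed

end

context lie_algebroid
begin

text \<open>Multiplying by the square of a bump function \<open>\<phi>\<close> distributes one factor to the frame and one
  to the coefficients, which makes both global: \<open>\<phi>\<^sup>2 V = \<Sum>\<^sub>b (\<phi> V\<^sub>b) (\<phi> e\<^sub>b)\<close>.\<close>

lemma cochain_frame:
  assumes G: "cochain G" and s: "set xs \<subseteq> \<Gamma>" "set ys \<subseteq> \<Gamma>"
    and t: "(U, \<psi>) \<in> trivs E" "x \<in> U" and B: "orthonormal_expansion B"
  obtains e where "\<And>V. V \<in> \<Gamma> \<Longrightarrow> G (xs @ V # ys) x = (\<Sum>b\<in>B. (\<psi> (V x) \<bullet> b) * G (xs @ e b # ys) x)"
proof -
  obtain \<phi> N K where \<phi>: "\<phi> \<in> smooth_functions A" "x \<in> N" "\<And>x. x \<in> N \<Longrightarrow> \<phi> x = 1"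
    "closed K" "K \<subseteq> U" "\<And>x. x \<notin> K \<Longrightarrow> \<phi> x = 0"
    using bump_function[OF triv_open[OF t(1)] t(2)] by metis
  \<comment> \<open>The frame is fixed before \<open>V\<close> is given, so the numbers
    \<open>G (xs @ e b # ys) x\<close> are shared by all sections.\<close>
  define e where "e b = (\<lambda>y. if y \<in> U then triv_inv E \<psi> y (\<phi> y *\<^sub>R b) else vzero E y)" for b
  have e: "e b \<in> \<Gamma>" for b unfolding e_def by (rule cutoff_section[OF t(1) \<phi>(4,5,1,6)])
  have "G (xs @ V # ys) x = (\<Sum>b\<in>B. (\<psi> (V x) \<bullet> b) * G (xs @ e b # ys) x)" if V: "V \<in> \<Gamma>" for V
  proof -
    define f where "f b y = (if y \<in> U then \<phi> y * (\<psi> (V y) \<bullet> b) else 0)" for b y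
    have f: "f b \<in> smooth_functions A" for b
      unfolding smooth_functions_iff
    proof (rule mfd_smooth_on_extend[OF open_UNIV triv_open[OF t(1)] \<phi>(4,5)])
      have "mfd_smooth_on A U \<phi>" using \<phi>(1) mfd_smooth_on_subset unfolding smooth_functions_iff by blast
      then have "mfd_smooth_on A U (\<lambda>y. \<phi> y * (\<psi> (V y) \<bullet> b))"
        by (intro mfd_smooth_on_bilinear[OF bounded_bilinear_mult] mfd_smooth_on_bilinear[OF bounded_bilinear_inner]
            triv_open[OF t(1)] sections_smooth[OF V t(1)] mfd_smooth_on_const)
      then have "mfd_smooth_on A U (f b)"
        by (rule mfd_smooth_on_cong[OF _ triv_open[OF t(1)]]) (simp add: f_def)
      then show "mfd_smooth_on A (U \<inter> UNIV) (f b)" by simp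
    qed (simp add: f_def \<phi>(6))
    \<comment> \<open>Partial sums of the expansion, indexed by \<open>C\<close>: addition of
      sections is binary, so the sum over \<open>B\<close> is reached by finite induction.\<close>
    define S where "S C = (\<lambda>y. if y \<in> U
        then triv_inv E \<psi> y ((\<phi> y * \<phi> y) *\<^sub>R (\<Sum>b\<in>C. (\<psi> (V y) \<bullet> b) *\<^sub>R b)) else vzero E y)" for C
    have S_insert: "S (insert b C) = sec_add E (sec_mult E (f b) (e b)) (S C)" if "finite C" "b \<notin> C" for b C
    proof
      fix y
      show "S (insert b C) y = sec_add E (sec_mult E (f b) (e b)) (S C) y"
      proof (cases "y \<in> U")
        case True
        then show ?thesis
          using that
          by (simp add: S_def e_def f_def sec_add_def sec_mult_def scaleR_add_right mult_ac
              flip: triv_inv_add[OF t(1)] triv_inv_scale[OF t(1)])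
      qed (simp add: S_def e_def f_def sec_add_def sec_mult_def vscale_0[OF vzero_fibre] vplus_vzero[OF vzero_fibre])
    qed
    have "S C \<in> \<Gamma> \<and> G (xs @ S C # ys) x = (\<Sum>b\<in>C. (\<psi> (V x) \<bullet> b) * G (xs @ e b # ys) x)" if "finite C" for C
      using that
    proof (induction C rule: finite_induct)
      case empty
      have "S {} = vzero E" by (simp add: S_def fun_eq_iff triv_inv_0[OF t(1)])
      then show ?case by (simp add: vzero_section cochain_vzero[OF G s])
    next
      case (insert b C)
      have fx: "f b x = \<psi> (V x) \<bullet> b" using t(2) \<phi>(2,3) by (simp add: f_def)
      show ?case
        using insert
        by (simp add: S_insert sec_add_closed sec_mult_closed e f fx cochain_add[OF G s] cochain_mult[OF G s])
    qed
    then have "G (xs @ S B # ys) x = (\<Sum>b\<in>B. (\<psi> (V x) \<bullet> b) * G (xs @ e b # ys) x)"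
      using B by (simp add: orthonormal_expansion_def)
    moreover have "S B = sec_mult E (\<lambda>y. \<phi> y * \<phi> y) V"
    proof
      fix y
      have "(\<Sum>b\<in>B. (\<psi> (V y) \<bullet> b) *\<^sub>R b) = \<psi> (V y)" using B unfolding orthonormal_expansion_def by metis
      moreover have \<phi>0: "\<phi> y = 0" if "y \<notin> U" using that \<phi>(5,6) by blast
      ultimately show "S B y = sec_mult E (\<lambda>y. \<phi> y * \<phi> y) V y"
        using \<phi>0
        by (cases "y \<in> U") (simp_all add: S_def sec_mult_def triv_inv_scale[OF t(1)] triv_inv_triv[OF t(1)]
            sections_fibre[OF V] vscale_0[OF sections_fibre[OF V]])
    qed
    ultimately show ?thesis
      using cochain_mult[OF G s V smooth_functions_mult[OF \<phi>(1) \<phi>(1)]] \<phi>(2,3) by simp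
  qed
  then show ?thesis using that by blast
qed

lemma cochain_pointwise_slot:
  assumes G: "cochain G" and s: "set xs \<subseteq> \<Gamma>" "set ys \<subseteq> \<Gamma>" and V: "V \<in> \<Gamma>" and W: "W \<in> \<Gamma>" and eq: "V x = W x"
  shows "G (xs @ V # ys) x = G (xs @ W # ys) x"
proof -
  obtain U \<psi> where t: "(U, \<psi>) \<in> trivs E" "x \<in> U" using triv_at .
  obtain B :: "'f set" where B: "orthonormal_expansion B" using fibre_orthonormal .
  obtain e where "\<And>V. V \<in> \<Gamma> \<Longrightarrow> G (xs @ V # ys) x = (\<Sum>b\<in>B. (\<psi> (V x) \<bullet> b) * G (xs @ e b # ys) x)"
    using cochain_frame[OF G s t B] by blast
  from this[OF V] this[OF W] show ?thesis by (simp add: eq)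
qed

text \<open>Slots are exchanged from left to right; \<open>xs\<close> holds those already
  exchanged.\<close>

lemma cochain_pointwise:
  assumes G: "cochain G"
  shows "map (\<lambda>V. V x) Vs = map (\<lambda>V. V x) Ws \<Longrightarrow> set Vs \<subseteq> \<Gamma> \<Longrightarrow> set Ws \<subseteq> \<Gamma> \<Longrightarrow> set xs \<subseteq> \<Gamma> \<Longrightarrow>
    G (xs @ Vs) x = G (xs @ Ws) x"
proof (induction Vs arbitrary: Ws xs)
  case (Cons V Vs)
  then obtain W Ws' where W: "Ws = W # Ws'" by (cases Ws) auto
  have "G (xs @ V # Vs) x = G (xs @ W # Vs) x"
    by (rule cochain_pointwise_slot[OF G]) (use Cons.prems W in auto)
  also have "\<dots> = G (xs @ W # Ws') x"
    using Cons.IH[of Ws' "xs @ [W]"] Cons.prems W by simp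
  finally show ?case by (simp add: W)
qed simp

text \<open>Cochains are alternating for neighbours, while \<open>alt_forms\<close> asks for
  arbitrary transpositions. Both outer sections are moved past \<open>Y\<close>, at the cost of one
  sign on each side, and the distance shrinks.\<close>

lemma cochain_transpose:
  assumes G: "cochain G" and V: "V \<in> \<Gamma>" and W: "W \<in> \<Gamma>" and zs: "set zs \<subseteq> \<Gamma>"
  shows "set xs \<subseteq> \<Gamma> \<Longrightarrow> set ys \<subseteq> \<Gamma> \<Longrightarrow> G (xs @ W # ys @ V # zs) x = - G (xs @ V # ys @ W # zs) x"
proof (induction ys arbitrary: xs)
  case Nil
  then show ?case using cochain_swap[OF G Nil.prems(1) zs V W] by simp
next
  case (Cons Y ys)
  then have Y: "Y \<in> \<Gamma>" "set (ys @ V # zs) \<subseteq> \<Gamma>" "set (ys @ W # zs) \<subseteq> \<Gamma>" using V W zs by auto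
  have "G (xs @ W # Y # (ys @ V # zs)) x = - G (xs @ Y # W # (ys @ V # zs)) x"
    by (simp only: cochain_swap[OF G Cons.prems(1) Y(2,1) W])
  moreover have "G (xs @ V # Y # (ys @ W # zs)) x = - G (xs @ Y # V # (ys @ W # zs)) x"
    by (simp only: cochain_swap[OF G Cons.prems(1) Y(3,1) V])
  moreover have "G ((xs @ [Y]) @ W # ys @ V # zs) x = - G ((xs @ [Y]) @ V # ys @ W # zs) x"
    by (rule Cons.IH) (use Cons.prems in auto)
  ultimately show ?case by simp
qed

section \<open>The form induced by a cochain\<close>

definition induced_form :: "nat \<Rightarrow> (('m \<Rightarrow> 'e) list \<Rightarrow> 'm \<Rightarrow> real) \<Rightarrow> ('m, 'e) form" where
  "induced_form p G = (\<lambda>x vs. if length vs = p \<and> set vs \<subseteq> fibre E x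
     then G (SOME Vs. set Vs \<subseteq> \<Gamma> \<and> map (\<lambda>V. V x) Vs = vs) x else 0)"

lemma induced_form_apply:
  assumes G: "cochain G" and Vs: "set Vs \<subseteq> \<Gamma>" "length Vs = p"
  shows "induced_form p G x (map (\<lambda>V. V x) Vs) = G Vs x"
proof -
  let ?P = "\<lambda>Ws. set Ws \<subseteq> \<Gamma> \<and> map (\<lambda>V. V x) Ws = map (\<lambda>V. V x) Vs"
  define Ws where "Ws = (SOME Ws. ?P Ws)"
  have "?P Ws" unfolding Ws_def by (rule someI[of ?P Vs]) (simp add: Vs)
  then have Ws: "map (\<lambda>V. V x) Ws = map (\<lambda>V. V x) Vs" "set Ws \<subseteq> \<Gamma>" by blast+
  have "set (map (\<lambda>V. V x) Vs) \<subseteq> fibre E x" using Vs sections_fibre by auto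
  then have "induced_form p G x (map (\<lambda>V. V x) Vs) = G Ws x" using Vs(2) by (simp add: induced_form_def Ws_def)
  also have "\<dots> = G Vs x" using cochain_pointwise[OF G Ws Vs(1), of "[]"] by simp
  finally show ?thesis .
qed

text \<open>The sections chosen in \<open>induced_form\<close> depend on \<open>x\<close> and
  \<open>vs\<close> but not on the map, so all three terms are evaluated on the same list.\<close>

lemma induced_form_lincomb:
  assumes "\<And>Vs. set Vs \<subseteq> \<Gamma> \<Longrightarrow> F Vs x = r * G Vs x + q * H Vs x"
  shows "induced_form p F x vs = r * induced_form p G x vs + q * induced_form p H x vs"
proof (cases "length vs = p \<and> set vs \<subseteq> fibre E x")
  case True
  let ?P = "\<lambda>Vs. set Vs \<subseteq> \<Gamma> \<and> map (\<lambda>V. V x) Vs = vs"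
  define Ws where "Ws = (SOME Vs. ?P Vs)"
  have "\<exists>Vs. ?P Vs" using sections_through[of vs x] True by metis
  then have "?P Ws" unfolding Ws_def by (rule someI_ex[where P = ?P])
  then have "F Ws x = r * G Ws x + q * H Ws x" using assms by blast
  then show ?thesis using True by (simp add: induced_form_def Ws_def)
next
  case False
  then have "induced_form p F' x vs = 0" for F' unfolding induced_form_def by (simp only: if_False)
  then show ?thesis by simp
qed

lemma eval_induced_form: "cochain G \<Longrightarrow> set Vs \<subseteq> \<Gamma> \<Longrightarrow> length Vs = p \<Longrightarrow> eval_form (induced_form p G) Vs = G Vs"
  by (simp add: eval_form_def induced_form_apply fun_eq_iff)

lemma induced_form_alt:
  assumes G: "cochain G"
  shows "induced_form p G x \<in> alt_forms E x p"
proof -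
  let ?\<omega> = "induced_form p G x"
  \<comment> \<open>Lifts the update of one vector to the replacement of one section, so that the
    laws of cochains apply to lists in split form.\<close>
  have upd: "?\<omega> (vs[i := V x]) = G (take i Vs @ V # drop (Suc i) Vs) x"
    if "set Vs \<subseteq> \<Gamma>" "map (\<lambda>V. V x) Vs = vs" "length vs = p" "i < p" "V \<in> \<Gamma>" for V Vs vs i
  proof -
    have l: "length Vs = p" using that by auto
    then have "vs[i := V x] = map (\<lambda>V. V x) (take i Vs @ V # drop (Suc i) Vs)"
      using that by (simp add: map_update flip: upd_conv_take_nth_drop)
    moreover have "set (take i Vs @ V # drop (Suc i) Vs) \<subseteq> \<Gamma>"
      using that set_take_subset[of i Vs] set_drop_subset[of "Suc i" Vs] by auto
    ultimately show ?thesis using that l by (simp only:) (rule induced_form_apply[OF G]; simp)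
  qed
  have sub: "set (take i Vs) \<subseteq> \<Gamma>" "set (drop i Vs) \<subseteq> \<Gamma>" if "set Vs \<subseteq> \<Gamma>" for i and Vs :: "('m \<Rightarrow> 'e) list"
    using that set_take_subset[of i Vs] set_drop_subset[of i Vs] by auto
  show ?thesis
    unfolding alt_forms_def mem_Collect_eq
  proof (intro conjI allI impI; (elim conjE)?)
    fix vs assume "\<not> (length vs = p \<and> set vs \<subseteq> fibre E x)"
    then show "?\<omega> vs = 0" by (auto simp: induced_form_def)
  next
    fix vs i a b
    assume vs: "length vs = p" "set vs \<subseteq> fibre E x" "i < p" and a: "a \<in> fibre E x" and b: "b \<in> fibre E x"
    obtain Vs where Vs: "set Vs \<subseteq> \<Gamma>" "map (\<lambda>V. V x) Vs = vs" using sections_through[OF vs(2)] .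
    obtain V W where V: "V \<in> \<Gamma>" "V x = a" and W: "W \<in> \<Gamma>" "W x = b"
      using section_through[OF a] section_through[OF b] by metis
    have "?\<omega> (vs[i := sec_add E V W x]) = ?\<omega> (vs[i := V x]) + ?\<omega> (vs[i := W x])"
      by (simp only: upd[OF Vs vs(1,3)] V(1) W(1) sec_add_closed cochain_add[OF G sub(1)[OF Vs(1)] sub(2)[OF Vs(1)]])
    then show "?\<omega> (vs[i := vplus E a b]) = ?\<omega> (vs[i := a]) + ?\<omega> (vs[i := b])"
      by (simp add: sec_add_def V W)
  next
    fix vs i r a
    assume vs: "length vs = p" "set vs \<subseteq> fibre E x" "i < p" and a: "a \<in> fibre E x"
    obtain Vs where Vs: "set Vs \<subseteq> \<Gamma>" "map (\<lambda>V. V x) Vs = vs" using sections_through[OF vs(2)] .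
    obtain V where V: "V \<in> \<Gamma>" "V x = a" using section_through[OF a] by metis
    note r = smooth_functions_const[of r]
    have "?\<omega> (vs[i := sec_mult E (\<lambda>_. r) V x]) = r * ?\<omega> (vs[i := V x])"
      by (simp only: upd[OF Vs vs(1,3)] V(1) sec_mult_closed[OF r V(1)]
          cochain_mult[OF G sub(1)[OF Vs(1)] sub(2)[OF Vs(1)] V(1) r])
    then show "?\<omega> (vs[i := vscale E r a]) = r * ?\<omega> (vs[i := a])"
      by (simp add: sec_mult_def V)
  next
    fix vs i j
    assume vs: "length vs = p" "set vs \<subseteq> fibre E x" and ij: "i < j" "j < p"
    obtain Vs where Vs: "set Vs \<subseteq> \<Gamma>" "map (\<lambda>V. V x) Vs = vs" using sections_through[OF vs(2)] .
    have l: "length Vs = p" using vs(1) Vs(2) by auto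
    define xs V Zs where d: "xs = take i Vs" "V = Vs ! i" "Zs = drop (Suc i) Vs"
    \<comment> \<open>The second position is counted inside \<open>Zs\<close>, which starts just
      after index \<open>i\<close>; hence \<open>j - Suc i\<close>.\<close>
    define ys W zs where e: "ys = take (j - Suc i) Zs" "W = Zs ! (j - Suc i)" "zs = drop (Suc (j - Suc i)) Zs"
    have "Vs = xs @ V # Zs" unfolding d using ij l by (intro id_take_nth_drop) simp
    moreover have "Zs = ys @ W # zs" unfolding e using ij l by (intro id_take_nth_drop) (simp add: d)
    ultimately have Vs_eq: "Vs = xs @ V # ys @ W # zs" by simp
    have len: "i = length xs" "j = length xs + Suc (length ys)" using ij l by (auto simp: d e)
    have "vs = map (\<lambda>V. V x) (xs @ V # ys @ W # zs)" using Vs(2) Vs_eq by simp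
    moreover have "vs[i := vs ! j, j := vs ! i] = map (\<lambda>V. V x) (xs @ W # ys @ V # zs)"
      using Vs(2)[symmetric] unfolding Vs_eq len by (simp add: list_update_append nth_append)
    moreover have "set (xs @ V # ys @ W # zs) \<subseteq> \<Gamma>" "length (xs @ V # ys @ W # zs) = p"
      using Vs(1) l Vs_eq by auto
    moreover then have "set (xs @ W # ys @ V # zs) \<subseteq> \<Gamma>" "length (xs @ W # ys @ V # zs) = p" by auto
    ultimately show "?\<omega> (vs[i := vs ! j, j := vs ! i]) = - ?\<omega> vs"
      using cochain_transpose[OF G, of V W zs xs ys x] by (simp only: induced_form_apply[OF G]) simp
  qed
qed

text \<open>Near a point, vectors with constant coordinates agree with the cut-off global sections,
  so there the coefficient is a value of \<open>G\<close> on a fixed list of sections, which is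
  smooth.\<close>

lemma induced_form_forms:
  assumes G: "cochain G"
  shows "induced_form p G \<in> forms A E (int p)"
proof -
  have "mfd_smooth_on A U (\<lambda>x. induced_form p G x (map (triv_inv E \<psi> x) ws))"
    if t: "(U, \<psi>) \<in> trivs E" and ws: "length ws = p" for U \<psi> ws
  proof (rule mfd_smooth_on_local)
    fix x assume x: "x \<in> U"
    obtain \<phi> N K where \<phi>: "\<phi> \<in> smooth_functions A" "open N" "x \<in> N" "N \<subseteq> U" "\<And>x. x \<in> N \<Longrightarrow> \<phi> x = 1"
      "closed K" "K \<subseteq> U" "\<And>x. x \<notin> K \<Longrightarrow> \<phi> x = 0"
      using bump_function[OF triv_open[OF t] x] by metis
    define e where "e w = (\<lambda>y. if y \<in> U then triv_inv E \<psi> y (\<phi> y *\<^sub>R w) else vzero E y)" for w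
    have e: "e w \<in> \<Gamma>" for w unfolding e_def by (rule cutoff_section[OF t \<phi>(6,7,1,8)])
    have "G (map e ws) \<in> smooth_functions A"
      by (rule smooth_mapD[OF cochain_smooth[OF G]]) (use e in auto)
    then have "mfd_smooth_on A N (G (map e ws))"
      unfolding smooth_functions_iff using mfd_smooth_on_subset by blast
    then have "mfd_smooth_on A N (\<lambda>y. induced_form p G y (map (triv_inv E \<psi> y) ws))"
    proof (rule mfd_smooth_on_cong[OF _ \<phi>(2)])
      fix y assume y: "y \<in> N"
      then have "y \<in> U" using \<phi>(4) by blast
      then have "map (triv_inv E \<psi> y) ws = map (\<lambda>V. V y) (map e ws)" using y by (simp add: e_def \<phi>(5))
      moreover have "induced_form p G y (map (\<lambda>V. V y) (map e ws)) = G (map e ws) y"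
        by (rule induced_form_apply[OF G]) (use e ws in auto)
      ultimately show "G (map e ws) y = induced_form p G y (map (triv_inv E \<psi> y) ws)" by (simp only:)
    qed
    then show "\<exists>N. open N \<and> x \<in> N \<and> mfd_smooth_on A N (\<lambda>x. induced_form p G x (map (triv_inv E \<psi> x) ws))"
      using \<phi>(2,3) by blast
  qed
  then show ?thesis using induced_form_alt[OF G] by (auto simp: forms_def)
qed

section \<open>The exterior derivative\<close>

lemma cochain_eval_form:
  assumes \<eta>: "\<eta> \<in> forms A E (int p)"
  shows "cochain (eval_form \<eta>)"
proof (rule cochainI)
  show "smooth_map (eval_form \<eta>)" using eval_form_smooth[OF \<eta>] by (simp add: smooth_map_def)
  have fib: "set (map (\<lambda>V. V x) xs) \<subseteq> fibre E x" if "set xs \<subseteq> \<Gamma>" for xs x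
    using that sections_fibre by auto
  fix xs ys V W f assume s: "set xs \<subseteq> \<Gamma>" "set ys \<subseteq> \<Gamma>" and V: "V \<in> \<Gamma>"
  show "eval_form \<eta> (xs @ sec_mult E f V # ys) = (\<lambda>x. f x * eval_form \<eta> (xs @ V # ys) x)"
    using alt_forms_scale[OF forms_alt[OF \<eta>] fib[OF s(1)] fib[OF s(2)] sections_fibre[OF V]]
    by (simp add: eval_form_def sec_mult_def fun_eq_iff)
  show "eval_form \<eta> (xs @ W # V # ys) = (\<lambda>x. - eval_form \<eta> (xs @ V # W # ys) x)"
    using alt_forms_swap[OF forms_alt[OF \<eta>], of _ "map (\<lambda>V. V _) xs" "W _" "V _"]
    by (simp add: eval_form_def fun_eq_iff)
  assume W: "W \<in> \<Gamma>"
  show "eval_form \<eta> (xs @ sec_add E V W # ys) = (\<lambda>x. eval_form \<eta> (xs @ V # ys) x + eval_form \<eta> (xs @ W # ys) x)"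
    using alt_forms_add[OF forms_alt[OF \<eta>] fib[OF s(1)] fib[OF s(2)] sections_fibre[OF V] sections_fibre[OF W]]
    by (simp add: eval_form_def sec_add_def fun_eq_iff)
qed

definition form_diff :: "nat \<Rightarrow> ('m, 'e) form \<Rightarrow> ('m, 'e) form" where
  "form_diff p \<eta> = induced_form (Suc p) (ce_diff (eval_form \<eta>))"

lemma form_diff_forms: "\<eta> \<in> forms A E (int p) \<Longrightarrow> form_diff p \<eta> \<in> forms A E (int p + 1)"
  using induced_form_forms[OF cochain_ce_diff[OF cochain_eval_form], of \<eta> p "Suc p"]
  by (simp add: form_diff_def add.commute)

lemma eval_form_diff:
  "\<eta> \<in> forms A E (int p) \<Longrightarrow> set Vs \<subseteq> \<Gamma> \<Longrightarrow> length Vs = Suc p \<Longrightarrow>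
    eval_form (form_diff p \<eta>) Vs = ce_diff (eval_form \<eta>) Vs"
  unfolding form_diff_def by (rule eval_induced_form[OF cochain_ce_diff[OF cochain_eval_form]])

text \<open>One direction is existence and the other uniqueness of the form with prescribed values
  on sections; the theorem characterises \<open>d\<close> in the same shape.\<close>

lemma form_diff_eq_iff:
  assumes \<eta>: "\<eta> \<in> forms A E (int p)"
  shows "form_diff p \<eta> = \<theta> \<longleftrightarrow> \<theta> \<in> forms A E (int p + 1) \<and>
    (\<forall>Vs. set Vs \<subseteq> \<Gamma> \<longrightarrow> length Vs = Suc p \<longrightarrow> eval_form \<theta> Vs = ce_diff (eval_form \<eta>) Vs)"
  using forms_eqI[of "form_diff p \<eta>" "Suc p" \<theta>] form_diff_forms[OF \<eta>] eval_form_diff[OF \<eta>]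
  by (auto simp: add.commute)

lemma form_diff_function:
  assumes f: "f \<in> smooth_functions A"
  shows "form_diff 0 (fun_form f) = \<theta> \<longleftrightarrow> \<theta> \<in> forms A E 1 \<and>
       (\<forall>V\<in>\<Gamma>.
          eval_form \<theta> [V] = L V f \<and>
          L V f = eval_form (differential A f) [\<rho> \<circ> V] \<and>
          eval_form (differential A f) [\<rho> \<circ> V] =
            eval_form (transpose_comp E \<rho> (differential A f)) [V])"
proof -
  have "eval_form (fun_form f :: ('m, 'e) form) [] = f" by (simp add: eval_form_def fun_form_def)
  then show ?thesis
    using form_diff_eq_iff[of "fun_form f" 0 \<theta>] fun_form_forms[OF f]
    by (auto simp: eval_differential eval_transpose length_Suc_conv)
qed

lemma form_diff_formula:
  assumes \<eta>: "\<eta> \<in> forms A E (int p)"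
  shows "form_diff p \<eta> = \<theta> \<longleftrightarrow> \<theta> \<in> forms A E (int p + 1) \<and>
       (\<forall>V. (\<forall>i\<le>p. V i \<in> \<Gamma>) \<longrightarrow>
          (\<forall>x. eval_form \<theta> (map V [0..<Suc p]) x =
             (\<Sum>i\<le>p. (-1) ^ i * L (V i) (eval_form \<eta> (omit {i} p V)) x) +
             (\<Sum>j\<le>p. \<Sum>i<j. (-1) ^ (i + j) *
                eval_form \<eta> (bracket (V i) (V j) # omit {i, j} p V) x)))"
    (is "_ \<longleftrightarrow> _ \<and> (\<forall>V. ?S V \<longrightarrow> (\<forall>x. _ = ?R V x))")
proof -
  have R: "?R V x = ce_diff (eval_form \<eta>) (map V [0..<Suc p]) x" if "?S V" for V x
    using ce_diff_formula[OF cochain_eval_form[OF \<eta>], where n = "Suc p" and V = V and x = x] that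
    by (simp add: select_empty omit_def select_def lessThan_Suc_atMost del: upt_Suc sum.lessThan_Suc)
  have PQ: "(\<forall>Vs. set Vs \<subseteq> \<Gamma> \<longrightarrow> length Vs = Suc p \<longrightarrow> eval_form \<theta> Vs = ce_diff (eval_form \<eta>) Vs)
    \<longleftrightarrow> (\<forall>V. ?S V \<longrightarrow> (\<forall>x. eval_form \<theta> (map V [0..<Suc p]) x = ?R V x))" (is "?P \<longleftrightarrow> ?Q")
  proof
    assume P: ?P
    show ?Q
    proof (intro allI impI)
      fix V x assume V: "?S V"
      then have "set (map V [0..<Suc p]) \<subseteq> \<Gamma>" by auto
      then show "eval_form \<theta> (map V [0..<Suc p]) x = ?R V x" unfolding R[OF V] using P by simp
    qed
  next
    assume Q: ?Q
    show ?P
    proof (intro allI impI)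
      fix Vs assume Vs: "set Vs \<subseteq> \<Gamma>" "length Vs = Suc p"
      \<comment> \<open>The theorem speaks of families indexed by numbers. A list is read as the
        family of its entries, of which only the indices up to \<open>p\<close> enter.\<close>
      have V: "?S (\<lambda>i. Vs ! i)" using Vs by auto
      have eq: "map (\<lambda>i. Vs ! i) [0..<Suc p] = Vs" using map_nth[of Vs] Vs(2) by simp
      have "eval_form \<theta> (map (\<lambda>i. Vs ! i) [0..<Suc p]) x = ?R (\<lambda>i. Vs ! i) x" for x
        using Q V by blast
      then have "eval_form \<theta> Vs x = ce_diff (eval_form \<eta>) Vs x" for x
        unfolding R[OF V] eq .
      then show "eval_form \<theta> Vs = ce_diff (eval_form \<eta>) Vs" by (rule ext)
    qed
  qed
  show ?thesis unfolding form_diff_eq_iff[OF \<eta>] PQ ..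
qed

lemma form_diff_add:
  assumes "\<eta> \<in> forms A E (int p)" "\<theta> \<in> forms A E (int p)"
  shows "form_diff p (\<lambda>x vs. \<eta> x vs + \<theta> x vs) = (\<lambda>x vs. form_diff p \<eta> x vs + form_diff p \<theta> x vs)"
proof (intro ext)
  fix x vs
  have "ce_diff (eval_form (\<lambda>x vs. \<eta> x vs + \<theta> x vs)) Vs x = ce_diff (eval_form \<eta>) Vs x + ce_diff (eval_form \<theta>) Vs x"
    if "set Vs \<subseteq> \<Gamma>" for Vs
    by (rule ce_diff_add[OF cochain_smooth[OF cochain_eval_form[OF assms(1)]]
          cochain_smooth[OF cochain_eval_form[OF assms(2)]] that]) (simp add: eval_form_def)
  then show "form_diff p (\<lambda>x vs. \<eta> x vs + \<theta> x vs) x vs = form_diff p \<eta> x vs + form_diff p \<theta> x vs"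
    using induced_form_lincomb[where r = 1 and q = 1] by (simp add: form_diff_def)
qed

lemma form_diff_scale:
  assumes "\<eta> \<in> forms A E (int p)"
  shows "form_diff p (\<lambda>x vs. r * \<eta> x vs) = (\<lambda>x vs. r * form_diff p \<eta> x vs)"
proof (intro ext)
  fix x vs
  have "ce_diff (eval_form (\<lambda>x vs. r * \<eta> x vs)) Vs x = r * ce_diff (eval_form \<eta>) Vs x"
    if "set Vs \<subseteq> \<Gamma>" for Vs
    by (rule ce_diff_scale[OF cochain_smooth[OF cochain_eval_form[OF assms]] that]) (simp add: eval_form_def)
  then show "form_diff p (\<lambda>x vs. r * \<eta> x vs) x vs = r * form_diff p \<eta> x vs"
    using induced_form_lincomb[where r = r and q = 0] by (simp add: form_diff_def)
qed

lemma form_diff_zero: "form_diff p zero_form = zero_form"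
  using form_diff_scale[OF zero_form_forms, of p 0] by (simp add: zero_form_def)

section \<open>The operator on inhomogeneous forms and its uniqueness\<close>

text \<open>The component in degree \<open>q\<close> comes from degree \<open>q - 1\<close>. For
  \<open>q \<le> 0\<close> that degree is negative and carries only the zero form; in the other
  branch \<open>nat (q - 1)\<close> is exact.\<close>

definition ext_diff :: "(int \<Rightarrow> ('m, 'e) form) \<Rightarrow> int \<Rightarrow> ('m, 'e) form" where
  "ext_diff = (\<lambda>\<omega>\<in>ext_forms A E. \<lambda>q. if q \<le> 0 then zero_form else form_diff (nat (q - 1)) (\<omega> (q - 1)))"

lemma homogeneous_ext_forms: "\<eta> \<in> forms A E p \<Longrightarrow> homogeneous p \<eta> \<in> ext_forms A E"
  by (auto simp: ext_forms_def homogeneous_def zero_form_forms intro: finite_subset[of _ "{p}"])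

lemma ext_forms_component: "\<omega> \<in> ext_forms A E \<Longrightarrow> \<omega> p \<in> forms A E p"
  by (simp add: ext_forms_def)

lemma ext_diff_homogeneous:
  "\<eta> \<in> forms A E (int p) \<Longrightarrow> ext_diff (homogeneous (int p) \<eta>) (int p + 1) = form_diff p \<eta>"
  by (simp add: ext_diff_def homogeneous_ext_forms) (simp add: homogeneous_def)

lemma graded_endo_ext_diff: "graded_endo A E 1 ext_diff"
  unfolding graded_endo_def
proof (intro conjI ballI allI)
  show "ext_diff \<in> ext_forms A E \<rightarrow>\<^sub>E ext_forms A E"
  proof (rule PiE_I)
    fix \<omega> assume \<omega>: "\<omega> \<in> ext_forms A E"
    have "ext_diff \<omega> q \<in> forms A E q" for q
    proof (cases "q \<le> 0")
      case False
      then have "form_diff (nat (q - 1)) (\<omega> (q - 1)) \<in> forms A E (int (nat (q - 1)) + 1)"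
        using ext_forms_component[OF \<omega>, of "q - 1"] by (intro form_diff_forms) simp
      then show ?thesis using False \<omega> by (simp add: ext_diff_def)
    qed (simp add: ext_diff_def \<omega> zero_form_forms)
    moreover have "{q. ext_diff \<omega> q \<noteq> zero_form} \<subseteq> (\<lambda>p. p + 1) ` {p. \<omega> p \<noteq> zero_form}"
    proof
      fix q assume "q \<in> {q. ext_diff \<omega> q \<noteq> zero_form}"
      then have "\<omega> (q - 1) \<noteq> zero_form" using \<omega> by (auto simp: ext_diff_def form_diff_zero split: if_splits)
      then show "q \<in> (\<lambda>p. p + 1) ` {p. \<omega> p \<noteq> zero_form}" by (intro image_eqI[of _ _ "q - 1"]) auto
    qed
    ultimately show "ext_diff \<omega> \<in> ext_forms A E"
      using \<omega> by (auto simp: ext_forms_def intro: finite_subset)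
  qed (simp add: ext_diff_def)
next
  fix \<omega> \<theta> assume \<omega>: "\<omega> \<in> ext_forms A E" and \<theta>: "\<theta> \<in> ext_forms A E"
  have closed: "ext_add \<omega> \<theta> \<in> ext_forms A E" by (rule ext_add_ext_forms[OF \<omega> \<theta>])
  show "ext_diff (ext_add \<omega> \<theta>) = ext_add (ext_diff \<omega>) (ext_diff \<theta>)"
  proof
    fix q
    show "ext_diff (ext_add \<omega> \<theta>) q = ext_add (ext_diff \<omega>) (ext_diff \<theta>) q"
      using form_diff_add[of "\<omega> (q - 1)" "nat (q - 1)" "\<theta> (q - 1)"]
        ext_forms_component[OF \<omega>, of "q - 1"] ext_forms_component[OF \<theta>, of "q - 1"]
      by (simp add: ext_diff_def closed \<omega> \<theta>) (simp add: ext_add_def zero_form_def)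
  qed
next
  fix r \<omega> assume \<omega>: "\<omega> \<in> ext_forms A E"
  have closed: "ext_scale r \<omega> \<in> ext_forms A E" by (rule ext_scale_ext_forms[OF \<omega>])
  show "ext_diff (ext_scale r \<omega>) = ext_scale r (ext_diff \<omega>)"
  proof
    fix q
    show "ext_diff (ext_scale r \<omega>) q = ext_scale r (ext_diff \<omega>) q"
      using form_diff_scale[of "\<omega> (q - 1)" "nat (q - 1)" r] ext_forms_component[OF \<omega>, of "q - 1"]
      by (simp add: ext_diff_def closed \<omega>) (simp add: ext_scale_def zero_form_def)
  qed
next
  fix p \<eta> assume \<eta>: "\<eta> \<in> forms A E p"
  show "\<exists>\<theta>\<in>forms A E (p + 1). ext_diff (homogeneous p \<eta>) = homogeneous (p + 1) \<theta>"
  proof (cases "p < 0")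
    case True
    then have "ext_diff (homogeneous p \<eta>) = homogeneous (p + 1) zero_form"
      using \<eta> homogeneous_ext_forms[OF \<eta>]
      by (auto simp: ext_diff_def homogeneous_def fun_eq_iff form_diff_zero forms_def)
    then show ?thesis using zero_form_forms by blast
  next
    case False
    then have "ext_diff (homogeneous p \<eta>) = homogeneous (p + 1) (form_diff (nat p) \<eta>)"
      using homogeneous_ext_forms[OF \<eta>]
      by (auto simp: ext_diff_def homogeneous_def fun_eq_iff form_diff_zero)
    then show ?thesis using form_diff_forms[of \<eta> "nat p"] \<eta> False by auto
  qed
qed

text \<open>By the grading, the image of a homogeneous element is concentrated in degree
  \<open>p + k\<close>, so one component decides. Additivity and finiteness of the support extend
  the agreement to all elements.\<close>

lemma graded_endo_eqI:
  assumes d: "graded_endo A E k d" and d': "graded_endo A E k d'"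
    and eq: "\<And>p \<eta>. \<eta> \<in> forms A E (int p) \<Longrightarrow> d (homogeneous (int p) \<eta>) (int p + k) = d' (homogeneous (int p) \<eta>) (int p + k)"
  shows "d = d'"
proof (rule PiE_ext)
  show "d \<in> ext_forms A E \<rightarrow>\<^sub>E ext_forms A E" "d' \<in> ext_forms A E \<rightarrow>\<^sub>E ext_forms A E"
    using d d' unfolding graded_endo_def by blast+
  fix \<omega> assume \<omega>: "\<omega> \<in> ext_forms A E"
  let ?z = "\<lambda>p. zero_form :: ('m, 'e) form"
  have z: "?z \<in> ext_forms A E" by (simp add: ext_forms_def zero_form_forms)
  \<comment> \<open>Compatibility with the scalar 0 forces the image of zero to be zero.\<close>
  have "ext_scale 0 \<theta> = ?z" for \<theta> by (simp add: ext_scale_def zero_form_def)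
  then have zero: "d ?z = ?z" if "graded_endo A E k d" for d
    using that z unfolding graded_endo_def by metis
  have hom: "d (homogeneous p \<eta>) = d' (homogeneous p \<eta>)" if \<eta>: "\<eta> \<in> forms A E p" for p \<eta>
  proof (cases "p < 0")
    case True
    then have "homogeneous p \<eta> = ?z" using \<eta> by (auto simp: homogeneous_def forms_def)
    then show ?thesis using zero[OF d] zero[OF d'] by simp
  next
    case False
    obtain \<theta> \<theta>' where "d (homogeneous p \<eta>) = homogeneous (p + k) \<theta>" "d' (homogeneous p \<eta>) = homogeneous (p + k) \<theta>'"
      using d d' \<eta> unfolding graded_endo_def by metis
    moreover have "d (homogeneous p \<eta>) (p + k) = d' (homogeneous p \<eta>) (p + k)"
      using eq[of \<eta> "nat p"] \<eta> False by simp
    moreover from calculation have "\<theta> = \<theta>'" by (simp add: homogeneous_def)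
    ultimately show ?thesis by simp
  qed
  \<comment> \<open>Truncation of \<open>\<omega>\<close> to the degrees in \<open>P\<close>; adding
    one degree at a time ends at the support, where it equals \<open>\<omega>\<close>.\<close>
  let ?r = "\<lambda>P q. if q \<in> P then \<omega> q else zero_form"
  have R: "?r P \<in> ext_forms A E \<and> d (?r P) = d' (?r P)" if "finite P" for P
    using that
  proof (induction P rule: finite_induct)
    case empty
    then show ?case using zero[OF d] zero[OF d'] z by simp
  next
    case (insert p P)
    let ?h = "homogeneous p (\<omega> p)"
    have h: "?h \<in> ext_forms A E" using \<omega> by (intro homogeneous_ext_forms ext_forms_component)
    have "?r (insert p P) = ext_add ?h (?r P)"
      using insert.hyps by (auto simp: fun_eq_iff ext_add_def homogeneous_def zero_form_def)
    moreover have "?r (insert p P) \<in> ext_forms A E"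
      using \<omega> insert.hyps by (auto simp: ext_forms_def zero_form_forms intro: finite_subset[of _ "insert p P"])
    moreover have "d (ext_add ?h (?r P)) = ext_add (d ?h) (d (?r P))" "d' (ext_add ?h (?r P)) = ext_add (d' ?h) (d' (?r P))"
      using d d' h insert.IH unfolding graded_endo_def by blast+
    ultimately show ?case using hom[OF ext_forms_component[OF \<omega>]] insert.IH by simp
  qed
  have fin: "finite {p. \<omega> p \<noteq> zero_form}" using \<omega> by (simp add: ext_forms_def)
  have eq: "?r {p. \<omega> p \<noteq> zero_form} = \<omega>" by auto
  show "d \<omega> = d' \<omega>" using R[OF fin, THEN conjunct2] unfolding eq .
qed

end

theorem proposition4p2p1:
  fixes A :: "('m::{t2_space,second_countable_topology}, 'b::real_inner) chart set"
    and E :: "('m, 'e, 'f::real_inner) vbundle"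
    and \<rho> :: "'e \<Rightarrow> ('m, 'b) tangent"
    and bracket :: "('m \<Rightarrow> 'e) \<Rightarrow> ('m \<Rightarrow> 'e) \<Rightarrow> 'm \<Rightarrow> 'e"
  assumes "lie_algebroid A E \<rho> bracket"
  shows "\<exists>!d. graded_endo A E 1 d \<and>
    (\<forall>f\<in>smooth_functions A. \<forall>\<theta>.
       d (homogeneous 0 (fun_form f)) 1 = \<theta> \<longleftrightarrow>
       \<theta> \<in> forms A E 1 \<and>
       (\<forall>V\<in>sections A E.
          eval_form \<theta> [V] = anchor_deriv A \<rho> V f \<and>
          anchor_deriv A \<rho> V f = eval_form (differential A f) [\<rho> \<circ> V] \<and>
          eval_form (differential A f) [\<rho> \<circ> V] =
            eval_form (transpose_comp E \<rho> (differential A f)) [V])) \<and>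
    (\<forall>p\<ge>1. \<forall>\<eta>\<in>forms A E (int p). \<forall>\<theta>.
       d (homogeneous (int p) \<eta>) (int p + 1) = \<theta> \<longleftrightarrow>
       \<theta> \<in> forms A E (int p + 1) \<and>
       (\<forall>V. (\<forall>i\<le>p. V i \<in> sections A E) \<longrightarrow>
          (\<forall>x. eval_form \<theta> (map V [0..<Suc p]) x =
             (\<Sum>i\<le>p. (-1) ^ i * anchor_deriv A \<rho> (V i) (eval_form \<eta> (omit {i} p V)) x) +
             (\<Sum>j\<le>p. \<Sum>i<j. (-1) ^ (i + j) *
                eval_form \<eta> (bracket (V i) (V j) # omit {i, j} p V) x))))"
  (is "\<exists>!d. _ \<and> ?P1 d \<and> ?P2 d")
proof -
  interpret lie_algebroid A E \<rho> bracket by fact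
  show ?thesis
  proof (rule ex1I[of _ ext_diff], intro conjI graded_endo_ext_diff ballI allI impI)
    fix f \<theta> assume f: "f \<in> smooth_functions A"
    have "ext_diff (homogeneous 0 (fun_form f)) 1 = form_diff 0 (fun_form f)"
      using ext_diff_homogeneous[of "fun_form f" 0] fun_form_forms[OF f] by simp
    then show "ext_diff (homogeneous 0 (fun_form f)) 1 = \<theta> \<longleftrightarrow>
       \<theta> \<in> forms A E 1 \<and>
       (\<forall>V\<in>sections A E.
          eval_form \<theta> [V] = anchor_deriv A \<rho> V f \<and>
          anchor_deriv A \<rho> V f = eval_form (differential A f) [\<rho> \<circ> V] \<and>
          eval_form (differential A f) [\<rho> \<circ> V] =
            eval_form (transpose_comp E \<rho> (differential A f)) [V])"
      by (simp only: form_diff_function[OF f])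
  next
    fix p :: nat and \<eta> \<theta> assume \<eta>: "\<eta> \<in> forms A E (int p)"
    show "ext_diff (homogeneous (int p) \<eta>) (int p + 1) = \<theta> \<longleftrightarrow>
       \<theta> \<in> forms A E (int p + 1) \<and>
       (\<forall>V. (\<forall>i\<le>p. V i \<in> sections A E) \<longrightarrow>
          (\<forall>x. eval_form \<theta> (map V [0..<Suc p]) x =
             (\<Sum>i\<le>p. (-1) ^ i * anchor_deriv A \<rho> (V i) (eval_form \<eta> (omit {i} p V)) x) +
             (\<Sum>j\<le>p. \<Sum>i<j. (-1) ^ (i + j) *
                eval_form \<eta> (bracket (V i) (V j) # omit {i, j} p V) x)))"
      unfolding ext_diff_homogeneous[OF \<eta>] by (rule form_diff_formula[OF \<eta>])
  next
    fix d assume d: "graded_endo A E 1 d \<and> ?P1 d \<and> ?P2 d"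
    note d1 = d[THEN conjunct2, THEN conjunct1] and d2 = d[THEN conjunct2, THEN conjunct2]
    show "d = ext_diff"
    proof (rule graded_endo_eqI[OF d[THEN conjunct1] graded_endo_ext_diff])
      fix p :: nat and \<eta> assume \<eta>: "\<eta> \<in> forms A E (int p)"
      have "d (homogeneous (int p) \<eta>) (int p + 1) = form_diff p \<eta>"
      proof (cases "p = 0")
        case True
        then obtain f where f: "f \<in> smooth_functions A" "\<eta> = fun_form f" using \<eta> forms_0[of \<eta>] by auto
        have "d (homogeneous 0 (fun_form f)) 1 = form_diff 0 (fun_form f)"
          \<comment> \<open>The equivalence assumed for \<open>d\<close> is taken at
            \<open>\<theta> = form_diff 0 (fun_form f)\<close>; its right-hand side is the
            characterisation of that form, read off from a trivial equality. Positive degrees are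
            treated alike.\<close>
          by (rule iffD2[OF spec[OF bspec[OF d1 f(1)]]]) (rule iffD1[OF form_diff_function[OF f(1)] refl])
        then show ?thesis using True f(2) by simp
      next
        case False
        then have "1 \<le> p" by simp
        show ?thesis
          by (rule iffD2[OF spec[OF bspec[OF mp[OF spec[OF d2] \<open>1 \<le> p\<close>] \<eta>]]])
            (rule iffD1[OF form_diff_formula[OF \<eta>] refl])
      qed
      then show "d (homogeneous (int p) \<eta>) (int p + 1) = ext_diff (homogeneous (int p) \<eta>) (int p + 1)"
        by (simp only: ext_diff_homogeneous[OF \<eta>])
    qed
  qed
qed

end
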